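(* Let $X=\mathbb{OP}^2=E_6^{\mathrm{sc}}/P_6$ be the Cayley plane, and fix the reduced expression $$w^P=s_1s_3s_4s_2s_5s_6s_4s_5s_3s_4s_2s_1s_3s_4s_5s_6 .$$ Then $w'$ has the (unique) reduced expression $w'=s_1s_3s_4s_5s_6$, and for $z=u_+t\bar w_Pu_-\in\mathcal{Z}_P^\circ$ with $u_+\in U_+^\vee$, $t\in T^P$ and $(u_-)^{-1}=y_1^\vee(-a_1)y_3^\vee(-a_2)\cdots y_6^\vee(-a_{16})$ (the sequence of indices being that of the fixed reduced expression of $w^P$, $a_i\in\mathbb{C}^*$) and $q=\alpha_6^\vee(t)$, the restriction of the potential to $\mathcal{Z}_P^\circ$ is $$\mathcal{W}_{\mathcal{Z}_P^\circ}(z)=\sum_{i=1}^{16}a_i+q\,\frac{P(a_i)}{\prod_{i=1}^{16}a_i},$$ where $$\begin{aligned}P(a_i)={}&a_1a_2a_3a_5a_6+a_1a_2a_3a_5a_{16}+a_1a_2a_3a_8a_{16}+a_1a_2a_7a_8a_{16}\\&+a_1a_2a_3a_{15}a_{16}+a_1a_2a_7a_{15}a_{16}+a_1a_2a_{10}a_{15}a_{16}+a_1a_9a_{10}a_{15}a_{16}\\&+a_1a_2a_{14}a_{15}a_{16}+a_1a_9a_{14}a_{15}a_{16}+a_1a_{13}a_{14}a_{15}a_{16}+a_{12}a_{13}a_{14}a_{15}a_{16}.\end{aligned}$$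
   Context: $G=E_6^{\mathrm{sc}}$ is the simply-connected simple complex algebraic group of type $E_6$, with Dynkin diagram numbered so that $1-3-4-5-6$ is a chain and vertex $2$ is attached to vertex $4$. $P=P_6$ is the maximal parabolic subgroup attached to vertex $k=6$ (its Lie algebra is generated by all Chevalley generators $e_i,h_i$ and by the $f_j$ with $j\ne6$). $G^\vee$ is the Langlands dual group (the adjoint group of type $E_6$), with maximal torus $T^\vee$, simple roots $\alpha_1^\vee,\dots,\alpha_6^\vee$ (the simple coroots of $G$, viewed as characters of $T^\vee$), opposite Borel subgroups $B_\pm^\vee$ with unipotent radicals $U_\pm^\vee$, and Chevalley generators $e_i^\vee,f_i^\vee,h_i^\vee$. Put $x_i^\vee(a)=\exp(ae_i^\vee)$, $y_i^\vee(a)=\exp(af_i^\vee)$. $W$ is the Weyl group with simple reflections $s_i$ and longest element $w_0$; $W_P=\langle s_i\mid i\neq 6\rangle$ has longest element $w_P$; $W^P$ is the set of minimal length representatives of $W/W_P$; $w^P\in W^P$ is the representative of $w_0W_P$; $w''\in W^P$ is the representative of $w_Ps_6W_P$; $w'=w^P(w'')^{-1}$. Put $\dot s_i=x_i^\vee(1)y_i^\vee(-1)x_i^\vee(1)$, $\bar s_i=\dot s_i^{-1}=x_i^\vee(-1)y_i^\vee(1)x_i^\vee(-1)$, and $\dot w=\dot s_{i_1}\cdots\dot s_{i_d}$, $\bar w=\bar s_{i_1}\cdots\bar s_{i_d}$ for a reduced expression $w=s_{i_1}\cdots s_{i_d}$. $T^P=(T^\vee)^{W_P}$ for the action $(w,t)\mapsto\dot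 wt\dot w^{-1}$. $\mathcal{Z}_P^\vee=B_-^\vee\bar w_0^{-1}\cap U_+^\vee T^P\bar w_PU_-^\vee$ and $U_-^P=U_-^\vee\cap B_+^\vee\bar w_P\bar w_0B_+^\vee$; every $z\in\mathcal{Z}_P^\vee$ has a unique decomposition $z=u_+t\bar w_Pu_-$ with $u_+\in U_+^\vee$, $t\in T^P$, $u_-\in U_-^P$. The potential $\mathcal{W}_{\mathcal{Z}_P^\vee}:\mathcal{Z}_P^\vee\to\mathbb{C}$ is $z\mapsto\sum_i(e_i^\vee)^*(u_+^{-1})+\sum_i(f_i^\vee)^*(u_-)$ for this decomposition, where $(e_i^\vee)^*:U_+^\vee\to\mathbb{C}$, $(f_i^\vee)^*:U_-^\vee\to\mathbb{C}$ are the group homomorphisms with $(e_i^\vee)^*(x_j^\vee(a))=a\delta_{ij}=(f_i^\vee)^*(y_j^\vee(a))$. Writing the fixed reduced expression as $w^P=s_{r_1}\cdots s_{r_{16}}$, $U_-^\circ=\{y^\vee_{r_{16}}(a_{16})\cdots y^\vee_{r_1}(a_1)\mid a_i\in\mathbb{C}^*\}\subset U_-^P$, and $\mathcal{Z}_P^\circ=B_-^\vee\bar w_0^{-1}\cap U_+^\vee T^P\bar w_PU_-^\circ$; $\mathcal{W}_{\mathcal{Z}_P^\circ}$ is the restriction of $\mathcal{W}_{\mathcal{Z}_P^\vee}$ to $\mathcal{Z}_P^\circ$. *)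

theory Defs
  imports "HOL-Analysis.Analysis" "HOL-Algebra.Generated_Groups"
begin

section \<open>The root system of type E6\<close>

datatype e6_node = N1 | N2 | N3 | N4 | N5 | N6

lemma UNIV_e6_node: "UNIV = {N1, N2, N3, N4, N5, N6}"
  using e6_node.exhaust by blast

instance e6_node :: finite
  by standard (simp add: UNIV_e6_node)

text \<open>The edges of the Dynkin diagram, each with one (arbitrary) orientation. The orientation
  only enters the signs of the structure constants below.\<close>

definition e6_edges :: "(e6_node \<times> e6_node) set" where
  "e6_edges = {(N1, N3), (N3, N4), (N4, N5), (N5, N6), (N2, N4)}"

definition e6_cartan :: "e6_node \<Rightarrow> e6_node \<Rightarrow> int" where
  "e6_cartan i j =
     (if i = j then 2 else if (i, j) \<in> e6_edges \<or> (j, i) \<in> e6_edges then - 1 else 0)"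

text \<open>The root lattice of the dual group is \<open>int ^ e6_node\<close>, in coordinates with respect to the
  simple roots of the dual group (that is, the simple coroots of the simply-connected group; the
  Cartan matrix is symmetric). Since the type is simply laced, its roots are exactly the lattice
  vectors of square length 2.\<close>

definition e6_form :: "int ^ e6_node \<Rightarrow> int ^ e6_node \<Rightarrow> int" where
  "e6_form v w = (\<Sum>i\<in>UNIV. \<Sum>j\<in>UNIV. v $ i * e6_cartan i j * w $ j)"

definition simple_root :: "e6_node \<Rightarrow> int ^ e6_node" where
  "simple_root i = axis i 1"

lemma e6_form_self:
  "e6_form v v = 2 * ((v$N1)^2 + (v$N2)^2 + (v$N3)^2 + (v$N4)^2 + (v$N5)^2 + (v$N6)^2
     - v$N1 * v$N3 - v$N3 * v$N4 - v$N4 * v$N5 - v$N5 * v$N6 - v$N2 * v$N4)"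
  by (simp add: e6_form_def UNIV_e6_node e6_cartan_def e6_edges_def power2_eq_square algebra_simps)

lemma e6_form_simple_root: "e6_form (simple_root i) (simple_root i) = 2"
  by (cases i) (simp_all add: e6_form_self simple_root_def axis_def)

typedef e6_root = "{v :: int ^ e6_node. e6_form v v = 2}"
  morphisms root_vec Root
  using e6_form_simple_root by blast

lemma finite_e6_roots: "finite {v :: int ^ e6_node. e6_form v v = 2}"
proof -
  have bound: "v $ i \<in> {-3..3}" if "e6_form v v = 2" for v :: "int ^ e6_node" and i
  proof -
    have sos: "3 * (2 * v$N1 - v$N3)^2 + (3 * v$N3 - 2 * v$N4)^2 + 3 * (2 * v$N6 - v$N5)^2
        + (3 * v$N5 - 2 * v$N4)^2 + 3 * (2 * v$N2 - v$N4)^2 + (v$N4)^2 = 12"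
      using that by (simp add: e6_form_self power2_eq_square algebra_simps)
    have sq: "\<bar>y\<bar> \<le> 3" if "y^2 \<le> 12" for y :: int
    proof (rule ccontr)
      assume "\<not> \<bar>y\<bar> \<le> 3"
      then have "4^2 \<le> \<bar>y\<bar>^2" by (intro power_mono) auto
      with that show False by simp
    qed
    note nonneg = zero_le_power2[of "2 * v$N1 - v$N3"] zero_le_power2[of "3 * v$N3 - 2 * v$N4"]
      zero_le_power2[of "2 * v$N6 - v$N5"] zero_le_power2[of "3 * v$N5 - 2 * v$N4"]
      zero_le_power2[of "2 * v$N2 - v$N4"] zero_le_power2[of "v$N4"]
    have "\<bar>2 * v$N1 - v$N3\<bar> \<le> 3" "\<bar>3 * v$N3 - 2 * v$N4\<bar> \<le> 3" "\<bar>2 * v$N6 - v$N5\<bar> \<le> 3"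
      "\<bar>3 * v$N5 - 2 * v$N4\<bar> \<le> 3" "\<bar>2 * v$N2 - v$N4\<bar> \<le> 3" "\<bar>v$N4\<bar> \<le> 3"
      by (rule sq, use sos nonneg in linarith)+
    then show ?thesis by (cases i) auto
  qed
  have "finite (vec_lambda ` (UNIV \<rightarrow>\<^sub>E {-3..3}) :: (int ^ e6_node) set)"
    by (intro finite_imageI finite_PiE) auto
  moreover have "{v. e6_form v v = 2} \<subseteq> vec_lambda ` (UNIV \<rightarrow>\<^sub>E {-3..3})"
  proof
    fix v :: "int ^ e6_node" assume "v \<in> {v. e6_form v v = 2}"
    then have "($) v \<in> UNIV \<rightarrow>\<^sub>E {-3..3}" using bound by auto
    then show "v \<in> vec_lambda ` (UNIV \<rightarrow>\<^sub>E {-3..3})"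
      by (metis image_eqI vec_nth_inverse)
  qed
  ultimately show ?thesis by (rule finite_subset[rotated])
qed

instance e6_root :: finite
proof
  have "finite (root_vec ` (UNIV :: e6_root set))"
    using finite_e6_roots by (simp add: type_definition.Rep_range[OF type_definition_e6_root])
  then show "finite (UNIV :: e6_root set)"
    by (rule finite_imageD) (simp add: inj_on_def root_vec_inject)
qed

definition positive_root :: "e6_root \<Rightarrow> bool" where
  "positive_root \<alpha> \<longleftrightarrow> (\<forall>i. 0 \<le> root_vec \<alpha> $ i)"

definition negative_root :: "e6_root \<Rightarrow> bool" where
  "negative_root \<alpha> \<longleftrightarrow> (\<forall>i. root_vec \<alpha> $ i \<le> 0)"


section \<open>The Weyl group\<close>

definition simple_refl :: "e6_node \<Rightarrow> int ^ e6_node \<Rightarrow> int ^ e6_node" where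
  "simple_refl i v = v - e6_form v (simple_root i) *s simple_root i"

definition weyl_word :: "e6_node list \<Rightarrow> int ^ e6_node \<Rightarrow> int ^ e6_node" where
  "weyl_word is = foldr (\<circ>) (map simple_refl is) id"

text \<open>The subgroup generated by the simple reflections indexed by \<open>J\<close> (these are involutions,
  so words suffice).\<close>

definition parabolic :: "e6_node set \<Rightarrow> (int ^ e6_node \<Rightarrow> int ^ e6_node) set" where
  "parabolic J = {weyl_word is | is. set is \<subseteq> J}"

definition weyl_group :: "(int ^ e6_node \<Rightarrow> int ^ e6_node) set" where
  "weyl_group = parabolic UNIV"

definition weyl_P :: "(int ^ e6_node \<Rightarrow> int ^ e6_node) set" where
  "weyl_P = parabolic (UNIV - {N6})"

definition weyl_length :: "(int ^ e6_node \<Rightarrow> int ^ e6_node) \<Rightarrow> nat" where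
  "weyl_length w = (LEAST n. \<exists>is. length is = n \<and> weyl_word is = w)"

definition reduced_expr :: "e6_node list \<Rightarrow> (int ^ e6_node \<Rightarrow> int ^ e6_node) \<Rightarrow> bool" where
  "reduced_expr is w \<longleftrightarrow> weyl_word is = w \<and> length is = weyl_length w"

definition longest_in ::
  "(int ^ e6_node \<Rightarrow> int ^ e6_node) set \<Rightarrow> int ^ e6_node \<Rightarrow> int ^ e6_node" where
  "longest_in S = (THE w. w \<in> S \<and> (\<forall>v\<in>S. weyl_length v \<le> weyl_length w))"

definition w_0 :: "int ^ e6_node \<Rightarrow> int ^ e6_node" where
  "w_0 = longest_in weyl_group"

definition w_P :: "int ^ e6_node \<Rightarrow> int ^ e6_node" where
  "w_P = longest_in weyl_P"

definition min_coset_reps :: "(int ^ e6_node \<Rightarrow> int ^ e6_node) set" where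
  "min_coset_reps = {w \<in> weyl_group. \<forall>u\<in>weyl_P. weyl_length w \<le> weyl_length (w \<circ> u)}"

definition min_rep ::
  "(int ^ e6_node \<Rightarrow> int ^ e6_node) \<Rightarrow> int ^ e6_node \<Rightarrow> int ^ e6_node" where
  "min_rep w = (THE v. v \<in> min_coset_reps \<and> v \<in> {w \<circ> u | u. u \<in> weyl_P})"

text \<open>These are $w^P$, $w''$ and $w'$.\<close>

definition w_upper_P :: "int ^ e6_node \<Rightarrow> int ^ e6_node" where
  "w_upper_P = min_rep w_0"

definition w_double_prime :: "int ^ e6_node \<Rightarrow> int ^ e6_node" where
  "w_double_prime = min_rep (w_P \<circ> simple_refl N6)"

definition w_prime :: "int ^ e6_node \<Rightarrow> int ^ e6_node" where
  "w_prime = w_upper_P \<circ> inv_into UNIV w_double_prime"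


section \<open>The Lie algebra\<close>

text \<open>The complex simple Lie algebra of type E6 in the Frenkel-Kac form (Kac, Infinite-dimensional
  Lie algebras, 7.8): it has basis \<open>H i\<close> (the simple coroots) and \<open>E \<alpha>\<close> (one vector for
  every root), with \<open>[E \<alpha>, E \<beta>] = \<epsilon>(\<alpha>, \<beta>) E (\<alpha> + \<beta>)\<close> if \<open>\<alpha> + \<beta>\<close> is a root and
  \<open>[E \<alpha>, E (- \<alpha>)] = - \<alpha>\<close>, where the bimultiplicative sign \<open>\<epsilon>\<close> satisfies
  \<open>\<epsilon>(\<alpha>, \<alpha>) = (- 1) ^ ((\<alpha>, \<alpha>) / 2)\<close>.\<close>

datatype e6_basis = H e6_node | E e6_root

lemma UNIV_e6_basis: "UNIV = range H \<union> range E"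
  by (auto intro: e6_basis.exhaust)

instance e6_basis :: finite
  by standard (simp add: UNIV_e6_basis)

type_synonym e6_lie = "complex ^ e6_basis"

definition e6_eps :: "int ^ e6_node \<Rightarrow> int ^ e6_node \<Rightarrow> complex" where
  "e6_eps v w =
     (if even ((\<Sum>i\<in>UNIV. v $ i * w $ i) + (\<Sum>(i, j)\<in>e6_edges. v $ i * w $ j)) then 1 else - 1)"

fun basis_bracket :: "e6_basis \<Rightarrow> e6_basis \<Rightarrow> e6_lie" where
  "basis_bracket (H i) (H j) = 0"
| "basis_bracket (H i) (E \<beta>) =
     of_int (e6_form (simple_root i) (root_vec \<beta>)) *s axis (E \<beta>) 1"
| "basis_bracket (E \<alpha>) (H j) =
     - of_int (e6_form (simple_root j) (root_vec \<alpha>)) *s axis (E \<alpha>) 1"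
| "basis_bracket (E \<alpha>) (E \<beta>) =
     (if root_vec \<alpha> + root_vec \<beta> = 0
      then - (\<Sum>i\<in>UNIV. of_int (root_vec \<alpha> $ i) *s axis (H i) 1)
      else if root_vec \<alpha> + root_vec \<beta> \<in> range root_vec
      then e6_eps (root_vec \<alpha>) (root_vec \<beta>) *s axis (E (Root (root_vec \<alpha> + root_vec \<beta>))) 1
      else 0)"

definition bracket :: "e6_lie \<Rightarrow> e6_lie \<Rightarrow> e6_lie" where
  "bracket x y = (\<Sum>b\<in>UNIV. \<Sum>c\<in>UNIV. (x $ b * y $ c) *s basis_bracket b c)"

definition root_vector :: "e6_root \<Rightarrow> e6_lie" where
  "root_vector \<alpha> = axis (E \<alpha>) 1"

text \<open>The sign makes $[e_i, f_i] = h_i$ and $h_i$ the basis vector \<open>H i\<close>.\<close>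

definition chev_e :: "e6_node \<Rightarrow> e6_lie" where
  "chev_e i = root_vector (Root (simple_root i))"

definition chev_f :: "e6_node \<Rightarrow> e6_lie" where
  "chev_f i = - root_vector (Root (- simple_root i))"


section \<open>The adjoint group\<close>

definition GL_e6 :: "(e6_lie \<Rightarrow> e6_lie) monoid" where
  "GL_e6 = \<lparr>carrier = {g. Vector_Spaces.linear (*s) (*s) g \<and> bij g}, mult = (\<circ>), one = id\<rparr>"

text \<open>\<open>exp_ad x\<close> is the exponential of the endomorphism \<open>ad x\<close>.\<close>

definition exp_ad :: "e6_lie \<Rightarrow> e6_lie \<Rightarrow> e6_lie" where
  "exp_ad x v = suminf (\<lambda>n. (1 / fact n) *\<^sub>R (bracket x ^^ n) v)"

text \<open>The characters of the maximal torus of the adjoint group form the root lattice, so its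
  points are the families \<open>c\<close> of nonzero values of the simple roots.\<close>

definition torus_elt :: "(e6_node \<Rightarrow> complex) \<Rightarrow> e6_lie \<Rightarrow> e6_lie" where
  "torus_elt c v = (\<chi> b. case b of
      H i \<Rightarrow> v $ b
    | E \<alpha> \<Rightarrow> (\<Prod>i\<in>UNIV. c i powi (root_vec \<alpha> $ i)) * v $ b)"

definition torus :: "(e6_lie \<Rightarrow> e6_lie) set" where
  "torus = {torus_elt c | c. \<forall>i. c i \<noteq> 0}"

text \<open>The simple root \<open>i\<close> as a character of the torus.\<close>

definition root_char :: "e6_node \<Rightarrow> (e6_lie \<Rightarrow> e6_lie) \<Rightarrow> complex" where
  "root_char i t = (THE c. t (chev_e i) = c *s chev_e i)"

definition root_subgroup :: "e6_root \<Rightarrow> (e6_lie \<Rightarrow> e6_lie) set" where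
  "root_subgroup \<alpha> = {exp_ad (a *s root_vector \<alpha>) | a. True}"

definition G_ad :: "(e6_lie \<Rightarrow> e6_lie) monoid" where
  "G_ad = GL_e6\<lparr>carrier := generate GL_e6 (torus \<union> (\<Union>\<alpha>. root_subgroup \<alpha>))\<rparr>"

definition U_plus :: "(e6_lie \<Rightarrow> e6_lie) set" where
  "U_plus = generate G_ad (\<Union>\<alpha>\<in>{\<alpha>. positive_root \<alpha>}. root_subgroup \<alpha>)"

definition U_minus :: "(e6_lie \<Rightarrow> e6_lie) set" where
  "U_minus = generate G_ad (\<Union>\<alpha>\<in>{\<alpha>. negative_root \<alpha>}. root_subgroup \<alpha>)"

definition B_plus :: "(e6_lie \<Rightarrow> e6_lie) set" where
  "B_plus = generate G_ad (torus \<union> U_plus)"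

definition B_minus :: "(e6_lie \<Rightarrow> e6_lie) set" where
  "B_minus = generate G_ad (torus \<union> U_minus)"

definition x_sub :: "e6_node \<Rightarrow> complex \<Rightarrow> e6_lie \<Rightarrow> e6_lie" where
  "x_sub i a = exp_ad (a *s chev_e i)"

definition y_sub :: "e6_node \<Rightarrow> complex \<Rightarrow> e6_lie \<Rightarrow> e6_lie" where
  "y_sub i a = exp_ad (a *s chev_f i)"

definition gprod :: "(e6_lie \<Rightarrow> e6_lie) list \<Rightarrow> e6_lie \<Rightarrow> e6_lie" where
  "gprod gs = foldr (\<otimes>\<^bsub>G_ad\<^esub>) gs \<one>\<^bsub>G_ad\<^esub>"

definition s_dot :: "e6_node \<Rightarrow> e6_lie \<Rightarrow> e6_lie" where
  "s_dot i = gprod [x_sub i 1, y_sub i (- 1), x_sub i 1]"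

definition s_bar :: "e6_node \<Rightarrow> e6_lie \<Rightarrow> e6_lie" where
  "s_bar i = inv\<^bsub>G_ad\<^esub> s_dot i"

text \<open>By the braid relations, the two lifts do not depend on the reduced expression.\<close>

definition w_dot :: "(int ^ e6_node \<Rightarrow> int ^ e6_node) \<Rightarrow> e6_lie \<Rightarrow> e6_lie" where
  "w_dot w = gprod (map s_dot (SOME is. reduced_expr is w))"

definition w_bar :: "(int ^ e6_node \<Rightarrow> int ^ e6_node) \<Rightarrow> e6_lie \<Rightarrow> e6_lie" where
  "w_bar w = gprod (map s_bar (SOME is. reduced_expr is w))"

definition T_P :: "(e6_lie \<Rightarrow> e6_lie) set" where
  "T_P = {t \<in> torus. \<forall>w\<in>weyl_P. w_dot w \<otimes>\<^bsub>G_ad\<^esub> t \<otimes>\<^bsub>G_ad\<^esub> inv\<^bsub>G_ad\<^esub> w_dot w = t}"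


section \<open>The mirror variety and its potential\<close>

definition U_minus_P :: "(e6_lie \<Rightarrow> e6_lie) set" where
  "U_minus_P = U_minus \<inter>
     (B_plus #>\<^bsub>G_ad\<^esub> (w_bar w_P \<otimes>\<^bsub>G_ad\<^esub> w_bar w_0) <#>\<^bsub>G_ad\<^esub> B_plus)"

definition Z_P :: "(e6_lie \<Rightarrow> e6_lie) set" where
  "Z_P = (B_minus #>\<^bsub>G_ad\<^esub> inv\<^bsub>G_ad\<^esub> w_bar w_0) \<inter>
     (U_plus <#>\<^bsub>G_ad\<^esub> T_P #>\<^bsub>G_ad\<^esub> w_bar w_P <#>\<^bsub>G_ad\<^esub> U_minus)"

text \<open>For a word \<open>rs\<close> = $(r_1, \dots, r_d)$: the products
  $y_{r_d}(a_d) \cdots y_{r_1}(a_1)$ with nonzero $a_k$. List positions start at 0.\<close>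

definition U_minus_circ :: "e6_node list \<Rightarrow> (e6_lie \<Rightarrow> e6_lie) set" where
  "U_minus_circ rs = {gprod (map (\<lambda>k. y_sub (rs ! (k - 1)) (a k)) (rev [1..<length rs + 1])) | a.
     \<forall>k\<in>{1..length rs}. a k \<noteq> 0}"

definition Z_P_circ :: "e6_node list \<Rightarrow> (e6_lie \<Rightarrow> e6_lie) set" where
  "Z_P_circ rs = (B_minus #>\<^bsub>G_ad\<^esub> inv\<^bsub>G_ad\<^esub> w_bar w_0) \<inter>
     (U_plus <#>\<^bsub>G_ad\<^esub> T_P #>\<^bsub>G_ad\<^esub> w_bar w_P <#>\<^bsub>G_ad\<^esub> U_minus_circ rs)"

definition additive_C :: "complex monoid" where
  "additive_C = \<lparr>carrier = UNIV, mult = (+), one = 0\<rparr>"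

definition e_star :: "e6_node \<Rightarrow> (e6_lie \<Rightarrow> e6_lie) \<Rightarrow> complex" where
  "e_star i = (THE \<phi>. \<phi> \<in> hom (G_ad\<lparr>carrier := U_plus\<rparr>) additive_C \<inter> extensional U_plus \<and>
     (\<forall>j a. \<phi> (x_sub j a) = (if i = j then a else 0)))"

definition f_star :: "e6_node \<Rightarrow> (e6_lie \<Rightarrow> e6_lie) \<Rightarrow> complex" where
  "f_star i = (THE \<phi>. \<phi> \<in> hom (G_ad\<lparr>carrier := U_minus\<rparr>) additive_C \<inter> extensional U_minus \<and>
     (\<forall>j a. \<phi> (y_sub j a) = (if i = j then a else 0)))"

definition Z_decomp :: "(e6_lie \<Rightarrow> e6_lie) \<Rightarrow>
    (e6_lie \<Rightarrow> e6_lie) \<times> (e6_lie \<Rightarrow> e6_lie) \<times> (e6_lie \<Rightarrow> e6_lie)" where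
  "Z_decomp z = (THE (up, t, um). up \<in> U_plus \<and> t \<in> T_P \<and> um \<in> U_minus_P \<and>
     z = up \<otimes>\<^bsub>G_ad\<^esub> t \<otimes>\<^bsub>G_ad\<^esub> w_bar w_P \<otimes>\<^bsub>G_ad\<^esub> um)"

definition potential :: "(e6_lie \<Rightarrow> e6_lie) \<Rightarrow> complex" where
  "potential = (\<lambda>z\<in>Z_P. case Z_decomp z of (up, t, um) \<Rightarrow>
     (\<Sum>i\<in>UNIV. e_star i (inv\<^bsub>G_ad\<^esub> up)) + (\<Sum>i\<in>UNIV. f_star i um))"

definition potential_circ :: "e6_node list \<Rightarrow> (e6_lie \<Rightarrow> e6_lie) \<Rightarrow> complex" where
  "potential_circ rs = restrict potential (Z_P_circ rs)"


section \<open>The polynomial in the numerator of the quantum term\<close>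

definition cayley_poly :: "(nat \<Rightarrow> complex) \<Rightarrow> complex" where
  "cayley_poly a =
     a 1 * a 2 * a 3 * a 5 * a 6 + a 1 * a 2 * a 3 * a 5 * a 16
   + a 1 * a 2 * a 3 * a 8 * a 16 + a 1 * a 2 * a 7 * a 8 * a 16
   + a 1 * a 2 * a 3 * a 15 * a 16 + a 1 * a 2 * a 7 * a 15 * a 16
   + a 1 * a 2 * a 10 * a 15 * a 16 + a 1 * a 9 * a 10 * a 15 * a 16
   + a 1 * a 2 * a 14 * a 15 * a 16 + a 1 * a 9 * a 14 * a 15 * a 16
   + a 1 * a 13 * a 14 * a 15 * a 16 + a 12 * a 13 * a 14 * a 15 * a 16"

end

theory Submission
  imports Defs
begin

text \<open>The 27-dimensional minuscule representation (lattice vectors of square length 4/3) is faithful on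
  the Lie algebra and every element of the adjoint group lifts to it, so identities between root
  elements reduce to identities between operators \<open>1 + a X\<close> with \<open>X\<^sup>2 = 0\<close>.

  Write \<open>u\<^sub>- = b w\<^sub>P w\<^sub>0 b'\<close> with \<open>b, b'\<close> in \<open>B\<^sub>+\<close> (a Bruhat cell computation along the reduced word).
  Comparing the cones of weights by which the factors can shift a weight vector shows that the
  decomposition \<open>z = u\<^sub>+ t w\<^sub>P u\<^sub>-\<close> is unique and that the simple-root coordinates of the inverse of \<open>u\<^sub>+\<close>
  vanish except at node 6. The remaining one is the ratio of the coefficients, at the lowest
  weight and one step above it, of the image of the lowest weight vector under \<open>t w\<^sub>P u\<^sub>- w\<^sub>0\<close>. Since \<open>w\<^sub>0\<close> sends
  that vector to the highest weight vector and \<open>w\<^sub>P\<close> exchanges the first step with the highest root, this is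
  \<open>q\<close> times a ratio of two matrix coefficients of \<open>u\<^sub>-\<close>: the lowest one uses all 16 factors, and the
  other sums over the occurrences of 1, 3, 4, 5, 6 as a subword of the reduced word.\<close>

section \<open>The root lattice\<close>

text \<open>Two obstacles shape the development. The adjoint group acts on the 27-dimensional space
  only up to scalars, and the weights of that space are not in the root lattice. Hence weights are
  stored as offsets from the lowest one, a group element is tied to an operator by a relation
  \<open>lift\<close> instead of a homomorphism, and information is extracted only from ratios of
  coefficients. The second obstacle is that \<open>w_bar\<close> uses an unspecified reduced word.
  Braid relations are bypassed: an element preserving every weight space of the adjoint
  representation lies in the torus (\<open>shape_zero_id_torus\<close>), so lifts along two words
  for the same Weyl element differ by a torus factor, which a Bruhat cell absorbs. The scalar by
  which the lift of \<open>w_0\<close> moves the lowest weight vector is only shown to be nonzero,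
  since it cancels in the ratio. The sign produced by the lift of \<open>w_P\<close> does matter,
  and it is computed for all reduced words at once by means of \<open>spin_sign\<close>.\<close>

type_synonym lattice = "int ^ e6_node"

lemma sum_e6_node: "(\<Sum>i\<in>UNIV. f i) = f N1 + f N2 + f N3 + f N4 + f N5 + f N6"
  by (simp add: UNIV_e6_node add.assoc)

lemma prod_e6_node: "(\<Prod>i\<in>UNIV. f i) = f N1 * f N2 * f N3 * f N4 * f N5 * f N6"
  by (simp add: UNIV_e6_node mult.assoc)

lemma all_e6_node: "(\<forall>i. P i) \<longleftrightarrow> P N1 \<and> P N2 \<and> P N3 \<and> P N4 \<and> P N5 \<and> P N6"
  by (metis e6_node.exhaust)

lemma simple_root_nth [simp]: "simple_root i $ j = (if i = j then 1 else 0)"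
  by (auto simp: simple_root_def axis_def)

lemma e6_form_explicit:
  "e6_form v w = 2 * (v$N1*w$N1 + v$N2*w$N2 + v$N3*w$N3 + v$N4*w$N4 + v$N5*w$N5 + v$N6*w$N6)
     - v$N1*w$N3 - v$N3*w$N1 - v$N3*w$N4 - v$N4*w$N3 - v$N4*w$N5 - v$N5*w$N4
     - v$N5*w$N6 - v$N6*w$N5 - v$N2*w$N4 - v$N4*w$N2"
  by (simp add: e6_form_def UNIV_e6_node e6_cartan_def e6_edges_def algebra_simps)

lemma e6_form_sym: "e6_form v w = e6_form w v"
  by (simp add: e6_form_explicit algebra_simps)

lemma e6_form_add_left [simp]: "e6_form (u + v) w = e6_form u w + e6_form v w"
  by (simp add: e6_form_explicit algebra_simps)
lemma e6_form_add_right [simp]: "e6_form w (u + v) = e6_form w u + e6_form w v"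
  by (simp add: e6_form_explicit algebra_simps)
lemma e6_form_diff_left [simp]: "e6_form (u - v) w = e6_form u w - e6_form v w"
  by (simp add: e6_form_explicit algebra_simps)
lemma e6_form_diff_right [simp]: "e6_form w (u - v) = e6_form w u - e6_form w v"
  by (simp add: e6_form_explicit algebra_simps)
lemma e6_form_minus_left [simp]: "e6_form (- v) w = - e6_form v w"
  by (simp add: e6_form_explicit algebra_simps)
lemma e6_form_minus_right [simp]: "e6_form w (- v) = - e6_form w v"
  by (simp add: e6_form_explicit algebra_simps)
lemma e6_form_zero_left [simp]: "e6_form 0 w = 0"
  by (simp add: e6_form_explicit)
lemma e6_form_zero_right [simp]: "e6_form w 0 = 0"
  by (simp add: e6_form_explicit)
lemma e6_form_scale_left [simp]: "e6_form (c *s v) w = c * e6_form v w"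
  by (simp add: e6_form_explicit algebra_simps)
lemma e6_form_scale_right [simp]: "e6_form w (c *s v) = c * e6_form w v"
  by (simp add: e6_form_explicit algebra_simps)

lemma e6_form_simple: 
  "e6_form (simple_root N1) v = 2 * v$N1 - v$N3"
  "e6_form (simple_root N2) v = 2 * v$N2 - v$N4"
  "e6_form (simple_root N3) v = 2 * v$N3 - v$N1 - v$N4"
  "e6_form (simple_root N4) v = 2 * v$N4 - v$N3 - v$N2 - v$N5"
  "e6_form (simple_root N5) v = 2 * v$N5 - v$N4 - v$N6"
  "e6_form (simple_root N6) v = 2 * v$N6 - v$N5"
  by (simp_all add: e6_form_explicit)

lemma e6_form_expand: "e6_form v w = (\<Sum>i\<in>UNIV. v $ i * e6_form (simple_root i) w)"
  by (simp add: sum_e6_node e6_form_simple e6_form_explicit algebra_simps)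

text \<open>Squares are completed from the ends of the three arms towards node 4; the leftover
  square of \<open>v$N4\<close> makes the form positive definite.\<close>

lemma e6_form_sos:
  "6 * e6_form v v = 3 * (2 * v$N1 - v$N3)^2 + (3 * v$N3 - 2 * v$N4)^2 + 3 * (2 * v$N6 - v$N5)^2
        + (3 * v$N5 - 2 * v$N4)^2 + 3 * (2 * v$N2 - v$N4)^2 + (v$N4)^2"
  by (simp add: e6_form_self power2_eq_square algebra_simps)

lemma e6_form_nonneg: "0 \<le> e6_form v v"
proof -
  have "0 \<le> 6 * e6_form v v" unfolding e6_form_sos by simp
  then show ?thesis by simp
qed

lemma e6_form_eq_0: "e6_form v v = 0 \<longleftrightarrow> v = 0"
proof
  assume "e6_form v v = 0"
  then have *: "3 * (2 * v$N1 - v$N3)^2 + (3 * v$N3 - 2 * v$N4)^2 + 3 * (2 * v$N6 - v$N5)^2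
        + (3 * v$N5 - 2 * v$N4)^2 + 3 * (2 * v$N2 - v$N4)^2 + (v$N4)^2 = 0"
    using e6_form_sos[of v] by simp
  note nonneg = zero_le_power2[of "2 * v$N1 - v$N3"] zero_le_power2[of "3 * v$N3 - 2 * v$N4"]
      zero_le_power2[of "2 * v$N6 - v$N5"] zero_le_power2[of "3 * v$N5 - 2 * v$N4"]
      zero_le_power2[of "2 * v$N2 - v$N4"] zero_le_power2[of "v$N4"]
  have "(2 * v$N1 - v$N3)^2 = 0" "(3 * v$N3 - 2 * v$N4)^2 = 0" "(2 * v$N6 - v$N5)^2 = 0"
     "(3 * v$N5 - 2 * v$N4)^2 = 0" "(2 * v$N2 - v$N4)^2 = 0" "(v$N4)^2 = 0"
    using * nonneg by linarith+
  then show "v = 0" by (simp add: vec_eq_iff all_e6_node)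
qed simp

lemma even_e6_form: "even (e6_form v v)"
  by (simp add: e6_form_self)

text \<open>The lattice vectors of square length 4/3 in the coset of \<open>- \<omega>\<^sub>6\<close>, written as offsets from
  \<open>- \<omega>\<^sub>6\<close>, are the weights of a 27-dimensional minuscule representation.\<close>

definition minuscule :: "lattice set" where
  "minuscule = {\<gamma>. e6_form \<gamma> \<gamma> = 2 * \<gamma> $ N6}"

text \<open>The offset \<open>\<gamma>\<close> stands for the weight
  \<open>\<gamma> - \<omega>\<^sub>6\<close>, and \<open>v $ N6\<close> is the product of
  \<open>v\<close> with \<open>\<omega>\<^sub>6\<close>; so this is the value of that weight on
  \<open>v\<close>.\<close>

definition pairing :: "lattice \<Rightarrow> lattice \<Rightarrow> int" where
  "pairing v \<gamma> = e6_form v \<gamma> - v $ N6"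

text \<open>Positivity of the form bounds the difference of the two sides below by -4/3, and
  evenness improves this to 0. Thus the minuscule weights are the shortest vectors of their
  coset.\<close>

lemma twice_coord6_le_e6_form: "2 * v $ N6 \<le> e6_form v v"
proof -
  \<comment> \<open>This is three times the sixth fundamental weight, which has denominator 3 in the
    simple roots.\<close>
  define w :: lattice where
    "w = (\<chi> i. case i of N1 \<Rightarrow> 2 | N2 \<Rightarrow> 3 | N3 \<Rightarrow> 4 | N4 \<Rightarrow> 6 | N5 \<Rightarrow> 5 | N6 \<Rightarrow> 4)"
  have "0 \<le> e6_form (3 *s v - w) (3 *s v - w)" by (rule e6_form_nonneg)
  also have "\<dots> = 9 * e6_form v v - 18 * v $ N6 + 12"
    by (simp add: e6_form_explicit w_def algebra_simps)
  finally have "- 2 < e6_form v v - 2 * v $ N6" by simp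
  moreover have "even (e6_form v v - 2 * v $ N6)" using even_e6_form by simp
  ultimately show ?thesis by (elim evenE) arith
qed

section \<open>Roots, their mutual products and their signs\<close>

definition lat_nonneg :: "lattice \<Rightarrow> bool" where
  "lat_nonneg v \<longleftrightarrow> (\<forall>i. 0 \<le> v $ i)"

definition is_root :: "lattice \<Rightarrow> bool" where
  "is_root v \<longleftrightarrow> e6_form v v = 2"

lemma is_root_root_vec [simp]: "is_root (root_vec \<alpha>)"
  using root_vec[of \<alpha>] by (simp add: is_root_def)

lemma root_vec_Root [simp]: "is_root v \<Longrightarrow> root_vec (Root v) = v"
  by (simp add: Root_inverse is_root_def)

lemma range_root_vec: "range root_vec = {v. is_root v}"
  using type_definition.Rep_range[OF type_definition_e6_root] by (simp add: is_root_def)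

lemma finite_roots: "finite {v. is_root v}"
  using finite_e6_roots by (simp add: is_root_def)

lemma is_root_simple [simp]: "is_root (simple_root i)"
  by (simp add: is_root_def e6_form_simple_root)

lemma is_root_uminus [simp]: "is_root (- v) \<longleftrightarrow> is_root v"
  by (simp add: is_root_def)

lemma is_root_nonzero: "is_root v \<Longrightarrow> v \<noteq> 0"
  by (auto simp: is_root_def)

lemma lat_nonneg_simple [simp]: "lat_nonneg (simple_root i)"
  by (simp add: lat_nonneg_def)

lemma not_lat_nonneg_uminus_simple [simp]: "\<not> lat_nonneg (- simple_root i)"
  by (auto simp: lat_nonneg_def)

lemma root_form_bounds:
  assumes "is_root v" "is_root w"
  shows "- 2 \<le> e6_form v w" "e6_form v w \<le> 2"
    "e6_form v w = 2 \<longleftrightarrow> v = w" "e6_form v w = - 2 \<longleftrightarrow> v = - w"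
proof -
  have m: "e6_form (v - w) (v - w) = 4 - 2 * e6_form v w"
    and p: "e6_form (v + w) (v + w) = 4 + 2 * e6_form v w"
    using assms e6_form_sym[of w v] by (simp_all add: is_root_def)
  show "- 2 \<le> e6_form v w" "e6_form v w \<le> 2"
    using m p e6_form_nonneg[of "v - w"] e6_form_nonneg[of "v + w"] by linarith+
  have "e6_form v w = 2 \<longleftrightarrow> e6_form (v - w) (v - w) = 0" using m by linarith
  then show "e6_form v w = 2 \<longleftrightarrow> v = w" unfolding e6_form_eq_0 by simp
  have "e6_form v w = - 2 \<longleftrightarrow> e6_form (v + w) (v + w) = 0" using p by linarith
  then show "e6_form v w = - 2 \<longleftrightarrow> v = - w" unfolding e6_form_eq_0
    by (simp add: eq_neg_iff_add_eq_0)
qed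

lemma is_root_add_iff:
  assumes "is_root v" "is_root w"
  shows "is_root (v + w) \<longleftrightarrow> e6_form v w = - 1"
  using assms e6_form_sym[of w v] by (auto simp: is_root_def)

text \<open>The two parts have disjoint supports, so only off-diagonal Cartan entries, which are
  nonpositive, enter \<open>e6_form p n\<close>. The splitting serves both roots and minuscule
  weights.\<close>

lemma lattice_parts:
  obtains p n where "v = p - n" "lat_nonneg p" "lat_nonneg n" "e6_form p n \<le> 0"
    "\<And>i. p $ i = max (v $ i) 0" "\<And>i. n $ i = max (- v $ i) 0"
proof
  define p n where "p = (\<chi> i. max (v $ i) 0)" and "n = (\<chi> i. max (- v $ i) 0)"
  show pi: "\<And>i. p $ i = max (v $ i) 0" and ni: "\<And>i. n $ i = max (- v $ i) 0"
    by (simp_all add: p_def n_def)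
  show "v = p - n" by (auto simp: vec_eq_iff pi ni)
  show p0: "lat_nonneg p" and n0: "lat_nonneg n" by (auto simp: lat_nonneg_def pi ni)
  have z: "p $ i * n $ i = 0" for i by (simp add: pi ni max_def)
  have c: "0 \<le> p $ i * n $ j" for i j using p0 n0 by (simp add: lat_nonneg_def)
  show "e6_form p n \<le> 0"
    unfolding e6_form_explicit z
    using c[of N1 N3] c[of N3 N1] c[of N3 N4] c[of N4 N3] c[of N4 N5] c[of N5 N4]
      c[of N5 N6] c[of N6 N5] c[of N2 N4] c[of N4 N2] by (simp only: mult_zero_right add_0_right)
qed

text \<open>Two nonzero parts would contribute at least 2 each, because the form is even and
  positive definite, while the whole square length is 2.\<close>

lemma root_sign: 
  assumes "is_root v"
  shows "lat_nonneg v \<or> lat_nonneg (- v)"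
proof -
  obtain p n where v: "v = p - n" and pn: "lat_nonneg p" "lat_nonneg n" "e6_form p n \<le> 0"
    by (rule lattice_parts)
  have "e6_form v v = e6_form p p + e6_form n n - 2 * e6_form p n"
    unfolding v by (simp add: e6_form_sym[of n p])
  then have le: "e6_form p p + e6_form n n \<le> 2" using assms pn(3) by (simp add: is_root_def)
  have "p = 0 \<or> n = 0"
  proof (rule ccontr)
    assume "\<not> ?thesis"
    then have "e6_form p p \<noteq> 0" "e6_form n n \<noteq> 0" by (auto simp: e6_form_eq_0)
    then have "e6_form p p > 0" "e6_form n n > 0"
      using e6_form_nonneg[of p] e6_form_nonneg[of n] by linarith+
    then have "e6_form p p = 1" using le by linarith
    then show False using even_e6_form[of p] by simp
  qed
  then show ?thesis using pn v by (auto simp: lat_nonneg_def)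
qed

lemma lat_nonneg_antisym: "lat_nonneg v \<Longrightarrow> lat_nonneg (- v) \<Longrightarrow> v = 0"
  by (auto simp: lat_nonneg_def vec_eq_iff intro: antisym)

lemma root_neg_iff: "is_root v \<Longrightarrow> lat_nonneg (- v) \<longleftrightarrow> \<not> lat_nonneg v"
  using root_sign lat_nonneg_antisym is_root_nonzero by blast

text \<open>The positive part already satisfies \<open>twice_coord6_le_e6_form\<close>, which leaves
  nothing for the negative part. Hence offset 0 is the lowest weight.\<close>

lemma minuscule_nonneg:
  assumes "\<gamma> \<in> minuscule"
  shows "lat_nonneg \<gamma>"
proof -
  obtain p n where v: "\<gamma> = p - n" and pn: "lat_nonneg p" "lat_nonneg n" "e6_form p n \<le> 0"
    by (rule lattice_parts)
  have "e6_form \<gamma> \<gamma> = e6_form p p + e6_form n n - 2 * e6_form p n"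
    unfolding v by (simp add: e6_form_sym[of n p])
  then have "e6_form n n + 2 * n $ N6 \<le> 0" 
    using assms pn(3) twice_coord6_le_e6_form[of p] by (simp add: minuscule_def v)
  moreover have "0 \<le> n $ N6" using pn by (simp add: lat_nonneg_def)
  ultimately have "e6_form n n = 0" using e6_form_nonneg[of n] by linarith
  then show ?thesis using v pn e6_form_eq_0 by simp
qed

section \<open>Weight strings of the minuscule representation\<close>

lemma zero_minuscule [simp]: "0 \<in> minuscule"
  by (simp add: minuscule_def)

lemma pairing_add_left [simp]: "pairing (v + w) \<gamma> = pairing v \<gamma> + pairing w \<gamma>"
  by (simp add: pairing_def)
lemma pairing_uminus_left [simp]: "pairing (- v) \<gamma> = - pairing v \<gamma>"
  by (simp add: pairing_def)
lemma pairing_add_right: "pairing v (\<gamma> + w) = pairing v \<gamma> + e6_form v w"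
  by (simp add: pairing_def)
lemma pairing_diff_right: "pairing v (\<gamma> - w) = pairing v \<gamma> - e6_form v w"
  by (simp add: pairing_def)

lemma minuscule_add_iff:
  assumes "is_root v" "\<gamma> \<in> minuscule"
  shows "\<gamma> + v \<in> minuscule \<longleftrightarrow> pairing v \<gamma> = - 1"
  using assms e6_form_sym[of \<gamma> v] by (auto simp: minuscule_def pairing_def is_root_def)

lemma minuscule_diff_iff:
  assumes "is_root v" "\<gamma> \<in> minuscule"
  shows "\<gamma> - v \<in> minuscule \<longleftrightarrow> pairing v \<gamma> = 1"
  using assms e6_form_sym[of \<gamma> v] by (auto simp: minuscule_def pairing_def is_root_def)

text \<open>Neither \<open>\<gamma> + v\<close> nor \<open>\<gamma> - v\<close> can be shorter than
  the minimum of the coset. This is the property that gives minuscule weights their name.\<close>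

lemma pairing_bounds:
  assumes "is_root v" "\<gamma> \<in> minuscule"
  shows "- 1 \<le> pairing v \<gamma>" "pairing v \<gamma> \<le> 1"
  using assms twice_coord6_le_e6_form[of "\<gamma> + v"] twice_coord6_le_e6_form[of "\<gamma> - v"]
    e6_form_sym[of \<gamma> v]
  by (simp_all add: minuscule_def pairing_def is_root_def)

section \<open>The Weyl group\<close>

lemma weyl_word_Nil [simp]: "weyl_word [] = id"
  by (simp add: weyl_word_def)
lemma weyl_word_Cons [simp]: "weyl_word (i # is) = simple_refl i \<circ> weyl_word is"
  by (simp add: weyl_word_def)
lemma weyl_word_append: "weyl_word (is @ js) = weyl_word is \<circ> weyl_word js"
  by (induction "is") (simp_all add: comp_assoc)

lemma simple_refl_simple [simp]: "simple_refl i (simple_root i) = - simple_root i"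
  using e6_form_simple_root[of i] by (simp add: simple_refl_def vec_eq_iff)

lemma simple_refl_nth: "simple_refl i v $ j = (if i = j then v $ j - e6_form v (simple_root i) else v $ j)"
  by (simp add: simple_refl_def)

lemma simple_refl_add: "simple_refl i (v + w) = simple_refl i v + simple_refl i w"
  by (simp add: simple_refl_def vec_eq_iff algebra_simps)
lemma simple_refl_uminus: "simple_refl i (- v) = - simple_refl i v"
  by (simp add: simple_refl_def vec_eq_iff algebra_simps)
lemma simple_refl_scale: "simple_refl i (c *s v) = c *s simple_refl i v"
  by (simp add: simple_refl_def vec_eq_iff algebra_simps)
lemma simple_refl_involution [simp]: "simple_refl i (simple_refl i v) = v"
  using e6_form_simple_root[of i] by (simp add: simple_refl_def vec_eq_iff)
lemma simple_refl_comp_self: "simple_refl i \<circ> simple_refl i = id"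
  by (simp add: fun_eq_iff)
lemma e6_form_simple_refl [simp]: "e6_form (simple_refl i v) (simple_refl i w) = e6_form v w"
  using e6_form_simple_root[of i] e6_form_sym[of "simple_root i" w]
  by (simp add: simple_refl_def)

lemma weyl_word_add: "weyl_word is (v + w) = weyl_word is v + weyl_word is w"
  by (induction "is") (simp_all add: simple_refl_add)
lemma weyl_word_uminus: "weyl_word is (- v) = - weyl_word is v"
  by (induction "is") (simp_all add: simple_refl_uminus)
lemma weyl_word_diff: "weyl_word is (v - w) = weyl_word is v - weyl_word is w"
  using weyl_word_add[of "is" v "- w"] by (simp add: weyl_word_uminus)
lemma weyl_word_scale: "weyl_word is (c *s v) = c *s weyl_word is v"
  by (induction "is") (simp_all add: simple_refl_scale)
lemma weyl_word_zero [simp]: "weyl_word is 0 = 0"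
  using weyl_word_scale[of "is" 0 0] by simp
lemma e6_form_weyl_word [simp]: "e6_form (weyl_word is v) (weyl_word is w) = e6_form v w"
  by (induction "is") simp_all
lemma is_root_weyl_word [simp]: "is_root (weyl_word is v) \<longleftrightarrow> is_root v"
  by (simp add: is_root_def)
lemma is_root_simple_refl [simp]: "is_root (simple_refl i v) \<longleftrightarrow> is_root v"
  by (simp add: is_root_def)

lemma weyl_word_rev [simp]: "weyl_word (rev is) (weyl_word is v) = v"
  by (induction "is" arbitrary: v) (simp_all add: weyl_word_append)
lemma weyl_word_rev' [simp]: "weyl_word is (weyl_word (rev is) v) = v"
  using weyl_word_rev[of "rev is"] by simp
lemma bij_weyl_word: "bij (weyl_word is)"
  by (rule o_bij[of "weyl_word (rev is)"]) (simp_all add: fun_eq_iff)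
lemma inv_weyl_word: "inv_into UNIV (weyl_word is) = weyl_word (rev is)"
  by (rule inv_unique_comp) (simp_all add: fun_eq_iff)

lemma lattice_expand: "v = (\<Sum>i\<in>UNIV. v $ i *s simple_root i)"
  by (simp add: vec_eq_iff sum_component if_distrib[of "\<lambda>x. _ * x"] cong: if_cong)

lemma weyl_word_expand: "weyl_word is v = (\<Sum>i\<in>UNIV. v $ i *s weyl_word is (simple_root i))"
proof -
  have "weyl_word is (\<Sum>i\<in>A. v $ i *s simple_root i) = (\<Sum>i\<in>A. v $ i *s weyl_word is (simple_root i))"
    if "finite A" for A
    using that by (induction A) (simp_all add: weyl_word_add weyl_word_scale)
  from this[OF finite_class.finite_UNIV] show ?thesis using lattice_expand[of v] by simp
qed

text \<open>By linearity, every identity between explicit Weyl group elements becomes six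
  evaluations.\<close>

lemma weyl_word_eqI:
  assumes "\<And>i. weyl_word is (simple_root i) = weyl_word js (simple_root i)"
  shows "weyl_word is = weyl_word js"
proof
  fix v
  have "weyl_word is v = (\<Sum>i\<in>UNIV. v $ i *s weyl_word is (simple_root i))" by (rule weyl_word_expand)
  also have "\<dots> = (\<Sum>i\<in>UNIV. v $ i *s weyl_word js (simple_root i))" by (simp add: assms)
  also have "\<dots> = weyl_word js v" by (rule weyl_word_expand[symmetric])
  finally show "weyl_word is v = weyl_word js v" .
qed

text \<open>The reflection changes only coordinate \<open>i\<close>, and some other coordinate of
  \<open>v\<close> is positive; one positive coordinate decides the sign of a root.\<close>

lemma simple_refl_lat_nonneg:
  assumes "is_root v" "lat_nonneg v" "v \<noteq> simple_root i"
  shows "lat_nonneg (simple_refl i v)"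
proof -
  have "\<exists>j. j \<noteq> i \<and> v $ j \<noteq> 0"
  proof (rule ccontr)
    assume "\<not> ?thesis"
    then have v: "v = v $ i *s simple_root i" by (auto simp: vec_eq_iff)
    have "2 = v $ i * (v $ i * 2)"
      using assms(1) e6_form_simple_root[of i] unfolding is_root_def
      by (subst (asm) v, subst (asm) (2) v) simp
    then have "v $ i * v $ i = 1" by simp
    moreover have "0 \<le> v $ i" using assms(2) by (simp add: lat_nonneg_def)
    ultimately have "v $ i = 1" by (simp add: zmult_eq_1_iff)
    with v assms(3) show False by simp
  qed
  then obtain j where j: "j \<noteq> i" "v $ j \<noteq> 0" by blast
  then have "0 < v $ j" using assms(2) by (simp add: lat_nonneg_def order_less_le)
  then have "0 < simple_refl i v $ j" using j by (simp add: simple_refl_nth)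
  then have "\<not> lat_nonneg (- simple_refl i v)" by (auto simp: lat_nonneg_def not_le)
  then show ?thesis using root_neg_iff[of "simple_refl i v"] assms(1) by simp
qed

text \<open>The cardinality will be the length (\<open>weyl_length_eq\<close>), which replaces a
  minimum over all words by a count.\<close>

definition inversions :: "(lattice \<Rightarrow> lattice) \<Rightarrow> lattice set" where
  "inversions w = {v. is_root v \<and> lat_nonneg v \<and> \<not> lat_nonneg (w v)}"

lemma finite_inversions [simp]: "finite (inversions w)"
  by (rule finite_subset[OF _ finite_roots]) (auto simp: inversions_def)

text \<open>The inversions of \<open>w\<close> are carried along by the reflection, and
  \<open>simple_root i\<close> is the only new one.\<close>

lemma card_inversions_refl:
  assumes "w = weyl_word is" "lat_nonneg (w (simple_root i))"
  shows "card (inversions (w \<circ> simple_refl i)) = Suc (card (inversions w))"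
proof -
  have "inversions (w \<circ> simple_refl i) = insert (simple_root i) (simple_refl i ` inversions w)"
  proof (rule Set.set_eqI, rule iffI)
    fix v assume v: "v \<in> inversions (w \<circ> simple_refl i)"
    show "v \<in> insert (simple_root i) (simple_refl i ` inversions w)"
    proof (cases "v = simple_root i")
      case False
      then have "simple_refl i v \<in> inversions w"
        using v simple_refl_lat_nonneg by (auto simp: inversions_def)
      then have "simple_refl i (simple_refl i v) \<in> simple_refl i ` inversions w" by blast
      then show ?thesis by simp
    qed simp
  next
    fix v assume "v \<in> insert (simple_root i) (simple_refl i ` inversions w)"
    then show "v \<in> inversions (w \<circ> simple_refl i)"
    proof
      assume "v = simple_root i"
      moreover have "\<not> lat_nonneg (- w (simple_root i))"
        using root_neg_iff[of "w (simple_root i)"] assms by simp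
      ultimately show ?thesis by (simp add: inversions_def assms(1) weyl_word_uminus)
    next
      assume "v \<in> simple_refl i ` inversions w"
      then obtain u where u: "v = simple_refl i u" "u \<in> inversions w" by blast
      then have "u \<noteq> simple_root i" using assms(2) by (auto simp: inversions_def)
      then show ?thesis using u simple_refl_lat_nonneg[of u i] by (auto simp: inversions_def)
    qed
  qed
  moreover have "simple_root i \<notin> simple_refl i ` inversions w"
  proof
    assume "simple_root i \<in> simple_refl i ` inversions w"
    then obtain u where u: "u \<in> inversions w" "simple_refl i u = simple_root i" by force
    then have "simple_refl i (simple_refl i u) = - simple_root i" by simp
    then have "u = - simple_root i" by simp
    then show False using u by (simp add: inversions_def)
  qed
  moreover have "inj_on (simple_refl i) (inversions w)"
    by (rule inj_on_inverseI[of _ "simple_refl i"]) simp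
  ultimately show ?thesis by (simp add: card_image)
qed

lemma card_inversions_refl_neg:
  assumes "w = weyl_word is" "\<not> lat_nonneg (w (simple_root i))"
  shows "card (inversions w) = Suc (card (inversions (w \<circ> simple_refl i)))"
proof -
  have "w \<circ> simple_refl i = weyl_word (is @ [i])" using assms by (simp add: weyl_word_append)
  moreover have "lat_nonneg ((w \<circ> simple_refl i) (simple_root i))"
    using assms root_neg_iff[of "w (simple_root i)"] by (simp add: weyl_word_uminus)
  ultimately have "card (inversions (w \<circ> simple_refl i \<circ> simple_refl i))
      = Suc (card (inversions (w \<circ> simple_refl i)))" by (rule card_inversions_refl)
  then show ?thesis by (simp add: comp_assoc simple_refl_comp_self)
qed

text \<open>Exchange condition. Reading the word from the right, the root first becomes negative at
  some letter \<open>k\<close>; just before, it equals \<open>simple_root k\<close>, so the two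
  reflections are conjugate and that letter can be deleted.\<close>

lemma weyl_exchange:
  assumes "\<not> lat_nonneg (weyl_word is (simple_root i))"
  shows "\<exists>js. Suc (length js) = length is \<and> weyl_word is \<circ> simple_refl i = weyl_word js"
  using assms
proof (induction "is")
  case Nil
  then show ?case by simp
next
  case (Cons k ks)
  show ?case
  proof (cases "lat_nonneg (weyl_word ks (simple_root i))")
    case False
    then obtain js where js: "Suc (length js) = length ks"
      "weyl_word ks \<circ> simple_refl i = weyl_word js" using Cons.IH by blast
    then have "weyl_word (k # ks) \<circ> simple_refl i = weyl_word (k # js)"
      by (metis comp_assoc weyl_word_Cons)
    moreover have "Suc (length (k # js)) = length (k # ks)"
      using js by auto
    ultimately show ?thesis by blast
  next
    case True
    let ?b = "weyl_word ks (simple_root i)"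
    have b: "?b = simple_root k"
      using Cons.prems True simple_refl_lat_nonneg[of ?b k] by auto
    have "simple_refl k (weyl_word ks (simple_refl i v)) = weyl_word ks v" for v
    proof -
      have "weyl_word ks (simple_refl i v) = weyl_word ks v - e6_form v (simple_root i) *s ?b"
        by (simp add: simple_refl_def weyl_word_diff weyl_word_scale)
      also have "e6_form v (simple_root i) = e6_form (weyl_word ks v) ?b" by simp
      finally have "weyl_word ks (simple_refl i v) = simple_refl k (weyl_word ks v)"
        by (simp only: b simple_refl_def)
      then show ?thesis by simp
    qed
    then have "weyl_word (k # ks) \<circ> simple_refl i = weyl_word ks" by (simp add: fun_eq_iff)
    moreover have "Suc (length ks) = length (k # ks)" by auto
    ultimately show ?thesis by blast
  qed
qed

text \<open>A shortest word for the element cannot end in a letter \<open>i\<close>: the shorter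
  initial part would send \<open>simple_root i\<close> to a negative root, and the exchange
  condition would give a still shorter word.\<close>

lemma weyl_word_eq_id:
  assumes "\<And>i. lat_nonneg (weyl_word is (simple_root i))"
  shows "weyl_word is = id"
proof -
  define n where "n = (LEAST n. \<exists>js. length js = n \<and> weyl_word js = weyl_word is)"
  have "\<exists>js. length js = n \<and> weyl_word js = weyl_word is"
    unfolding n_def by (rule LeastI[of _ "length is"]) blast
  then obtain js where js: "length js = n" "weyl_word js = weyl_word is" by blast
  show ?thesis
  proof (cases js rule: rev_cases)
    case Nil
    then show ?thesis using js by simp
  next
    case (snoc ks i)
    have "weyl_word js (simple_root i) = - weyl_word ks (simple_root i)"
      by (simp add: snoc weyl_word_append weyl_word_uminus)
    then have "\<not> lat_nonneg (weyl_word ks (simple_root i))"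
      using assms[of i] js root_neg_iff[of "weyl_word ks (simple_root i)"] by simp
    then obtain ls where ls: "Suc (length ls) = length ks" "weyl_word ks \<circ> simple_refl i = weyl_word ls"
      using weyl_exchange by blast
    then have "weyl_word ls = weyl_word is" using snoc js by (simp add: weyl_word_append)
    then have "n \<le> length ls" unfolding n_def by (intro Least_le) blast
    then show ?thesis using ls js snoc by simp
  qed
qed

lemma card_inversions_le: "card (inversions (weyl_word is)) \<le> length is"
proof (induction "is" rule: rev_induct)
  case Nil
  then show ?case by (simp add: inversions_def)
next
  case (snoc i ks)
  have eq: "weyl_word (ks @ [i]) = weyl_word ks \<circ> simple_refl i" by (simp add: weyl_word_append)
  show ?case
    using snoc card_inversions_refl[of "weyl_word ks" ks i] card_inversions_refl_neg[of "weyl_word ks" ks i]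
    unfolding eq by (cases "lat_nonneg (weyl_word ks (simple_root i))") (simp_all del: o_apply comp_apply)
qed

text \<open>While an inversion is left, some simple root is made negative, and multiplying by its
  reflection removes exactly one inversion.\<close>

lemma weyl_word_of_card_inversions:
  "\<exists>js. length js = card (inversions (weyl_word is)) \<and> weyl_word js = weyl_word is"
proof (induction "card (inversions (weyl_word is))" arbitrary: "is")
  case 0
  then have "inversions (weyl_word is) = {}" by simp
  then have "simple_root i \<notin> inversions (weyl_word is)" for i by simp
  then have "lat_nonneg (weyl_word is (simple_root i))" for i
    by (simp add: inversions_def)
  then have "weyl_word is = id" by (rule weyl_word_eq_id)
  then show ?case using 0 by (intro exI[of _ "[]"]) simp
next
  case (Suc n)
  have "\<exists>i. \<not> lat_nonneg (weyl_word is (simple_root i))"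
  proof (rule ccontr)
    assume "\<not> ?thesis"
    then have "weyl_word is = id" using weyl_word_eq_id by blast
    then show False using Suc(2) by (simp add: inversions_def)
  qed
  then obtain i where i: "\<not> lat_nonneg (weyl_word is (simple_root i))" by blast
  have eq: "weyl_word (is @ [i]) = weyl_word is \<circ> simple_refl i" by (simp add: weyl_word_append)
  have "card (inversions (weyl_word is)) = Suc (card (inversions (weyl_word (is @ [i]))))"
    unfolding eq by (rule card_inversions_refl_neg[OF refl i])
  then obtain js where js: "length js = n" "weyl_word js = weyl_word (is @ [i])"
    using Suc(1)[of "is @ [i]"] Suc(2) by auto
  then have "weyl_word (js @ [i]) = weyl_word is"
    by (simp add: weyl_word_append comp_assoc simple_refl_comp_self)
  then show ?case using js Suc(2) by (intro exI[of _ "js @ [i]"]) simp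
qed

lemma weyl_length_eq: "weyl_length (weyl_word is) = card (inversions (weyl_word is))"
  unfolding weyl_length_def
proof (rule Least_equality)
  show "\<exists>js. length js = card (inversions (weyl_word is)) \<and> weyl_word js = weyl_word is"
    by (rule weyl_word_of_card_inversions)
next
  fix n assume "\<exists>js. length js = n \<and> weyl_word js = weyl_word is"
  then show "card (inversions (weyl_word is)) \<le> n" using card_inversions_le by metis
qed

lemma reduced_expr_word: "reduced_expr is w \<longleftrightarrow> weyl_word is = w \<and> length is = card (inversions w)"
  by (auto simp: reduced_expr_def weyl_length_eq)

text \<open>The recursion behind all inductions along an arbitrary reduced word, taken from its
  right end.\<close>

lemma reduced_expr_snoc:
  "reduced_expr (is @ [i]) w \<longleftrightarrow>
     reduced_expr is (w \<circ> simple_refl i) \<and> lat_nonneg (weyl_word is (simple_root i))"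
proof -
  have eq: "weyl_word (is @ [i]) = w \<longleftrightarrow> weyl_word is = w \<circ> simple_refl i"
    by (auto simp: weyl_word_append comp_assoc simple_refl_comp_self)
  show ?thesis
  proof (cases "weyl_word is = w \<circ> simple_refl i")
    case True
    then have w: "w = weyl_word is \<circ> simple_refl i" by (simp add: comp_assoc simple_refl_comp_self)
    show ?thesis
      using True eq card_inversions_refl[OF refl, of "is" i] card_inversions_refl_neg[OF refl, of "is" i]
        card_inversions_le[of "is"] w
      by (cases "lat_nonneg (weyl_word is (simple_root i))") (auto simp: reduced_expr_word)
  next
    case False
    then show ?thesis using eq by (auto simp: reduced_expr_word)
  qed
qed

lemma reduced_expr_Nil: "reduced_expr [] w \<longleftrightarrow> w = id"
  by (auto simp: reduced_expr_word inversions_def)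

lemma ex_reduced_expr:
  assumes "w \<in> weyl_group" shows "\<exists>is. reduced_expr is w"
proof -
  obtain js where js: "w = weyl_word js" using assms by (auto simp: weyl_group_def parabolic_def)
  obtain ks where "length ks = card (inversions w)" "weyl_word ks = w"
    unfolding js using weyl_word_of_card_inversions by blast
  then show ?thesis by (auto simp: reduced_expr_word)
qed

section \<open>The minuscule representation\<close>

text \<open>The exponent inside \<open>e6_eps\<close>, written out as a bilinear form so that sign
  identities become parity computations.\<close>

definition eps_exponent :: "lattice \<Rightarrow> lattice \<Rightarrow> int" where
  "eps_exponent v w = v$N1*w$N1 + v$N2*w$N2 + v$N3*w$N3 + v$N4*w$N4 + v$N5*w$N5 + v$N6*w$N6
     + v$N1*w$N3 + v$N3*w$N4 + v$N4*w$N5 + v$N5*w$N6 + v$N2*w$N4"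

lemma e6_eps_explicit: "e6_eps v w = (if even (eps_exponent v w) then 1 else - 1)"
proof -
  have "(\<Sum>i\<in>UNIV. v $ i * w $ i) + (\<Sum>(i, j)\<in>e6_edges. v $ i * w $ j) = eps_exponent v w"
    by (simp add: sum_e6_node e6_edges_def eps_exponent_def)
  then show ?thesis by (simp only: e6_eps_def)
qed

lemma eps_exponent_add:
  "eps_exponent (u + v) w = eps_exponent u w + eps_exponent v w"
  "eps_exponent u (v + w) = eps_exponent u v + eps_exponent u w"
  by (simp_all add: eps_exponent_def algebra_simps)

lemma eps_exponent_uminus:
  "eps_exponent (- u) w = - eps_exponent u w"
  "eps_exponent u (- w) = - eps_exponent u w"
  by (simp_all add: eps_exponent_def algebra_simps)

lemma e6_eps_add_left: "e6_eps (u + v) w = e6_eps u w * e6_eps v w"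
  by (simp add: e6_eps_explicit eps_exponent_add)
lemma e6_eps_add_right: "e6_eps u (v + w) = e6_eps u v * e6_eps u w"
  by (simp add: e6_eps_explicit eps_exponent_add)
lemma e6_eps_uminus_left [simp]: "e6_eps (- u) w = e6_eps u w"
  by (simp add: e6_eps_explicit eps_exponent_uminus)
lemma e6_eps_uminus_right [simp]: "e6_eps u (- w) = e6_eps u w"
  by (simp add: e6_eps_explicit eps_exponent_uminus)
lemma e6_eps_diff_right: "e6_eps u (v - w) = e6_eps u v * e6_eps u w"
  using e6_eps_add_right[of u v "- w"] by simp
lemma e6_eps_zero_right [simp]: "e6_eps u 0 = 1"
  by (simp add: e6_eps_explicit eps_exponent_def)
lemma e6_eps_square [simp]: "e6_eps u v * e6_eps u v = 1"
  by (simp add: e6_eps_explicit)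
lemma e6_eps_nonzero [simp]: "e6_eps u v \<noteq> 0"
  by (simp add: e6_eps_explicit)
lemma e6_eps_self: "is_root v \<Longrightarrow> e6_eps v v = - 1"
proof -
  assume "is_root v"
  then have "2 * eps_exponent v v = 2 * (1 + 2 * (v$N1 * v$N3 + v$N3 * v$N4 + v$N4 * v$N5 + v$N5 * v$N6 + v$N2 * v$N4))"
    by (simp add: is_root_def e6_form_self eps_exponent_def power2_eq_square algebra_simps)
  then have "odd (eps_exponent v v)" by (simp only: mult_cancel_left) simp
  then show ?thesis by (simp add: e6_eps_explicit)
qed

text \<open>Modulo 2, the symmetrised exponent is the invariant form.\<close>

lemma e6_eps_swap: "e6_eps w v = (if even (e6_form v w) then e6_eps v w else - e6_eps v w)"
proof -
  have "eps_exponent v w + eps_exponent w v = e6_form v w +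
     2 * (v$N1*w$N3 + v$N3*w$N4 + v$N4*w$N5 + v$N5*w$N6 + v$N2*w$N4
        + w$N1 * v$N3 + w$N3 * v$N4 + w$N4 * v$N5 + w$N5 * v$N6 + w$N2 * v$N4)"
    by (simp add: eps_exponent_def e6_form_explicit algebra_simps)
  then have "even (eps_exponent v w + eps_exponent w v) \<longleftrightarrow> even (e6_form v w)" by simp
  then show ?thesis by (auto simp: e6_eps_explicit)
qed

type_synonym minuscule_fun = "lattice \<Rightarrow> complex"

text \<open>The sign is the one of the Lie bracket, applied to an offset; it makes sense because
  offsets lie in the root lattice. Functions live on the whole lattice, but the operator sees only
  their values on \<open>minuscule\<close>.\<close>

definition rep_root :: "lattice \<Rightarrow> minuscule_fun \<Rightarrow> minuscule_fun" where
  "rep_root v \<phi> \<gamma> =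
     (if \<gamma> \<in> minuscule \<and> \<gamma> - v \<in> minuscule then e6_eps v (\<gamma> - v) * \<phi> (\<gamma> - v) else 0)"

fun rep_basis :: "e6_basis \<Rightarrow> minuscule_fun \<Rightarrow> minuscule_fun" where
  "rep_basis (H i) \<phi> \<gamma> =
     (if \<gamma> \<in> minuscule then of_int (pairing (simple_root i) \<gamma>) * \<phi> \<gamma> else 0)"
| "rep_basis (E \<alpha>) \<phi> \<gamma> = rep_root (root_vec \<alpha>) \<phi> \<gamma>"

definition rep :: "e6_lie \<Rightarrow> minuscule_fun \<Rightarrow> minuscule_fun" where
  "rep x \<phi> \<gamma> = (\<Sum>b\<in>UNIV. x $ b * rep_basis b \<phi> \<gamma>)"

lemma sum_e6_basis: "(\<Sum>b\<in>UNIV. f b) = (\<Sum>i\<in>UNIV. f (H i)) + (\<Sum>\<alpha>\<in>UNIV. f (E \<alpha>))"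
proof -
  have "(\<Sum>b\<in>UNIV. f b) = (\<Sum>b\<in>range H. f b) + (\<Sum>b\<in>range E. f b)"
    unfolding UNIV_e6_basis by (rule sum.union_disjoint) auto
  also have "\<dots> = (\<Sum>i\<in>UNIV. f (H i)) + (\<Sum>\<alpha>\<in>UNIV. f (E \<alpha>))"
    by (simp add: sum.reindex inj_on_def)
  finally show ?thesis .
qed

lemma rep_axis [simp]: "rep (axis b 1) = rep_basis b"
  by (intro ext) (simp add: rep_def axis_def if_distrib[of "\<lambda>x. x * _"] cong: if_cong)

lemma rep_add: "rep (x + y) \<phi> \<gamma> = rep x \<phi> \<gamma> + rep y \<phi> \<gamma>"
  by (simp add: rep_def algebra_simps sum.distrib)
lemma rep_scale: "rep (c *s x) \<phi> \<gamma> = c * rep x \<phi> \<gamma>"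
  by (simp add: rep_def algebra_simps sum_distrib_left)
lemma rep_uminus: "rep (- x) \<phi> \<gamma> = - rep x \<phi> \<gamma>"
  by (simp add: rep_def sum_negf)
lemma rep_diff: "rep (x - y) \<phi> \<gamma> = rep x \<phi> \<gamma> - rep y \<phi> \<gamma>"
  by (simp add: rep_def algebra_simps sum_subtractf)
lemma rep_zero [simp]: "rep 0 \<phi> \<gamma> = 0"
  by (simp add: rep_def)
lemma rep_sum: "rep (sum f A) \<phi> \<gamma> = (\<Sum>a\<in>A. rep (f a) \<phi> \<gamma>)"
  by (induction A rule: infinite_finite_induct) (simp_all add: rep_add)

lemma rep_basis_sum: "rep_basis b (\<lambda>\<gamma>. \<Sum>c\<in>A. y c * f c \<gamma>) \<gamma> = (\<Sum>c\<in>A. y c * rep_basis b (f c) \<gamma>)"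
  by (cases b) (auto simp: rep_root_def sum_distrib_left algebra_simps intro!: sum.cong)

lemma pairing_expand: "pairing v \<gamma> = (\<Sum>i\<in>UNIV. v $ i * pairing (simple_root i) \<gamma>)"
proof -
  have "(\<Sum>i\<in>UNIV. v $ i * pairing (simple_root i) \<gamma>)
      = (\<Sum>i\<in>UNIV. v $ i * e6_form (simple_root i) \<gamma>) - v $ N6"
    by (simp add: sum_e6_node pairing_def algebra_simps)
  then show ?thesis unfolding pairing_def e6_form_expand[of v \<gamma>] by simp
qed

text \<open>If the roots have product -1, exactly one of the two composites survives at a weight
  where the sum acts, and the antisymmetry of the sign makes both possibilities agree. For opposite
  roots the composites live on opposite ends of a weight string. For product 0 the composites
  coincide, and for positive product both vanish because a pairing would reach 2.\<close>

lemma rep_basis_bracket_roots: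
  fixes \<alpha> \<beta> :: e6_root
  shows "rep (basis_bracket (E \<alpha>) (E \<beta>)) \<phi> \<gamma> =
    rep_root (root_vec \<alpha>) (rep_root (root_vec \<beta>) \<phi>) \<gamma> - rep_root (root_vec \<beta>) (rep_root (root_vec \<alpha>) \<phi>) \<gamma>"
proof (cases "\<gamma> \<in> minuscule")
  case False
  then have "rep x \<phi> \<gamma> = 0" for x
    by (simp add: rep_def sum_e6_basis rep_root_def)
  then show ?thesis using False by (simp add: rep_root_def)
next
  case \<gamma>: True
  define a b where "a = root_vec \<alpha>" and "b = root_vec \<beta>"
  have a: "is_root a" and b: "is_root b" by (simp_all add: a_def b_def)
  note pa = pairing_bounds[OF a \<gamma>] and pb = pairing_bounds[OF b \<gamma>]
  have ga: "\<gamma> - a \<in> minuscule \<longleftrightarrow> pairing a \<gamma> = 1" and gb: "\<gamma> - b \<in> minuscule \<longleftrightarrow> pairing b \<gamma> = 1"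
    using minuscule_diff_iff a b \<gamma> by blast+
  have comm: "\<gamma> - b - a = \<gamma> - a - b" by simp
  have gab: "\<gamma> - a - b \<in> minuscule \<longleftrightarrow> pairing b \<gamma> = 1 + e6_form a b" if "\<gamma> - a \<in> minuscule"
    using minuscule_diff_iff[OF b that] by (auto simp: pairing_diff_right e6_form_sym)
  have gba: "\<gamma> - a - b \<in> minuscule \<longleftrightarrow> pairing a \<gamma> = 1 + e6_form a b" if "\<gamma> - b \<in> minuscule"
    using minuscule_diff_iff[OF a that] unfolding comm by (auto simp: pairing_diff_right)
  have lhs: "rep_root a (rep_root b \<phi>) \<gamma> - rep_root b (rep_root a \<phi>) \<gamma> =
     (if \<gamma> - a \<in> minuscule \<and> \<gamma> - a - b \<in> minuscule then e6_eps a (\<gamma> - a) * (e6_eps b (\<gamma> - a - b) * \<phi> (\<gamma> - a - b)) else 0)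
   - (if \<gamma> - b \<in> minuscule \<and> \<gamma> - a - b \<in> minuscule then e6_eps b (\<gamma> - b) * (e6_eps a (\<gamma> - a - b) * \<phi> (\<gamma> - a - b)) else 0)"
    using \<gamma> unfolding rep_root_def comm by simp
  have split: "e6_eps a (\<gamma> - a) = e6_eps a (\<gamma> - a - b) * e6_eps a b"
     "e6_eps b (\<gamma> - b) = e6_eps b (\<gamma> - a - b) * e6_eps b a"
    using e6_eps_add_right[of a "\<gamma> - a - b" b] e6_eps_add_right[of b "\<gamma> - a - b" a]
    by (simp_all add: algebra_simps)
  consider (zero) "a + b = 0" | (root) "a + b \<noteq> 0" "is_root (a + b)" | (other) "a + b \<noteq> 0" "\<not> is_root (a + b)"
    by blast
  then show ?thesis
  proof cases
    case zero
    then have ba: "b = - a" by (simp add: eq_neg_iff_add_eq_0 add.commute)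
    have "rep (- (\<Sum>i\<in>UNIV. of_int (a $ i) *s axis (H i) 1)) \<phi> \<gamma>
       = - (\<Sum>i\<in>UNIV. of_int (a $ i) * of_int (pairing (simple_root i) \<gamma>) * \<phi> \<gamma>)"
      using \<gamma> by (simp add: rep_uminus rep_sum rep_scale mult.assoc)
    also have "\<dots> = - of_int (pairing a \<gamma>) * \<phi> \<gamma>"
      unfolding pairing_expand[of a \<gamma>] by (simp add: sum_distrib_right)
    finally have l: "rep (basis_bracket (E \<alpha>) (E \<beta>)) \<phi> \<gamma> = - of_int (pairing a \<gamma>) * \<phi> \<gamma>"
      using zero by (simp add: a_def b_def)
    have "e6_eps a (\<gamma> - a) * (e6_eps b \<gamma> * x) = - x" "e6_eps b (\<gamma> - b) * (e6_eps a \<gamma> * x) = - x" for x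
      using a by (simp_all add: ba e6_eps_diff_right e6_eps_self e6_eps_add_right)
    then have "rep_root a (rep_root b \<phi>) \<gamma> - rep_root b (rep_root a \<phi>) \<gamma> = - of_int (pairing a \<gamma>) * \<phi> \<gamma>"
      unfolding lhs ga gb using pa \<gamma> by (auto simp: ba)
    then show ?thesis using l by (simp add: a_def b_def)
  next
    case root
    have ab: "e6_form a b = - 1" using root is_root_add_iff a b by blast
    have l: "rep (basis_bracket (E \<alpha>) (E \<beta>)) \<phi> \<gamma> = e6_eps a b * rep_root (a + b) \<phi> \<gamma>"
      using root by (simp add: range_root_vec a_def b_def rep_scale)
    have sab: "\<gamma> - (a + b) = \<gamma> - a - b" by simp
    have sw: "e6_eps b a = - e6_eps a b" using e6_eps_swap[of b a] ab by simp
    have gg: "\<gamma> - a - b \<in> minuscule \<longleftrightarrow> pairing a \<gamma> + pairing b \<gamma> = 1"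
      using minuscule_diff_iff[OF root(2) \<gamma>] unfolding sab by simp
    show ?thesis
      unfolding l a_def[symmetric] b_def[symmetric] lhs
      unfolding rep_root_def sab ga gb split sw gg using \<gamma> pa pb
      by (auto simp: e6_eps_add_left)
  next
    case other
    have "e6_form a b \<noteq> - 1" "e6_form a b \<noteq> - 2"
      using other is_root_add_iff[OF a b] root_form_bounds(4)[OF a b] by (auto simp: eq_neg_iff_add_eq_0)
    then have ab: "0 \<le> e6_form a b" using root_form_bounds(1)[OF a b] by linarith
    have l: "rep (basis_bracket (E \<alpha>) (E \<beta>)) \<phi> \<gamma> = 0"
      using other by (simp add: range_root_vec a_def b_def)
    have "rep_root a (rep_root b \<phi>) \<gamma> - rep_root b (rep_root a \<phi>) \<gamma> = 0"
    proof (cases "e6_form a b = 0")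
      case True
      then have sw: "e6_eps b a = e6_eps a b" using e6_eps_swap[of b a] by simp
      show ?thesis unfolding lhs split sw using ga gb gab gba True by auto
    next
      case False
      then show ?thesis unfolding lhs using ab ga gb gab gba pa pb by auto
    qed
    then show ?thesis using l by (simp add: a_def b_def)
  qed
qed

lemma rep_basis_bracket:
  "rep (basis_bracket b c) \<phi> \<gamma> = rep_basis b (rep_basis c \<phi>) \<gamma> - rep_basis c (rep_basis b \<phi>) \<gamma>"
proof (cases b; cases c)
  fix i j assume "b = H i" "c = H j"
  then show ?thesis by simp
next
  fix i \<beta> assume "b = H i" "c = E \<beta>"
  then show ?thesis
    by (auto simp: rep_scale rep_root_def pairing_diff_right algebra_simps)
next
  fix i \<beta> assume "b = E \<beta>" "c = H i"
  then show ?thesis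
    by (auto simp: rep_scale rep_uminus rep_root_def pairing_diff_right algebra_simps)
next
  fix \<alpha> \<beta> assume bc: "b = E \<alpha>" "c = E \<beta>"
  have "rep_basis (E \<alpha>) = rep_root (root_vec \<alpha>)" for \<alpha> by (intro ext) simp
  then show ?thesis unfolding bc by (simp add: rep_basis_bracket_roots del: basis_bracket.simps)
qed

lemma rep_rep: "rep x (rep y \<phi>) \<gamma> = (\<Sum>b\<in>UNIV. \<Sum>c\<in>UNIV. x $ b * y $ c * rep_basis b (rep_basis c \<phi>) \<gamma>)"
proof -
  have "rep y \<phi> = (\<lambda>\<gamma>. \<Sum>c\<in>UNIV. y $ c * rep_basis c \<phi> \<gamma>)" by (intro ext) (simp add: rep_def)
  then show ?thesis
    by (simp add: rep_def[of x] rep_basis_sum sum_distrib_left mult.assoc)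
qed

lemma rep_bracket: "rep (bracket x y) \<phi> \<gamma> = rep x (rep y \<phi>) \<gamma> - rep y (rep x \<phi>) \<gamma>"
proof -
  have "rep y (rep x \<phi>) \<gamma> = (\<Sum>b\<in>UNIV. \<Sum>c\<in>UNIV. x $ b * y $ c * rep_basis c (rep_basis b \<phi>) \<gamma>)"
    unfolding rep_rep by (subst sum.swap) (simp add: mult_ac)
  then show ?thesis
    by (simp add: bracket_def rep_sum rep_scale rep_basis_bracket rep_rep[of x y]
        right_diff_distrib sum_subtractf)
qed

text \<open>A weight with pairing 1 is moved to one with pairing -1 by subtracting the root, so
  otherwise all pairings vanish; the seven lowest weights then force all coordinates to be
  0.\<close>

lemma ex_minuscule_pairing:
  assumes "is_root v"
  shows "\<exists>\<gamma>\<in>minuscule. pairing v \<gamma> = - 1"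
proof (rule ccontr)
  assume "\<not> ?thesis"
  then have no: "pairing v \<gamma> \<noteq> - 1" if "\<gamma> \<in> minuscule" for \<gamma> using that by blast
  have "pairing v \<gamma> \<noteq> 1" if "\<gamma> \<in> minuscule" for \<gamma>
  proof
    assume 1: "pairing v \<gamma> = 1"
    then have "\<gamma> - v \<in> minuscule" using minuscule_diff_iff assms that by blast
    moreover have "pairing v (\<gamma> - v) = - 1" using 1 assms by (simp add: pairing_diff_right is_root_def)
    ultimately show False using no by blast
  qed
  then have z: "pairing v \<gamma> = 0" if "\<gamma> \<in> minuscule" for \<gamma>
    using no[OF that] pairing_bounds[OF assms that] that by force
  \<comment> \<open>The weights listed in \<open>m\<close> are reached from the lowest one by adding
    the simple roots 6, 5, 4, 3, 1 in turn, and 2 directly after 4.\<close>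
  define u :: "int \<Rightarrow> int \<Rightarrow> int \<Rightarrow> int \<Rightarrow> int \<Rightarrow> int \<Rightarrow> lattice" where
    "u = (\<lambda>a b c d e f. \<chi> i. case i of N1 \<Rightarrow> a | N2 \<Rightarrow> b | N3 \<Rightarrow> c | N4 \<Rightarrow> d | N5 \<Rightarrow> e | N6 \<Rightarrow> f)"
  have m: "u 0 0 0 0 0 1 \<in> minuscule" "u 0 0 0 0 1 1 \<in> minuscule" "u 0 0 0 1 1 1 \<in> minuscule"
    "u 0 0 1 1 1 1 \<in> minuscule" "u 1 0 1 1 1 1 \<in> minuscule" "u 0 1 0 1 1 1 \<in> minuscule"
    by (simp_all add: minuscule_def u_def e6_form_self)
  from z[OF zero_minuscule] z[OF m(1)] z[OF m(2)] z[OF m(3)] z[OF m(4)] z[OF m(5)] z[OF m(6)]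
  have "v $ N6 = 0 \<and> v $ N5 = 0 \<and> v $ N4 = 0 \<and> v $ N3 = 0 \<and> v $ N2 = 0 \<and> v $ N1 = 0"
    by (simp add: pairing_def e6_form_explicit u_def)
  then have "v = 0" by (simp add: vec_eq_iff all_e6_node)
  then show False using assms is_root_nonzero by blast
qed

text \<open>Faithfulness, the source of all later identities. On the indicator of one weight
  \<open>\<gamma>\<close>, evaluated at \<open>\<gamma> + root_vec \<alpha>\<close>, a single root
  coefficient survives, since different roots shift by different vectors; the seven lowest weights
  separate the Cartan coefficients.\<close>

lemma rep_inject:
  assumes "\<And>\<phi> \<gamma>. rep x \<phi> \<gamma> = rep y \<phi> \<gamma>"
  shows "x = y"
proof -
  define z where "z = x - y"
  have z: "rep z \<phi> \<gamma> = 0" for \<phi> \<gamma> using assms by (simp add: z_def rep_diff)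
  have E: "z $ E \<alpha> = 0" for \<alpha>
  proof -
    obtain \<gamma> where \<gamma>: "\<gamma> \<in> minuscule" "pairing (root_vec \<alpha>) \<gamma> = - 1"
      using ex_minuscule_pairing[of "root_vec \<alpha>"] by auto
    let ?\<phi> = "\<lambda>\<delta>. if \<delta> = \<gamma> then 1 else 0 :: complex"
    have "\<gamma> + root_vec \<alpha> \<in> minuscule" using \<gamma> minuscule_add_iff by simp
    then have E: "rep_basis (E \<beta>) ?\<phi> (\<gamma> + root_vec \<alpha>) = (if \<beta> = \<alpha> then e6_eps (root_vec \<alpha>) \<gamma> else 0)" for \<beta>
      using \<gamma> by (auto simp: rep_root_def algebra_simps root_vec_inject)
    have "\<gamma> + root_vec \<alpha> \<noteq> \<gamma>" using is_root_nonzero[of "root_vec \<alpha>"] by simp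
    then have "rep z ?\<phi> (\<gamma> + root_vec \<alpha>) = z $ E \<alpha> * e6_eps (root_vec \<alpha>) \<gamma>"
      unfolding rep_def sum_e6_basis E by (simp add: if_distrib[of "\<lambda>x. _ * x"] cong: if_cong)
    then show ?thesis using z by simp
  qed
  have H: "(\<Sum>i\<in>UNIV. z $ H i * of_int (pairing (simple_root i) \<gamma>)) = 0" if "\<gamma> \<in> minuscule" for \<gamma>
    using z[of "\<lambda>_. 1" \<gamma>] that by (simp add: rep_def sum_e6_basis E)
  define u :: "int \<Rightarrow> int \<Rightarrow> int \<Rightarrow> int \<Rightarrow> int \<Rightarrow> int \<Rightarrow> lattice" where
    "u = (\<lambda>a b c d e f. \<chi> i. case i of N1 \<Rightarrow> a | N2 \<Rightarrow> b | N3 \<Rightarrow> c | N4 \<Rightarrow> d | N5 \<Rightarrow> e | N6 \<Rightarrow> f)"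
  have m: "u 0 0 0 0 0 1 \<in> minuscule" "u 0 0 0 0 1 1 \<in> minuscule" "u 0 0 0 1 1 1 \<in> minuscule"
    "u 0 0 1 1 1 1 \<in> minuscule" "u 1 0 1 1 1 1 \<in> minuscule" "u 0 1 0 1 1 1 \<in> minuscule"
    by (simp_all add: minuscule_def u_def e6_form_self)
  from H[OF zero_minuscule] H[OF m(1)] H[OF m(2)] H[OF m(3)] H[OF m(4)] H[OF m(5)] H[OF m(6)]
  have "z $ H N6 = 0 \<and> z $ H N5 = 0 \<and> z $ H N4 = 0 \<and> z $ H N3 = 0 \<and> z $ H N2 = 0 \<and> z $ H N1 = 0"
    by (simp add: pairing_def e6_form_simple u_def sum_e6_node)
  then have "z $ H i = 0" for i by (cases i) auto
  then have "z $ b = 0" for b using E by (cases b) auto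
  then show ?thesis by (simp add: z_def vec_eq_iff)
qed

section \<open>Lifting the adjoint group to the minuscule representation\<close>

lemma bracket_add_right: "bracket x (y + z) = bracket x y + bracket x z"
  by (simp add: bracket_def algebra_simps vec.scale_left_distrib sum.distrib)
lemma bracket_scale_right: "bracket x (c *s y) = c *s bracket x y"
  by (simp add: bracket_def vec.scale_sum_right vector_smult_assoc mult.left_commute)
lemma bracket_scale_left: "bracket (c *s x) y = c *s bracket x y"
  by (simp add: bracket_def vec.scale_sum_right vector_smult_assoc mult.assoc)
lemma bracket_zero_right [simp]: "bracket x 0 = 0"
  by (simp add: bracket_def)

lemma bracket_axis: "bracket (axis b 1) (axis c 1) = basis_bracket b c"
proof -
  have "bracket (axis b 1) (axis c 1) =
     (\<Sum>b'\<in>UNIV. \<Sum>c'\<in>UNIV. if b' = b then if c' = c then basis_bracket b' c' else 0 else 0)"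
    unfolding bracket_def by (intro sum.cong) (auto simp: axis_def)
  also have "\<dots> = (\<Sum>b'\<in>UNIV. if b' = b then basis_bracket b' c else 0)"
    by (intro sum.cong) auto
  finally show ?thesis by simp
qed

lemma rep_basis_fun_add: "rep_basis b (\<lambda>\<gamma>. \<phi> \<gamma> + \<psi> \<gamma>) \<gamma> = rep_basis b \<phi> \<gamma> + rep_basis b \<psi> \<gamma>"
  by (cases b) (auto simp: rep_root_def algebra_simps)
lemma rep_basis_fun_scale: "rep_basis b (\<lambda>\<gamma>. c * \<phi> \<gamma>) \<gamma> = c * rep_basis b \<phi> \<gamma>"
  by (cases b) (auto simp: rep_root_def algebra_simps)

lemma rep_fun_add: "rep x (\<lambda>\<gamma>. \<phi> \<gamma> + \<psi> \<gamma>) \<gamma> = rep x \<phi> \<gamma> + rep x \<psi> \<gamma>"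
  by (simp add: rep_def rep_basis_fun_add algebra_simps sum.distrib)
lemma rep_fun_scale: "rep x (\<lambda>\<gamma>. c * \<phi> \<gamma>) \<gamma> = c * rep x \<phi> \<gamma>"
  by (simp add: rep_def rep_basis_fun_scale algebra_simps sum_distrib_left)
lemma rep_fun_zero [simp]: "rep x (\<lambda>\<gamma>. 0) = (\<lambda>\<gamma>. 0)"
  using rep_fun_scale[of x 0 "\<lambda>_. 0"] by (intro ext) simp
lemma rep_fun_uminus: "rep x (\<lambda>\<gamma>. - \<phi> \<gamma>) \<gamma> = - rep x \<phi> \<gamma>"
  using rep_fun_scale[of x "- 1"] by simp
lemma rep_fun_diff: "rep x (\<lambda>\<gamma>. \<phi> \<gamma> - \<psi> \<gamma>) \<gamma> = rep x \<phi> \<gamma> - rep x \<psi> \<gamma>"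
  using rep_fun_add[of x \<phi> "\<lambda>\<gamma>. - \<psi> \<gamma>"] by (simp add: rep_fun_uminus)

lemmas rep_fun_linear = rep_fun_add rep_fun_scale rep_fun_uminus rep_fun_diff

lemma rep_bracket_fun: "rep (bracket x y) \<phi> = (\<lambda>\<gamma>. rep x (rep y \<phi>) \<gamma> - rep y (rep x \<phi>) \<gamma>)"
  by (intro ext) (rule rep_bracket)

lemma rep_root_vector: "rep (root_vector \<alpha>) = rep_root (root_vec \<alpha>)"
  unfolding root_vector_def rep_axis by (intro ext) simp

lemma rep_root_twice [simp]: "is_root v \<Longrightarrow> rep_root v (rep_root v \<phi>) = (\<lambda>\<gamma>. 0)"
proof
  fix \<gamma> assume v: "is_root v"
  have "\<not> (\<gamma> \<in> minuscule \<and> \<gamma> - v \<in> minuscule \<and> \<gamma> - v - v \<in> minuscule)"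
  proof
    assume m: "\<gamma> \<in> minuscule \<and> \<gamma> - v \<in> minuscule \<and> \<gamma> - v - v \<in> minuscule"
    then have "pairing v \<gamma> = 1" "pairing v (\<gamma> - v) = 1" using v minuscule_diff_iff by blast+
    then show False using v by (simp add: pairing_diff_right is_root_def)
  qed
  then show "rep_root v (rep_root v \<phi>) \<gamma> = 0" by (auto simp: rep_root_def)
qed

lemma rep_root_vector_twice [simp]:
  "rep (root_vector \<alpha>) (rep (root_vector \<alpha>) \<phi>) = (\<lambda>\<gamma>. 0)"
  by (simp add: rep_root_vector)

text \<open>In the representation every term of the expanded triple bracket contains the square of
  the root operator. Consequently \<open>exp_ad\<close> of a root vector is a quadratic
  polynomial.\<close>

lemma ad_root_vector_cube:
  "bracket (root_vector \<alpha>) (bracket (root_vector \<alpha>) (bracket (root_vector \<alpha>) y)) = 0"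
  by (rule rep_inject) (simp add: rep_bracket_fun rep_fun_linear)

definition root_elt :: "e6_root \<Rightarrow> complex \<Rightarrow> e6_lie \<Rightarrow> e6_lie" where
  "root_elt \<alpha> a = exp_ad (a *s root_vector \<alpha>)"

lemma root_elt_eq:
  "root_elt \<alpha> a v = v + a *s bracket (root_vector \<alpha>) v
     + (a * a / 2) *s bracket (root_vector \<alpha>) (bracket (root_vector \<alpha>) v)"
proof -
  let ?e = "root_vector \<alpha>"
  let ?f = "\<lambda>n. (1 / fact n) *\<^sub>R (bracket (a *s ?e) ^^ n) v"
  have z: "(bracket (a *s ?e) ^^ (n + 3)) v = 0" for n
  proof (induction n)
    case 0
    show ?case by (simp add: eval_nat_numeral bracket_scale_left bracket_scale_right ad_root_vector_cube)
  next
    case (Suc n)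
    have "(bracket (a *s ?e) ^^ (Suc n + 3)) v = bracket (a *s ?e) ((bracket (a *s ?e) ^^ (n + 3)) v)"
      by (simp only: add_Suc funpow.simps o_apply)
    then show ?case using Suc by simp
  qed
  have "(bracket (a *s ?e) ^^ n) v = 0" if "n \<notin> {..<3}" for n
    using z[of "n - 3"] that by simp
  then have "suminf ?f = sum ?f {..<3}" by (intro suminf_finite) auto
  also have "\<dots> = v + bracket (a *s ?e) v + (1 / 2) *\<^sub>R bracket (a *s ?e) (bracket (a *s ?e) v)"
    by (simp add: eval_nat_numeral)
  finally have "root_elt \<alpha> a v = v + bracket (a *s ?e) v + (1 / 2) *\<^sub>R bracket (a *s ?e) (bracket (a *s ?e) v)"
    by (simp add: root_elt_def exp_ad_def)
  moreover have "(1 / 2 :: real) *\<^sub>R w = (1 / 2) *s w" for w :: e6_lie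
    by (simp add: vec_eq_iff scaleR_conv_of_real[where 'a = complex])
  ultimately show ?thesis
    by (simp add: bracket_scale_left bracket_scale_right)
qed

lemma rep_root_elt: "rep (root_elt \<alpha> a y) \<phi> \<gamma> = rep y \<phi> \<gamma> + a * rep (bracket (root_vector \<alpha>) y) \<phi> \<gamma>
   + a * a / 2 * rep (bracket (root_vector \<alpha>) (bracket (root_vector \<alpha>) y)) \<phi> \<gamma>"
  by (simp add: root_elt_eq rep_add rep_scale)

text \<open>The last conjunct says that conjugation by \<open>T\<close> induces \<open>g\<close>;
  scalar multiples of \<open>T\<close> lift the same \<open>g\<close>, hence a relation. The
  conjunct on supports keeps the 27-dimensional space apart from the remaining lattice functions, on
  which \<open>rep\<close> is zero.\<close>

definition lift :: "(e6_lie \<Rightarrow> e6_lie) \<Rightarrow> (minuscule_fun \<Rightarrow> minuscule_fun) \<Rightarrow> bool" where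
  "lift g T \<longleftrightarrow> bij T \<and>
     (\<forall>\<phi> \<psi> c. T (\<lambda>\<gamma>. \<phi> \<gamma> + c * \<psi> \<gamma>) = (\<lambda>\<gamma>. T \<phi> \<gamma> + c * T \<psi> \<gamma>)) \<and>
     (\<forall>\<phi>. (\<forall>\<gamma>. \<gamma> \<notin> minuscule \<longrightarrow> \<phi> \<gamma> = 0) \<longleftrightarrow> (\<forall>\<gamma>. \<gamma> \<notin> minuscule \<longrightarrow> T \<phi> \<gamma> = 0)) \<and>
     (\<forall>y \<phi>. T (rep y \<phi>) = rep (g y) (T \<phi>))"

lemma lift_id: "lift id id"
  by (simp add: lift_def)

lemma lift_comp: "lift g S \<Longrightarrow> lift h T \<Longrightarrow> lift (g \<circ> h) (S \<circ> T)"
  unfolding lift_def by (auto simp: bij_comp)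

lemma lift_linear: "lift g T \<Longrightarrow> T (\<lambda>\<gamma>. \<phi> \<gamma> + c * \<psi> \<gamma>) = (\<lambda>\<gamma>. T \<phi> \<gamma> + c * T \<psi> \<gamma>)"
  by (simp add: lift_def)
lemma lift_rep: "lift g T \<Longrightarrow> T (rep y \<phi>) = rep (g y) (T \<phi>)"
  by (simp add: lift_def)
lemma lift_bij: "lift g T \<Longrightarrow> bij T"
  by (simp add: lift_def)
lemma lift_supp: "lift g T \<Longrightarrow> (\<forall>\<gamma>. \<gamma> \<notin> minuscule \<longrightarrow> T \<phi> \<gamma> = 0) \<longleftrightarrow> (\<forall>\<gamma>. \<gamma> \<notin> minuscule \<longrightarrow> \<phi> \<gamma> = 0)"
  by (simp add: lift_def)

lemma lift_zero: "lift g T \<Longrightarrow> T (\<lambda>_. 0) = (\<lambda>_. 0)"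
  using lift_linear[of g T "\<lambda>_. 0" "- 1" "\<lambda>_. 0"] by simp

lemma lift_scale: "lift g T \<Longrightarrow> T (\<lambda>\<gamma>. c * \<psi> \<gamma>) = (\<lambda>\<gamma>. c * T \<psi> \<gamma>)"
  using lift_linear[of g T "\<lambda>_. 0" c \<psi>] lift_zero by simp

text \<open>The operator is onto and the representation faithful, so \<open>T\<close> determines
  \<open>g\<close>. Group identities are therefore proved on lifts.\<close>

lemma lift_inject:
  assumes "lift g T" "lift h T" shows "g = h"
proof
  fix y
  show "g y = h y"
  proof (rule rep_inject)
    fix \<phi> \<gamma>
    obtain \<psi> where "\<phi> = T \<psi>" using lift_bij[OF assms(1)] by (metis bij_pointE)
    then show "rep (g y) \<phi> \<gamma> = rep (h y) \<phi> \<gamma>"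
      using lift_rep[OF assms(1), of y \<psi>] lift_rep[OF assms(2), of y \<psi>] by simp
  qed
qed

lemma lift_bracket:
  assumes "lift g T" shows "g (bracket x y) = bracket (g x) (g y)"
proof (rule rep_inject)
  fix \<phi> \<gamma>
  obtain \<psi> where \<psi>: "\<phi> = T \<psi>" using lift_bij[OF assms(1)] by (metis bij_pointE)
  have "rep (g (bracket x y)) \<phi> = T (rep (bracket x y) \<psi>)"
    using lift_rep[OF assms] \<psi> by simp
  also have "\<dots> = T (\<lambda>\<gamma>. rep x (rep y \<psi>) \<gamma> + (- 1) * rep y (rep x \<psi>) \<gamma>)"
    by (simp add: rep_bracket_fun)
  also have "\<dots> = (\<lambda>\<gamma>. rep (g x) (rep (g y) \<phi>) \<gamma> - rep (g y) (rep (g x) \<phi>) \<gamma>)"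
    unfolding lift_linear[OF assms] lift_rep[OF assms] \<psi> by simp
  finally show "rep (g (bracket x y)) \<phi> \<gamma> = rep (bracket (g x) (g y)) \<phi> \<gamma>"
    by (simp add: rep_bracket)
qed

definition rep_elt :: "lattice \<Rightarrow> complex \<Rightarrow> minuscule_fun \<Rightarrow> minuscule_fun" where
  "rep_elt v a \<phi> = (\<lambda>\<gamma>. \<phi> \<gamma> + a * rep_root v \<phi> \<gamma>)"

lemma rep_root_fun_add: "rep_root v (\<lambda>\<gamma>. \<phi> \<gamma> + c * \<psi> \<gamma>) \<gamma> = rep_root v \<phi> \<gamma> + c * rep_root v \<psi> \<gamma>"
  by (auto simp: rep_root_def algebra_simps)

lemma rep_root_fun_scale: "rep_root v (\<lambda>\<gamma>. c * \<phi> \<gamma>) \<gamma> = c * rep_root v \<phi> \<gamma>"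
  by (auto simp: rep_root_def)

lemma rep_elt_add: "is_root v \<Longrightarrow> rep_elt v a \<circ> rep_elt v b = rep_elt v (a + b)"
  by (intro ext) (simp add: rep_elt_def rep_root_fun_add algebra_simps)
lemma rep_elt_zero: "rep_elt v 0 = id"
  by (intro ext) (simp add: rep_elt_def)

lemma bij_rep_elt: "is_root v \<Longrightarrow> bij (rep_elt v a)"
  by (rule o_bij[of "rep_elt v (- a)"]) (simp_all add: rep_elt_add rep_elt_zero)

lemma rep_elt_supp: 
  assumes "\<gamma> \<notin> minuscule"
  shows "rep_elt v a \<phi> \<gamma> = \<phi> \<gamma>"
  using assms by (simp add: rep_elt_def rep_root_def)

text \<open>Since the root operator \<open>X\<close> has square zero,
  \<open>(1 + a X) y = (exp (a ad X) y) (1 + a X)\<close> is a finite polynomial identity.\<close>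

lemma lift_root_elt: "lift (root_elt \<alpha> a) (rep_elt (root_vec \<alpha>) a)"
  unfolding lift_def
proof (intro conjI allI)
  let ?v = "root_vec \<alpha>" and ?T = "rep_elt (root_vec \<alpha>) a"
  show "bij ?T" by (simp add: bij_rep_elt)
  fix \<phi> \<psi> c y
  show "?T (\<lambda>\<gamma>. \<phi> \<gamma> + c * \<psi> \<gamma>) = (\<lambda>\<gamma>. ?T \<phi> \<gamma> + c * ?T \<psi> \<gamma>)"
    by (simp add: rep_elt_def rep_root_fun_add algebra_simps)
  show "(\<forall>\<gamma>. \<gamma> \<notin> minuscule \<longrightarrow> \<phi> \<gamma> = 0) \<longleftrightarrow> (\<forall>\<gamma>. \<gamma> \<notin> minuscule \<longrightarrow> ?T \<phi> \<gamma> = 0)"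
    by (simp add: rep_elt_supp)
  show "?T (rep y \<phi>) = rep (root_elt \<alpha> a y) (?T \<phi>)"
    by (rule ext)
      (simp add: rep_root_elt rep_bracket_fun rep_fun_linear rep_elt_def rep_root_vector[symmetric]
        algebra_simps del: rep_root_twice)
qed

lemma root_elt_add: "root_elt \<alpha> a \<circ> root_elt \<alpha> b = root_elt \<alpha> (a + b)"
  by (rule lift_inject[OF lift_comp[OF lift_root_elt lift_root_elt]])
    (simp add: rep_elt_add lift_root_elt)

lemma root_elt_zero: "root_elt \<alpha> 0 = id"
  by (rule lift_inject[OF lift_root_elt]) (simp add: rep_elt_zero lift_id)

lemma bij_root_elt: "bij (root_elt \<alpha> a)"
  by (rule o_bij[of "root_elt \<alpha> (- a)"]) (simp_all add: root_elt_add root_elt_zero)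

lemma linear_root_elt: "Vector_Spaces.linear (*s) (*s) (root_elt \<alpha> a)"
proof (rule Vector_Spaces.linear.intro; (unfold_locales)?)
  fix x y :: e6_lie and c :: complex
  show "root_elt \<alpha> a (x + y) = root_elt \<alpha> a x + root_elt \<alpha> a y"
    by (simp add: root_elt_eq bracket_add_right vec.scale_right_distrib)
  show "root_elt \<alpha> a (c *s x) = c *s root_elt \<alpha> a x"
    by (simp add: root_elt_eq bracket_scale_right vec.scale_right_distrib mult.commute)
qed

text \<open>Conjugation is read off from the lifts: \<open>T (1 + b X) = (1 + b X') T\<close> if \<open>T X = X' T\<close>.\<close>

lemma root_elt_conj:
  assumes "lift g T" "g (root_vector \<alpha>) = c *s root_vector \<beta>"
  shows "g \<circ> root_elt \<alpha> a = root_elt \<beta> (a * c) \<circ> g"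
proof (rule lift_inject[OF lift_comp[OF assms(1) lift_root_elt]])
  have "T \<circ> rep_elt (root_vec \<alpha>) a = rep_elt (root_vec \<beta>) (a * c) \<circ> T"
  proof
    fix \<phi>
    have "(T \<circ> rep_elt (root_vec \<alpha>) a) \<phi> = (\<lambda>\<gamma>. T \<phi> \<gamma> + a * rep (g (root_vector \<alpha>)) (T \<phi>) \<gamma>)"
      by (simp add: rep_elt_def rep_root_vector[symmetric] lift_linear[OF assms(1)] lift_rep[OF assms(1)])
    also have "\<dots> = (rep_elt (root_vec \<beta>) (a * c) \<circ> T) \<phi>"
      by (simp add: assms(2) rep_scale rep_elt_def rep_root_vector mult.assoc)
    finally show "(T \<circ> rep_elt (root_vec \<alpha>) a) \<phi> = (rep_elt (root_vec \<beta>) (a * c) \<circ> T) \<phi>" .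
  qed
  then show "lift (root_elt \<beta> (a * c) \<circ> g) (T \<circ> rep_elt (root_vec \<alpha>) a)"
    using lift_comp[OF lift_root_elt assms(1)] by simp
qed

text \<open>Product 1 between the two roots forces the composite of their operators to vanish, as a
  weight would need pairing 2; so 1 plus a sum of the two operators factors into two root
  elements.\<close>

lemma root_elt_conj2:
  assumes "lift g T" "g (root_vector \<alpha>) = c *s root_vector \<beta> + d *s root_vector \<delta>"
    "e6_form (root_vec \<beta>) (root_vec \<delta>) = 1"
  shows "g \<circ> root_elt \<alpha> a = root_elt \<beta> (a * c) \<circ> root_elt \<delta> (a * d) \<circ> g"
proof (rule lift_inject[OF lift_comp[OF assms(1) lift_root_elt]])
  let ?b = "root_vec \<beta>" and ?d = "root_vec \<delta>"
  have prod0: "rep_root ?b (rep_root ?d \<phi>) \<gamma> = 0" for \<phi> \<gamma>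
  proof -
    have "\<not> (\<gamma> \<in> minuscule \<and> \<gamma> - ?b \<in> minuscule \<and> \<gamma> - ?b - ?d \<in> minuscule)"
    proof
      assume m: "\<gamma> \<in> minuscule \<and> \<gamma> - ?b \<in> minuscule \<and> \<gamma> - ?b - ?d \<in> minuscule"
      then have "pairing ?d (\<gamma> - ?b) = 1" using minuscule_diff_iff[of ?d "\<gamma> - ?b"] by simp
      then have "pairing ?d \<gamma> = 2" using assms(3) e6_form_sym[of ?d ?b] by (simp add: pairing_diff_right)
      then show False using pairing_bounds(2)[of ?d \<gamma>] m by simp
    qed
    then show ?thesis by (auto simp: rep_root_def)
  qed
  have "T \<circ> rep_elt (root_vec \<alpha>) a = rep_elt ?b (a * c) \<circ> rep_elt ?d (a * d) \<circ> T"
  proof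
    fix \<phi>
    have "(T \<circ> rep_elt (root_vec \<alpha>) a) \<phi> = (\<lambda>\<gamma>. T \<phi> \<gamma> + a * rep (g (root_vector \<alpha>)) (T \<phi>) \<gamma>)"
      by (simp add: rep_elt_def rep_root_vector[symmetric] lift_linear[OF assms(1)] lift_rep[OF assms(1)])
    also have "\<dots> = (rep_elt ?b (a * c) \<circ> rep_elt ?d (a * d) \<circ> T) \<phi>"
      by (simp add: assms(2) rep_add rep_scale rep_elt_def rep_root_vector rep_root_fun_add
          rep_root_fun_scale prod0 algebra_simps)
    finally show "(T \<circ> rep_elt (root_vec \<alpha>) a) \<phi> = (rep_elt ?b (a * c) \<circ> rep_elt ?d (a * d) \<circ> T) \<phi>" .
  qed
  then show "lift (root_elt \<beta> (a * c) \<circ> root_elt \<delta> (a * d) \<circ> g) (T \<circ> rep_elt (root_vec \<alpha>) a)"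
    using lift_comp[OF lift_comp[OF lift_root_elt lift_root_elt] assms(1)] by metis
qed

section \<open>Torus elements, their characters and their lifts\<close>

definition torus_char :: "(e6_node \<Rightarrow> complex) \<Rightarrow> lattice \<Rightarrow> complex" where
  "torus_char c v = (\<Prod>i\<in>UNIV. c i powi (v $ i))"

lemma torus_char_add: "(\<And>i. c i \<noteq> 0) \<Longrightarrow> torus_char c (v + w) = torus_char c v * torus_char c w"
  by (simp add: torus_char_def power_int_add prod.distrib)
lemma torus_char_zero [simp]: "torus_char c 0 = 1"
  by (simp add: torus_char_def)
lemma torus_char_nonzero: "(\<And>i. c i \<noteq> 0) \<Longrightarrow> torus_char c v \<noteq> 0"
  by (simp add: torus_char_def)
lemma torus_char_simple [simp]: "torus_char c (simple_root i) = c i"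
  by (simp add: torus_char_def if_distrib[of "\<lambda>x. _ powi x"] cong: if_cong)

lemma torus_elt_nth:
  "torus_elt c v $ (H i) = v $ H i"
  "torus_elt c v $ (E \<alpha>) = torus_char c (root_vec \<alpha>) * v $ E \<alpha>"
  by (simp_all add: torus_elt_def torus_char_def)

text \<open>Only the ratios of \<open>d\<close> between weights are prescribed. This leaves room for
  a scalar, which is used for coroot elements, where \<open>d\<close> is a power given by
  \<open>pairing\<close>.\<close>

lemma lift_torus_elt:
  assumes c: "\<And>i. c i \<noteq> 0" and d: "\<And>\<gamma>. d \<gamma> \<noteq> 0"
    and dc: "\<And>v \<gamma>. is_root v \<Longrightarrow> \<gamma> \<in> minuscule \<Longrightarrow> \<gamma> + v \<in> minuscule \<Longrightarrow> d (\<gamma> + v) = torus_char c v * d \<gamma>"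
  shows "lift (torus_elt c) (\<lambda>\<phi> \<gamma>. d \<gamma> * \<phi> \<gamma>)"
  unfolding lift_def
proof (intro conjI allI)
  let ?T = "\<lambda>\<phi> \<gamma>. d \<gamma> * \<phi> \<gamma>"
  show "bij ?T" by (rule o_bij[of "\<lambda>\<phi> \<gamma>. \<phi> \<gamma> / d \<gamma>"]) (auto simp: fun_eq_iff d)
  fix \<phi> \<psi> :: minuscule_fun and k :: complex and y
  show "?T (\<lambda>\<gamma>. \<phi> \<gamma> + k * \<psi> \<gamma>) = (\<lambda>\<gamma>. ?T \<phi> \<gamma> + k * ?T \<psi> \<gamma>)"
    by (simp add: algebra_simps)
  show "(\<forall>\<gamma>. \<gamma> \<notin> minuscule \<longrightarrow> \<phi> \<gamma> = 0) \<longleftrightarrow> (\<forall>\<gamma>. \<gamma> \<notin> minuscule \<longrightarrow> ?T \<phi> \<gamma> = 0)"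
    by (simp add: d)
  show "?T (rep y \<phi>) = rep (torus_elt c y) (?T \<phi>)"
  proof
    fix \<gamma>
    have "d \<gamma> * (y $ b * rep_basis b \<phi> \<gamma>) = torus_elt c y $ b * rep_basis b (?T \<phi>) \<gamma>" for b
    proof (cases b)
      case (H i)
      then show ?thesis by (simp add: torus_elt_nth)
    next
      case (E \<alpha>)
      have "d \<gamma> = torus_char c (root_vec \<alpha>) * d (\<gamma> - root_vec \<alpha>)"
        if "\<gamma> \<in> minuscule" "\<gamma> - root_vec \<alpha> \<in> minuscule"
        using dc[of "root_vec \<alpha>" "\<gamma> - root_vec \<alpha>"] that by simp
      then show ?thesis using E by (auto simp: torus_elt_nth rep_root_def)
    qed
    then show "?T (rep y \<phi>) \<gamma> = rep (torus_elt c y) (?T \<phi>) \<gamma>"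
      by (simp add: rep_def sum_distrib_left)
  qed
qed

lemma lift_torus_elt_char: 
  assumes "\<And>i. c i \<noteq> 0"
  shows "lift (torus_elt c) (\<lambda>\<phi> \<gamma>. torus_char c \<gamma> * \<phi> \<gamma>)"
  using assms by (intro lift_torus_elt) (auto simp: torus_char_nonzero torus_char_add)

lemma torus_elt_mult: "(\<And>i. c i \<noteq> 0) \<Longrightarrow> (\<And>i. d i \<noteq> 0) \<Longrightarrow> torus_elt c \<circ> torus_elt d = torus_elt (\<lambda>i. c i * d i)"
  by (auto simp: fun_eq_iff vec_eq_iff torus_elt_def power_int_mult_distrib prod.distrib split: e6_basis.split)
lemma torus_elt_one: "torus_elt (\<lambda>_. 1) = id"
  by (auto simp: fun_eq_iff vec_eq_iff torus_elt_def split: e6_basis.split)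
lemma bij_torus_elt: 
  assumes "\<And>i. c i \<noteq> 0" shows "bij (torus_elt c)"
  by (rule o_bij[of "torus_elt (\<lambda>i. inverse (c i))"]) (simp_all add: torus_elt_mult torus_elt_one assms)
lemma linear_torus_elt: "Vector_Spaces.linear (*s) (*s) (torus_elt c)"
proof (rule Vector_Spaces.linear.intro; (unfold_locales)?)
  fix x y :: e6_lie and k :: complex
  show "torus_elt c (x + y) = torus_elt c x + torus_elt c y"
    by (auto simp: vec_eq_iff torus_elt_def algebra_simps split: e6_basis.split)
  show "torus_elt c (k *s x) = k *s torus_elt c x"
    by (auto simp: vec_eq_iff torus_elt_def split: e6_basis.split)
qed

lemma torus_elt_root_vector: "torus_elt c (root_vector \<alpha>) = torus_char c (root_vec \<alpha>) *s root_vector \<alpha>"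
  by (auto simp: vec_eq_iff torus_elt_def torus_char_def root_vector_def axis_def split: e6_basis.split)

section \<open>The adjoint group and its subgroups\<close>

lemma group_GL_e6: "group GL_e6"
proof (rule groupI)
  fix g h assume "g \<in> carrier GL_e6" "h \<in> carrier GL_e6"
  then show "g \<otimes>\<^bsub>GL_e6\<^esub> h \<in> carrier GL_e6"
    by (auto simp: GL_e6_def intro: bij_comp Vector_Spaces.linear_compose)
next
  show "\<one>\<^bsub>GL_e6\<^esub> \<in> carrier GL_e6"
    using vec.linear_id by (simp add: GL_e6_def)
next
  fix g assume g: "g \<in> carrier GL_e6"
  then have "Vector_Spaces.linear (*s) (*s) g" "bij g" by (simp_all add: GL_e6_def)
  then obtain h where h: "Vector_Spaces.linear (*s) (*s) h" "h \<circ> g = id" "g \<circ> h = id"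
    using vec.linear_injective_left_inverse[of g] vec.linear_surjective_right_inverse[of g]
    by (metis bij_def comp_assoc comp_id id_comp)
  then have "bij h" by (intro o_bij[of g])
  then show "\<exists>h\<in>carrier GL_e6. h \<otimes>\<^bsub>GL_e6\<^esub> g = \<one>\<^bsub>GL_e6\<^esub>"
    using h by (auto simp: GL_e6_def)
qed (auto simp: GL_e6_def comp_assoc)

lemma torus_elt_in_torus: "(\<And>i. c i \<noteq> 0) \<Longrightarrow> torus_elt c \<in> torus"
  by (auto simp: torus_def)

lemma root_subgroup_eq: "root_subgroup \<alpha> = range (root_elt \<alpha>)"
  by (auto simp: root_subgroup_def root_elt_def)

lemma generators_subset_GL: "torus \<union> (\<Union>\<alpha>. root_subgroup \<alpha>) \<subseteq> carrier GL_e6"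
  by (auto simp: GL_e6_def torus_def root_subgroup_eq bij_torus_elt linear_torus_elt
      bij_root_elt linear_root_elt)

lemma subgroup_G_ad: "subgroup (carrier G_ad) GL_e6"
  unfolding G_ad_def using group.generate_is_subgroup[OF group_GL_e6 generators_subset_GL] by simp

lemma group_G_ad: "group G_ad"
proof -
  have "G_ad = GL_e6\<lparr>carrier := carrier G_ad\<rparr>" by (simp add: G_ad_def)
  then show ?thesis using subgroup.subgroup_is_group[OF subgroup_G_ad group_GL_e6] by simp
qed

lemma G_ad_mult [simp]: "g \<otimes>\<^bsub>G_ad\<^esub> h = g \<circ> h"
  by (simp add: G_ad_def GL_e6_def)
lemma G_ad_one [simp]: "\<one>\<^bsub>G_ad\<^esub> = id"
  by (simp add: G_ad_def GL_e6_def)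

lemma G_ad_linear: "g \<in> carrier G_ad \<Longrightarrow> Vector_Spaces.linear (*s) (*s) g"
  using subgroup.subset[OF subgroup_G_ad] by (auto simp: GL_e6_def)
lemma G_ad_bij: "g \<in> carrier G_ad \<Longrightarrow> bij g"
  using subgroup.subset[OF subgroup_G_ad] by (auto simp: GL_e6_def)
lemma G_ad_comp [simp]: "g \<in> carrier G_ad \<Longrightarrow> h \<in> carrier G_ad \<Longrightarrow> g \<circ> h \<in> carrier G_ad"
  using group.is_monoid[OF group_G_ad, THEN monoid.m_closed, of g h] by simp
lemma G_ad_id [simp]: "id \<in> carrier G_ad"
  using group.is_monoid[OF group_G_ad, THEN monoid.one_closed] by simp
lemma G_ad_inv [simp]: "g \<in> carrier G_ad \<Longrightarrow> inv\<^bsub>G_ad\<^esub> g \<in> carrier G_ad"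
  using group.inv_closed[OF group_G_ad] .
lemma G_ad_inv_comp: 
  assumes "g \<in> carrier G_ad"
  shows "inv\<^bsub>G_ad\<^esub> g \<circ> g = id" "g \<circ> inv\<^bsub>G_ad\<^esub> g = id"
  using group.l_inv[OF group_G_ad assms] group.r_inv[OF group_G_ad assms] by simp_all
lemma G_ad_inv_equality:
  "g \<in> carrier G_ad \<Longrightarrow> h \<in> carrier G_ad \<Longrightarrow> h \<circ> g = id \<Longrightarrow> inv\<^bsub>G_ad\<^esub> g = h"
  using group.inv_equality[OF group_G_ad, of h g] by simp

lemma G_ad_inv_mult: "g \<in> carrier G_ad \<Longrightarrow> h \<in> carrier G_ad \<Longrightarrow>
    inv\<^bsub>G_ad\<^esub> (g \<circ> h) = inv\<^bsub>G_ad\<^esub> h \<circ> inv\<^bsub>G_ad\<^esub> g"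
  using group.inv_mult_group[OF group_G_ad, of g h] by simp

lemma root_elt_in_G_ad [simp]: "root_elt \<alpha> a \<in> carrier G_ad"
  by (auto simp: G_ad_def root_subgroup_eq intro!: generate.incl)
lemma torus_in_G_ad: "t \<in> torus \<Longrightarrow> t \<in> carrier G_ad"
  by (auto simp: G_ad_def intro!: generate.incl)
lemma torus_elt_in_G_ad: "(\<And>i. c i \<noteq> 0) \<Longrightarrow> torus_elt c \<in> carrier G_ad"
  by (intro torus_in_G_ad torus_elt_in_torus)

lemma inv_root_elt: "inv\<^bsub>G_ad\<^esub> (root_elt \<alpha> a) = root_elt \<alpha> (- a)"
  by (rule G_ad_inv_equality) (simp_all add: root_elt_add root_elt_zero)

lemma inv_torus_elt: 
  assumes "\<And>i. c i \<noteq> 0"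
  shows "inv\<^bsub>G_ad\<^esub> (torus_elt c) = torus_elt (\<lambda>i. inverse (c i))"
  by (rule G_ad_inv_equality) (simp_all add: torus_elt_mult torus_elt_one torus_elt_in_G_ad assms)

definition unip :: "e6_root set \<Rightarrow> (e6_lie \<Rightarrow> e6_lie) set" where
  "unip S = generate G_ad (\<Union>\<alpha>\<in>S. root_subgroup \<alpha>)"

definition borel :: "e6_root set \<Rightarrow> (e6_lie \<Rightarrow> e6_lie) set" where
  "borel S = generate G_ad (torus \<union> unip S)"

lemma subgroup_unip: "subgroup (unip S) G_ad"
  unfolding unip_def
  by (rule group.generate_is_subgroup[OF group_G_ad]) (auto simp: root_subgroup_eq)

lemma unip_in_G_ad: "g \<in> unip S \<Longrightarrow> g \<in> carrier G_ad"
  using subgroup.subset[OF subgroup_unip] by blast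

lemma subgroup_borel: "subgroup (borel S) G_ad"
  unfolding borel_def
  by (rule group.generate_is_subgroup[OF group_G_ad]) (auto simp: torus_in_G_ad unip_in_G_ad)

lemma borel_in_G_ad: "g \<in> borel S \<Longrightarrow> g \<in> carrier G_ad"
  using subgroup.subset[OF subgroup_borel] by blast

lemma subgroup_comp: "subgroup K G_ad \<Longrightarrow> g \<in> K \<Longrightarrow> h \<in> K \<Longrightarrow> g \<circ> h \<in> K"
  using subgroup.m_closed[of K G_ad g h] by simp

lemmas unip_comp = subgroup_comp[OF subgroup_unip]
  and borel_comp = subgroup_comp[OF subgroup_borel]
lemma unip_inv: "g \<in> unip S \<Longrightarrow> inv\<^bsub>G_ad\<^esub> g \<in> unip S"
  by (rule subgroup.m_inv_closed[OF subgroup_unip])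
lemma borel_inv: "g \<in> borel S \<Longrightarrow> inv\<^bsub>G_ad\<^esub> g \<in> borel S"
  by (rule subgroup.m_inv_closed[OF subgroup_borel])
lemma unip_id [simp]: "id \<in> unip S"
  using subgroup.one_closed[OF subgroup_unip] by simp
lemma borel_id [simp]: "id \<in> borel S"
  using subgroup.one_closed[OF subgroup_borel] by simp

lemma root_elt_in_unip: "\<alpha> \<in> S \<Longrightarrow> root_elt \<alpha> a \<in> unip S"
  unfolding unip_def by (rule generate.incl) (auto simp: root_subgroup_eq)
lemma unip_subset_borel: "g \<in> unip S \<Longrightarrow> g \<in> borel S"
  unfolding borel_def by (rule generate.incl) auto
lemma torus_subset_borel: "t \<in> torus \<Longrightarrow> t \<in> borel S"
  unfolding borel_def by (rule generate.incl) auto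

text \<open>Root subgroups and the torus contain their inverses, so later inductions need no case
  for inverses.\<close>

lemma generate_inverse_closed_induct:
  assumes "g \<in> generate G_ad K" "K \<subseteq> carrier G_ad" "\<And>k. k \<in> K \<Longrightarrow> inv\<^bsub>G_ad\<^esub> k \<in> K"
    and "P id" "\<And>k. k \<in> K \<Longrightarrow> P k"
    and "\<And>g h. g \<in> generate G_ad K \<Longrightarrow> h \<in> generate G_ad K \<Longrightarrow> P g \<Longrightarrow> P h \<Longrightarrow> P (g \<circ> h)"
  shows "P g"
  using assms(1)
proof (induction rule: generate.induct)
  case one
  then show ?case using assms(4) by (simp only: G_ad_one)
next
  case (inv h)
  then show ?case by (intro assms(5) assms(3))
next
  case (eng g h)
  then show ?case unfolding G_ad_mult by (rule assms(6))
qed (rule assms(5))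

lemma unip_induct [consumes 1, case_names id root comp]:
  assumes "g \<in> unip S" "P id" "\<And>\<alpha> a. \<alpha> \<in> S \<Longrightarrow> P (root_elt \<alpha> a)"
    and "\<And>g h. g \<in> unip S \<Longrightarrow> h \<in> unip S \<Longrightarrow> P g \<Longrightarrow> P h \<Longrightarrow> P (g \<circ> h)"
  shows "P g"
  using assms(1) unfolding unip_def
proof (rule generate_inverse_closed_induct)
  show "inv\<^bsub>G_ad\<^esub> k \<in> (\<Union>\<alpha>\<in>S. root_subgroup \<alpha>)" if "k \<in> (\<Union>\<alpha>\<in>S. root_subgroup \<alpha>)" for k
    using that by (force simp: root_subgroup_eq inv_root_elt)
  show "(\<Union>\<alpha>\<in>S. root_subgroup \<alpha>) \<subseteq> carrier G_ad" by (auto simp: root_subgroup_eq)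
  show "P k" if "k \<in> (\<Union>\<alpha>\<in>S. root_subgroup \<alpha>)" for k
    using that assms(3) by (auto simp: root_subgroup_eq)
qed (rule assms(2), rule assms(4)[unfolded unip_def])

lemma borel_induct [consumes 1, case_names id torus root comp]:
  assumes "g \<in> borel S" "P id" "\<And>c. (\<And>i. c i \<noteq> 0) \<Longrightarrow> P (torus_elt c)"
    and "\<And>\<alpha> a. \<alpha> \<in> S \<Longrightarrow> P (root_elt \<alpha> a)"
    and "\<And>g h. g \<in> borel S \<Longrightarrow> h \<in> borel S \<Longrightarrow> P g \<Longrightarrow> P h \<Longrightarrow> P (g \<circ> h)"
  shows "P g"
  using assms(1) unfolding borel_def
proof (rule generate_inverse_closed_induct)
  show "torus \<union> unip S \<subseteq> carrier G_ad" by (auto simp: torus_in_G_ad unip_in_G_ad)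
  show "inv\<^bsub>G_ad\<^esub> k \<in> torus \<union> unip S" if "k \<in> torus \<union> unip S" for k
    using that unip_inv inv_torus_elt
    by (fastforce simp: torus_def)
  show "P k" if "k \<in> torus \<union> unip S" for k
  proof (cases "k \<in> torus")
    case True
    then show ?thesis using assms(3) by (auto simp: torus_def)
  next
    case False
    then have "k \<in> unip S" using that by blast
    then show ?thesis
    proof (induction rule: unip_induct)
      case (comp g h)
      then show ?case using assms(5) unip_subset_borel by blast
    qed (rule assms(2), rule assms(4))
  qed
qed (rule assms(2), rule assms(5)[unfolded borel_def])

section \<open>The opposite Borel subgroups and their generators\<close>

definition pos_roots :: "e6_root set" where "pos_roots = {\<alpha>. positive_root \<alpha>}"
definition neg_roots :: "e6_root set" where "neg_roots = {\<alpha>. negative_root \<alpha>}"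

lemma pos_roots_iff: "\<alpha> \<in> pos_roots \<longleftrightarrow> lat_nonneg (root_vec \<alpha>)"
  by (simp add: pos_roots_def positive_root_def lat_nonneg_def)
lemma neg_roots_iff: "\<alpha> \<in> neg_roots \<longleftrightarrow> lat_nonneg (- root_vec \<alpha>)"
  by (simp add: neg_roots_def negative_root_def lat_nonneg_def)

lemma U_plus_eq: "U_plus = unip pos_roots"
  by (simp add: U_plus_def unip_def pos_roots_def)
lemma U_minus_eq: "U_minus = unip neg_roots"
  by (simp add: U_minus_def unip_def neg_roots_def)
lemma B_plus_eq: "B_plus = borel pos_roots"
  by (simp add: B_plus_def borel_def U_plus_eq)
lemma B_minus_eq: "B_minus = borel neg_roots"
  by (simp add: B_minus_def borel_def U_minus_eq)

lemma x_sub_eq: "x_sub i a = root_elt (Root (simple_root i)) a"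
  by (simp add: x_sub_def chev_e_def root_elt_def)
lemma y_sub_eq: "y_sub i a = root_elt (Root (- simple_root i)) (- a)"
proof -
  have "a *s - root_vector \<alpha> = (- a) *s root_vector \<alpha>" for \<alpha> by (simp add: vec_eq_iff)
  then show ?thesis by (simp add: y_sub_def chev_f_def root_elt_def)
qed

lemma ex_lift_G_ad: 
  assumes "g \<in> carrier G_ad"
  shows "\<exists>T. lift g T"
proof -
  have "g \<in> generate GL_e6 (torus \<union> (\<Union>\<alpha>. root_subgroup \<alpha>))" using assms by (simp add: G_ad_def)
  then show ?thesis
  proof (induction rule: generate.induct)
    case one
    have "\<one>\<^bsub>GL_e6\<^esub> = id" by (simp add: GL_e6_def)
    then show ?case using lift_id by metis
  next
    case (incl h)
    then consider c where "h = torus_elt c" "\<forall>i. c i \<noteq> 0" | \<alpha> a where "h = root_elt \<alpha> a"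
      by (auto simp: torus_def root_subgroup_eq)
    then show ?case using lift_torus_elt_char lift_root_elt by cases blast+
  next
    case (inv h)
    then have h: "h \<in> carrier G_ad"
      by (auto simp: G_ad_def intro: generate.incl)
    have "inv\<^bsub>GL_e6\<^esub> h = inv\<^bsub>G_ad\<^esub> h"
      using group.m_inv_consistent[OF group_GL_e6 subgroup_G_ad h] by (simp add: G_ad_def)
    moreover have "\<exists>T. lift (inv\<^bsub>G_ad\<^esub> h) T"
    proof (cases "h \<in> torus")
      case True
      then obtain c where c: "h = torus_elt c" "\<And>i. c i \<noteq> 0" by (auto simp: torus_def)
      then show ?thesis using inv_torus_elt[of c] lift_torus_elt_char[of "\<lambda>i. inverse (c i)"] by auto
    next
      case False
      then obtain \<alpha> a where "h = root_elt \<alpha> a" using inv by (auto simp: root_subgroup_eq)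
      then show ?thesis using lift_root_elt by (auto simp: inv_root_elt)
    qed
    ultimately show ?case by simp
  next
    case (eng g h)
    moreover have "g \<otimes>\<^bsub>GL_e6\<^esub> h = g \<circ> h" by (simp add: GL_e6_def)
    ultimately show ?case using lift_comp by metis
  qed
qed

section \<open>Weights of matrix entries\<close>

fun basis_weight :: "e6_basis \<Rightarrow> lattice" where
  "basis_weight (H i) = 0"
| "basis_weight (E \<alpha>) = root_vec \<alpha>"

abbreviation entry :: "(e6_lie \<Rightarrow> e6_lie) \<Rightarrow> e6_basis \<Rightarrow> e6_basis \<Rightarrow> complex" where
  "entry g b c \<equiv> g (axis c 1) $ b"

lemma linear_nth_expand:
  assumes "Vector_Spaces.linear (*s) (*s) g"
  shows "g v $ b = (\<Sum>p\<in>UNIV. v $ p * entry g b p)"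
proof -
  have "g v = g (\<Sum>p\<in>UNIV. v $ p *s axis p 1)" by (simp add: basis_expansion)
  also have "\<dots> = (\<Sum>p\<in>UNIV. v $ p *s g (axis p 1))"
    by (simp add: vec.linear_sum[OF assms] vec.linear_scale[OF assms])
  finally show ?thesis by (simp add: sum_component)
qed

lemma linear_eq_id:
  assumes "Vector_Spaces.linear (*s) (*s) g" "\<And>b c. entry g b c = (if b = c then 1 else 0)"
  shows "g = id"
proof
  fix v
  have "g v $ b = v $ b" for b
    unfolding linear_nth_expand[OF assms(1), of v b] assms(2)
    by (simp add: if_distrib[of "\<lambda>x. _ * x"] cong: if_cong)
  then show "g v = id v" by (simp add: vec_eq_iff)
qed

lemma entry_comp:
  assumes "Vector_Spaces.linear (*s) (*s) g"
  shows "entry (g \<circ> h) b c = (\<Sum>p\<in>UNIV. entry h p c * entry g b p)"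
  by (simp add: linear_nth_expand[OF assms, of "h _"])

lemma entry_comp_nonzero:
  assumes "Vector_Spaces.linear (*s) (*s) g" "entry (g \<circ> h) b c \<noteq> 0"
  obtains p where "entry g b p \<noteq> 0" "entry h p c \<noteq> 0"
proof -
  have "(\<Sum>p\<in>UNIV. entry h p c * entry g b p) \<noteq> 0" using entry_comp[OF assms(1)] assms(2) by metis
  then obtain p where "entry h p c * entry g b p \<noteq> 0" by (meson sum.not_neutral_contains_not_neutral)
  then show ?thesis using that by auto
qed

text \<open>With \<open>C = {0}\<close> the element permutes the weight spaces as \<open>w\<close>
  does; with \<open>w = id\<close> and a cone \<open>C\<close> it is block triangular. Arguments
  about subgroups are replaced by arguments about these sets of weight shifts, which add up under
  composition.\<close>

definition shape :: "lattice set \<Rightarrow> (lattice \<Rightarrow> lattice) \<Rightarrow> (e6_lie \<Rightarrow> e6_lie) \<Rightarrow> bool" where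
  "shape C w g \<longleftrightarrow> (\<forall>b c. entry g b c \<noteq> 0 \<longrightarrow> basis_weight b - w (basis_weight c) \<in> C)"

lemma shape_comp:
  assumes "Vector_Spaces.linear (*s) (*s) g" "shape C (weyl_word is) g" "shape D w' h"
    and "\<And>x y. x \<in> C \<Longrightarrow> y \<in> D \<Longrightarrow> x + weyl_word is y \<in> F"
  shows "shape F (weyl_word is \<circ> w') (g \<circ> h)"
  unfolding shape_def
proof (intro allI impI)
  fix b c assume "entry (g \<circ> h) b c \<noteq> 0"
  then obtain p where "entry g b p \<noteq> 0" "entry h p c \<noteq> 0"
    using entry_comp_nonzero assms(1) by blast
  then have 1: "basis_weight b - weyl_word is (basis_weight p) \<in> C"
    and 2: "basis_weight p - w' (basis_weight c) \<in> D"
    using assms(2,3) by (auto simp: shape_def)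
  have "basis_weight b - weyl_word is (w' (basis_weight c)) =
    (basis_weight b - weyl_word is (basis_weight p)) + weyl_word is (basis_weight p - w' (basis_weight c))"
    by (simp add: weyl_word_diff)
  then show "basis_weight b - (weyl_word is \<circ> w') (basis_weight c) \<in> F"
    using assms(4)[OF 1 2] by (simp only: o_apply)
qed

lemma shape_mono: "shape C w g \<Longrightarrow> C \<subseteq> D \<Longrightarrow> shape D w g"
  by (auto simp: shape_def)

lemma shape_id: "0 \<in> C \<Longrightarrow> shape C id id"
  by (auto simp: shape_def axis_def)

lemma entry_bracket_root_vector:
  assumes "bracket (root_vector \<alpha>) (axis c 1) $ b \<noteq> 0"
  shows "basis_weight b = root_vec \<alpha> + basis_weight c"
proof -
  have "basis_bracket (E \<alpha>) c $ b \<noteq> 0"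
    using assms by (simp add: root_vector_def bracket_axis)
  then show ?thesis
    by (cases c)
      (auto simp: axis_def sum_component range_root_vec Root_inverse split: if_splits
        intro!: sum.neutral dest!: sum.not_neutral_contains_not_neutral)
qed

lemma linear_bracket: "Vector_Spaces.linear (*s) (*s) (bracket x)"
  by (rule Vector_Spaces.linear.intro; (unfold_locales)?)
    (simp_all add: bracket_add_right bracket_scale_right vec.scale_right_distrib)

text \<open>The exponential is quadratic, so at most two steps along the root occur.\<close>

lemma entry_root_elt_nonzero:
  assumes "entry (root_elt \<alpha> a) b c \<noteq> 0" "b \<noteq> c"
  shows "\<exists>k\<in>{1,2}. basis_weight b = k *s root_vec \<alpha> + basis_weight c"
proof -
  let ?ad = "bracket (root_vector \<alpha>)"
  have "entry ?ad b c \<noteq> 0 \<or> entry (?ad \<circ> ?ad) b c \<noteq> 0"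
    using assms by (auto simp: root_elt_eq axis_def)
  then show ?thesis
  proof
    assume "entry ?ad b c \<noteq> 0"
    then show ?thesis using entry_bracket_root_vector by (force simp: vec_eq_iff)
  next
    assume "entry (?ad \<circ> ?ad) b c \<noteq> 0"
    then obtain p where "entry ?ad b p \<noteq> 0" "entry ?ad p c \<noteq> 0"
      using entry_comp_nonzero linear_bracket by blast
    then have "basis_weight b = 2 *s root_vec \<alpha> + basis_weight c"
      using entry_bracket_root_vector by (auto simp: vec_eq_iff)
    then show ?thesis by blast
  qed
qed

lemma entry_root_elt_diag: "entry (root_elt \<alpha> a) c c = 1"
proof -
  let ?ad = "bracket (root_vector \<alpha>)"
  have "entry ?ad c c = 0" using entry_bracket_root_vector[of \<alpha> c c] is_root_nonzero[of "root_vec \<alpha>"] by auto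
  moreover have "entry (?ad \<circ> ?ad) c c = 0"
  proof (rule ccontr)
    assume "entry (?ad \<circ> ?ad) c c \<noteq> 0"
    then obtain p where "entry ?ad c p \<noteq> 0" "entry ?ad p c \<noteq> 0"
      using entry_comp_nonzero linear_bracket by blast
    then have "basis_weight c = root_vec \<alpha> + (root_vec \<alpha> + basis_weight c)"
      using entry_bracket_root_vector by metis
    then have "root_vec \<alpha> = 0" by (auto simp: vec_eq_iff)
    then show False using is_root_nonzero[of "root_vec \<alpha>"] by simp
  qed
  ultimately show ?thesis by (simp add: root_elt_eq axis_def)
qed

lemma lat_nonneg_add: "lat_nonneg v \<Longrightarrow> lat_nonneg w \<Longrightarrow> lat_nonneg (v + w)"
  by (simp add: lat_nonneg_def)
lemma lat_nonneg_zero [simp]: "lat_nonneg 0"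
  by (simp add: lat_nonneg_def)

lemma shape_root_elt:
  assumes "root_vec \<alpha> \<in> C" "0 \<in> C" "\<And>x y. x \<in> C \<Longrightarrow> y \<in> C \<Longrightarrow> x + y \<in> C"
  shows "shape C id (root_elt \<alpha> a)"
  unfolding shape_def
proof (intro allI impI)
  fix b c assume *: "entry (root_elt \<alpha> a) b c \<noteq> 0"
  show "basis_weight b - id (basis_weight c) \<in> C"
  proof (cases "b = c")
    case False
    then obtain k where "k \<in> {1, 2}" "basis_weight b = k *s root_vec \<alpha> + basis_weight c"
      using entry_root_elt_nonzero[OF *] by blast
    moreover have "2 *s root_vec \<alpha> = root_vec \<alpha> + root_vec \<alpha>" by (simp add: vec_eq_iff)
    ultimately show ?thesis using assms(1) assms(3)[OF assms(1) assms(1)] by auto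
  qed (use assms in simp)
qed

lemma shape_torus_elt: "0 \<in> C \<Longrightarrow> shape C id (torus_elt c)"
  unfolding shape_def
proof (intro allI impI)
  fix b d assume "0 \<in> C" "entry (torus_elt c) b d \<noteq> 0"
  then have "b = d" by (cases b) (auto simp: torus_elt_nth axis_def split: if_splits)
  then show "basis_weight b - id (basis_weight d) \<in> C" using \<open>0 \<in> C\<close> by simp
qed

lemma shape_comp_id:
  assumes "Vector_Spaces.linear (*s) (*s) g" "shape C id g" "shape C id h"
    and "\<And>x y. x \<in> C \<Longrightarrow> y \<in> C \<Longrightarrow> x + y \<in> C"
  shows "shape C id (g \<circ> h)"
  using shape_comp[of g C "[]" C id h C] assms by simp

lemma shape_borel:
  assumes "g \<in> borel S" "\<And>\<alpha>. \<alpha> \<in> S \<Longrightarrow> root_vec \<alpha> \<in> C" "0 \<in> C" "\<And>x y. x \<in> C \<Longrightarrow> y \<in> C \<Longrightarrow> x + y \<in> C"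
  shows "shape C id g"
  using assms(1)
proof (induction rule: borel_induct)
  case (comp g h)
  then show ?case using shape_comp_id[of g C h] G_ad_linear borel_in_G_ad assms(4) by blast
next
  case (root \<alpha> a)
  show ?case by (rule shape_root_elt) (fact assms(2)[OF root] assms(3,4))+
qed (rule shape_id shape_torus_elt, rule assms(3))+

section \<open>Characters of the maximal unipotent subgroups\<close>

text \<open>The sign \<open>s\<close> treats the positive and the negative roots simultaneously.\<close>

definition sroots :: "int \<Rightarrow> e6_root set" where
  "sroots s = {\<alpha>. lat_nonneg (s *s root_vec \<alpha>)}"

definition sroot :: "int \<Rightarrow> e6_node \<Rightarrow> e6_root" where
  "sroot s i = Root (s *s simple_root i)"

lemma minus_one_scale: "(- 1) *s v = - (v :: lattice)"
  by (simp add: vec_eq_iff)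
lemma one_scale: "1 *s v = (v :: lattice)"
  by (simp add: vec_eq_iff)

lemma pos_roots_eq: "pos_roots = sroots 1"
  by (auto simp: sroots_def pos_roots_iff one_scale)
lemma neg_roots_eq: "neg_roots = sroots (- 1)"
  by (auto simp: sroots_def neg_roots_iff minus_one_scale)

lemma is_root_scale [simp]: "s = 1 \<or> s = - 1 \<Longrightarrow> is_root (s *s v) \<longleftrightarrow> is_root v"
  by (auto simp: is_root_def)

lemma root_vec_sroot [simp]: "s = 1 \<or> s = - 1 \<Longrightarrow> root_vec (sroot s i) = s *s simple_root i"
  unfolding sroot_def by (intro root_vec_Root) simp

lemma sroot_in_sroots: "s = 1 \<or> s = - 1 \<Longrightarrow> sroot s i \<in> sroots s"
  by (auto simp: sroots_def lat_nonneg_def)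

lemma x_sub_sroot: "x_sub i a = root_elt (sroot 1 i) a"
  by (simp add: x_sub_eq sroot_def one_scale)
lemma y_sub_sroot: "y_sub i a = root_elt (sroot (- 1) i) (- a)"
  by (simp add: y_sub_eq sroot_def minus_one_scale)

lemma bracket_root_vectors:
  "bracket (root_vector \<alpha>) (root_vector \<beta>) = basis_bracket (E \<alpha>) (E \<beta>)"
  by (simp add: root_vector_def bracket_axis del: basis_bracket.simps)

lemma bracket_root_vectors_sum:
  assumes "root_vec \<alpha> + root_vec \<beta> = root_vec \<delta>"
  shows "bracket (root_vector \<alpha>) (root_vector \<beta>) = e6_eps (root_vec \<alpha>) (root_vec \<beta>) *s root_vector \<delta>"
proof -
  have "root_vec \<alpha> + root_vec \<beta> \<noteq> 0" using assms is_root_nonzero[of "root_vec \<delta>"] by simp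
  then have "basis_bracket (E \<alpha>) (E \<beta>) = e6_eps (root_vec \<alpha>) (root_vec \<beta>) *s root_vector \<delta>"
    using assms by (simp add: root_vec_inverse root_vector_def)
  then show ?thesis by (simp only: bracket_root_vectors)
qed

lemma bracket_root_vectors_zero:
  assumes "0 \<le> e6_form (root_vec \<alpha>) (root_vec \<beta>)"
  shows "bracket (root_vector \<alpha>) (root_vector \<beta>) = 0"
proof -
  have "e6_form (root_vec \<alpha>) (root_vec \<beta>) = - 2" if "root_vec \<alpha> + root_vec \<beta> = 0"
    using that root_form_bounds(4)[of "root_vec \<alpha>" "root_vec \<beta>"] by (auto simp: eq_neg_iff_add_eq_0)
  moreover have "e6_form (root_vec \<alpha>) (root_vec \<beta>) = - 1" if "is_root (root_vec \<alpha> + root_vec \<beta>)"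
    using that is_root_add_iff[of "root_vec \<alpha>" "root_vec \<beta>"] by auto
  ultimately show ?thesis using assms
    by (auto simp: bracket_root_vectors range_root_vec)
qed

lemma root_elt_root_vector_zero:
  assumes "0 \<le> e6_form (root_vec \<alpha>) (root_vec \<beta>)"
  shows "root_elt \<alpha> a (root_vector \<beta>) = root_vector \<beta>"
  by (simp add: root_elt_eq bracket_root_vectors_zero[OF assms])

lemma root_elt_root_vector_sum:
  assumes "root_vec \<alpha> + root_vec \<beta> = root_vec \<delta>"
  shows "root_elt \<alpha> a (root_vector \<beta>)
    = 1 *s root_vector \<beta> + (a * e6_eps (root_vec \<alpha>) (root_vec \<beta>)) *s root_vector \<delta>"
proof -
  have "is_root (root_vec \<alpha> + root_vec \<beta>)" using assms by simp
  then have ab: "e6_form (root_vec \<alpha>) (root_vec \<beta>) = - 1"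
    using is_root_add_iff[of "root_vec \<alpha>" "root_vec \<beta>"] by simp
  have "e6_form (root_vec \<alpha>) (root_vec \<delta>) = 1"
    using ab is_root_root_vec[of \<alpha>] unfolding assms[symmetric] is_root_def by simp
  then have "bracket (root_vector \<alpha>) (root_vector \<delta>) = 0" by (intro bracket_root_vectors_zero) simp
  then show ?thesis
    by (simp add: root_elt_eq bracket_root_vectors_sum[OF assms] bracket_scale_right vector_smult_assoc)
qed

text \<open>Chevalley commutator formula in the simply laced case, obtained by conjugating one root
  element with the other.\<close>

lemma root_elt_commute:
  assumes "root_vec \<alpha> + root_vec \<beta> = root_vec \<delta>"
  shows "root_elt \<alpha> a \<circ> root_elt \<beta> b
    = root_elt \<beta> b \<circ> root_elt \<delta> (b * (a * e6_eps (root_vec \<alpha>) (root_vec \<beta>))) \<circ> root_elt \<alpha> a"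
proof -
  have "is_root (root_vec \<alpha> + root_vec \<beta>)" using assms by simp
  then have ab: "e6_form (root_vec \<alpha>) (root_vec \<beta>) = - 1"
    using is_root_add_iff[of "root_vec \<alpha>" "root_vec \<beta>"] by simp
  then have "e6_form (root_vec \<beta>) (root_vec \<delta>) = 1"
    using e6_form_sym[of "root_vec \<beta>" "root_vec \<alpha>"] is_root_root_vec[of \<beta>]
    unfolding assms[symmetric] is_root_def by simp
  from root_elt_conj2[OF lift_root_elt root_elt_root_vector_sum[OF assms] this, of a b]
  show ?thesis by simp
qed

text \<open>Expanding the square length 2 over the simple roots, some simple root has positive
  product with \<open>v\<close>; the product is 1, and the reflection subtracts that simple
  root.\<close>

lemma positive_root_nonsimple:
  assumes "is_root v" "lat_nonneg v" "\<And>j. v \<noteq> simple_root j"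
  shows "\<exists>j w. is_root w \<and> lat_nonneg w \<and> v = simple_root j + w"
proof -
  have "\<exists>j. 0 < e6_form v (simple_root j)"
  proof (rule ccontr)
    assume "\<not> ?thesis"
    then have "e6_form (simple_root j) v \<le> 0" for j
      by (metis e6_form_sym not_less)
    then have "v $ j * e6_form (simple_root j) v \<le> 0" for j
      using assms(2) by (intro mult_nonneg_nonpos) (auto simp: lat_nonneg_def)
    then have "e6_form v v \<le> 0" unfolding e6_form_expand[of v v] by (intro sum_nonpos) auto
    then show False using assms(1) by (simp add: is_root_def)
  qed
  then obtain j where j: "0 < e6_form v (simple_root j)" by blast
  then have "e6_form v (simple_root j) = 1"
    using root_form_bounds[of v "simple_root j"] assms(1,3) by force
  then have "simple_refl j v = v - simple_root j" by (simp add: simple_refl_def vec_eq_iff)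
  moreover have "lat_nonneg (simple_refl j v)" "is_root (simple_refl j v)"
    using simple_refl_lat_nonneg assms by auto
  ultimately show ?thesis by (intro exI[of _ j] exI[of _ "simple_refl j v"]) simp
qed

lemma sroots_nonsimple:
  assumes s: "s = 1 \<or> s = - 1" and "\<alpha> \<in> sroots s" "\<And>j. \<alpha> \<noteq> sroot s j"
  shows "\<exists>j. \<exists>\<beta>\<in>sroots s. root_vec (sroot s j) + root_vec \<beta> = root_vec \<alpha>"
proof -
  let ?v = "s *s root_vec \<alpha>"
  have ss: "s *s (s *s v) = v" for v :: lattice using s by (auto simp: vec_eq_iff)
  have "?v \<noteq> simple_root j" for j
  proof
    assume "?v = simple_root j"
    then have "root_vec \<alpha> = root_vec (sroot s j)" using ss[of "root_vec \<alpha>"] s by simp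
    then show False using assms(3) by (simp add: root_vec_inject)
  qed
  then obtain j w where w: "is_root w" "lat_nonneg w" "?v = simple_root j + w"
    using positive_root_nonsimple[of ?v] assms by (auto simp: sroots_def)
  have "s *s (simple_root j + w) = root_vec \<alpha>" using w(3) ss by metis
  moreover have "root_vec (Root (s *s w)) = s *s w" using w s by simp
  moreover have "Root (s *s w) \<in> sroots s" using w s ss by (simp add: sroots_def)
  ultimately show ?thesis using s by (intro exI[of _ j] bexI[of _ "Root (s *s w)"]) (simp_all add: vector_add_ldistrib)
qed

lemma shape_unip:
  assumes s: "s = 1 \<or> s = - 1" and "g \<in> borel (sroots s)"
  shows "shape {v. lat_nonneg (s *s v)} id g"
proof (rule shape_borel[OF assms(2)])
  fix x y :: lattice assume "x \<in> {v. lat_nonneg (s *s v)}" "y \<in> {v. lat_nonneg (s *s v)}"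
  then show "x + y \<in> {v. lat_nonneg (s *s v)}"
    using lat_nonneg_add[of "s *s x" "s *s y"] by (simp add: vector_add_ldistrib)
qed (auto simp: sroots_def)

lemma shape_unip_weights:
  assumes "s = 1 \<or> s = - 1" and "g \<in> borel (sroots s)" "entry g b c \<noteq> 0"
  shows "lat_nonneg (s *s (basis_weight b - basis_weight c))"
  using shape_unip[OF assms(1,2)] assms(3) by (auto simp: shape_def)

lemma lat_nonneg_scale_antisym:
  assumes "s = 1 \<or> s = - 1" "lat_nonneg (s *s (v - w))" "lat_nonneg (s *s (w - v))"
  shows "v = w"
proof -
  have "s *s (w - v) = - (s *s (v - w))" by (simp add: vec_eq_iff algebra_simps)
  then have "s *s (v - w) = 0" using assms(2,3) lat_nonneg_antisym by metis
  then show ?thesis using assms(1) by (auto simp: vec_eq_iff)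
qed

text \<open>The zero weight space has dimension 6, so triangularity with respect to weights does not
  exclude a nontrivial block there; root elements act as the identity on every weight block, and
  this persists in products.\<close>

lemma unip_entry_diag:
  assumes s: "s = 1 \<or> s = - 1" and "g \<in> unip (sroots s)"
  shows "basis_weight b = basis_weight c \<Longrightarrow> entry g b c = (if b = c then 1 else 0)"
  using assms(2)
proof (induction arbitrary: b c rule: unip_induct)
  case id
  then show ?case by (simp add: axis_def)
next
  case (root \<alpha> a)
  show ?case
  proof (cases "b = c")
    case False
    have "entry (root_elt \<alpha> a) b c = 0"
    proof (rule ccontr)
      assume "entry (root_elt \<alpha> a) b c \<noteq> 0"
      then obtain k where "k \<in> {1, 2}" "basis_weight b = k *s root_vec \<alpha> + basis_weight c"
        using entry_root_elt_nonzero False by blast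
      then have "k *s root_vec \<alpha> = 0" "k \<noteq> 0" using root(2) by auto
      then have "root_vec \<alpha> = 0" by (simp add: vec_eq_iff)
      then show False using is_root_nonzero[of "root_vec \<alpha>"] by simp
    qed
    then show ?thesis using False by simp
  qed (simp add: entry_root_elt_diag)
next
  case (comp g h)
  have "entry h p c * entry g b p = (if p = c then if b = c then 1 else 0 else 0)" for p
  proof (cases "entry h p c \<noteq> 0 \<and> entry g b p \<noteq> 0")
    case True
    then have "lat_nonneg (s *s (basis_weight p - basis_weight c))" "lat_nonneg (s *s (basis_weight b - basis_weight p))"
      using shape_unip_weights[OF s] comp(1,2) unip_subset_borel by blast+
    then have "basis_weight p = basis_weight c"
      using lat_nonneg_scale_antisym[OF s] comp(5) by metis
    then show ?thesis using comp(3)[of b p] comp(4)[of p c] comp(5) True by (auto split: if_splits)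
  next
    case False
    then show ?thesis using comp(3)[of b c] comp(4)[of c c] comp(5) by (auto split: if_splits)
  qed
  then show ?case
    by (simp only: entry_comp[OF G_ad_linear[OF unip_in_G_ad[OF comp(1)]]]) simp
qed

text \<open>The simple root coordinate of a unipotent element, realised as the adjoint matrix entry
  leading from the opposite simple root vector into the Cartan subalgebra. The minus sign
  compensates the one in the bracket of opposite root vectors.\<close>

definition unip_char :: "int \<Rightarrow> e6_node \<Rightarrow> (e6_lie \<Rightarrow> e6_lie) \<Rightarrow> complex" where
  "unip_char s i g = - entry g (H i) (E (sroot (- s) i))"

text \<open>No weight lies strictly between \<open>- (s *s simple_root i)\<close> and 0 in the order
  of shifts, so only two terms of the matrix product survive.\<close>

lemma unip_char_comp:
  assumes s: "s = 1 \<or> s = - 1" and g: "g \<in> unip (sroots s)" and h: "h \<in> unip (sroots s)"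
  shows "unip_char s i (g \<circ> h) = unip_char s i g + unip_char s i h"
proof -
  let ?c = "E (sroot (- s) i)"
  have wc: "basis_weight ?c = - (s *s simple_root i)" using s by (auto simp: vec_eq_iff)
  have ne: "basis_weight ?c \<noteq> 0" using s unfolding wc by (auto simp: vec_eq_iff)
  have "entry h p ?c * entry g (H i) p
     = (if p = ?c then entry g (H i) ?c else 0) + (if p = H i then entry h (H i) ?c else 0)" for p
  proof (cases "entry h p ?c \<noteq> 0 \<and> entry g (H i) p \<noteq> 0")
    case True
    let ?w = "s *s basis_weight p"
    have l1: "lat_nonneg (s *s (basis_weight p - basis_weight ?c))" and l2: "lat_nonneg (s *s (0 - basis_weight p))"
      using True shape_unip_weights[OF s, of h ?c p] shape_unip_weights[OF s, of g p "H i"] g h unip_subset_borel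
      by auto
    have w: "?w $ j \<le> 0" "?w $ j + (if i = j then 1 else 0) \<ge> 0" for j
      using spec[OF l1[unfolded lat_nonneg_def], of j] spec[OF l2[unfolded lat_nonneg_def], of j] s
      unfolding wc by (auto split: if_splits)
    have wj: "?w $ j = (if i = j then ?w $ i else 0)" for j
      using w[of j] by (cases "i = j") (auto intro: antisym)
    have "?w = 0 \<or> ?w = - simple_root i"
    proof (cases "?w $ i = 0")
      case True
      then have "\<forall>j. ?w $ j = 0 $ j" using wj by (metis zero_index)
      then have "?w = 0" by (subst vec_eq_iff)
      then show ?thesis by blast
    next
      case False
      then have "?w $ i < 0" using w(1)[of i] by (metis order_le_less)
      then have "?w $ i = - 1" using w(2)[of i] unfolding simp_thms if_True by linarith
      then have "?w $ j = (- simple_root i) $ j" for j by (subst wj) auto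
      then have "?w = - simple_root i" by (subst vec_eq_iff) blast
      then show ?thesis by blast
    qed
    then have "basis_weight p = 0 \<or> basis_weight p = basis_weight ?c"
      using s unfolding wc by (auto simp: vec_eq_iff)
    then show ?thesis
    proof
      assume p0: "basis_weight p = 0"
      then have "p = H i" using True unip_entry_diag[OF s g, of "H i" p] by (auto split: if_splits)
      then show ?thesis using unip_entry_diag[OF s g, of "H i" "H i"] by simp
    next
      assume pc: "basis_weight p = basis_weight ?c"
      then have "p = ?c" using True unip_entry_diag[OF s h, of p ?c] by (auto split: if_splits)
      then show ?thesis using unip_entry_diag[OF s h, of ?c ?c] by simp
    qed
  next
    case False
    then show ?thesis using unip_entry_diag[OF s g, of "H i" "H i"] unip_entry_diag[OF s h, of ?c ?c] by auto
  qed
  then have "entry (g \<circ> h) (H i) ?c = entry g (H i) ?c + entry h (H i) ?c"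
    by (simp only: entry_comp[OF G_ad_linear[OF unip_in_G_ad[OF g]]]) (simp add: sum.distrib)
  then show ?thesis by (simp add: unip_char_def)
qed

lemma unip_char_root_elt:
  assumes s: "s = 1 \<or> s = - 1" and "\<alpha> \<in> sroots s"
  shows "unip_char s i (root_elt \<alpha> a) = (if \<alpha> = sroot s i then of_int s * a else 0)"
proof -
  let ?c = "E (sroot (- s) i)"
  have s': "- s = 1 \<or> - s = - 1" using s by auto
  show ?thesis
  proof (cases "\<alpha> = sroot s i")
    case True
    let ?ad = "bracket (root_vector \<alpha>)"
    have sum0: "root_vec \<alpha> + root_vec (sroot (- s) i) = 0"
      using s by (auto simp: True root_vec_sroot[OF s'] vec_eq_iff)
    have "entry ?ad (H i) ?c = basis_bracket (E \<alpha>) ?c $ H i"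
      by (simp only: root_vector_def bracket_axis)
    also have "\<dots> = - of_int (root_vec \<alpha> $ i)"
      using sum0 by (simp add: sum_component axis_def if_distrib[of "\<lambda>x. _ * x"] cong: if_cong)
    finally have 1: "entry ?ad (H i) ?c = - of_int s"
      using s by (simp add: True)
    have 2: "entry (?ad \<circ> ?ad) (H i) ?c = 0"
    proof (rule ccontr)
      assume "entry (?ad \<circ> ?ad) (H i) ?c \<noteq> 0"
      then obtain p where "entry ?ad (H i) p \<noteq> 0" "entry ?ad p ?c \<noteq> 0"
        using entry_comp_nonzero linear_bracket by blast
      then have "0 = root_vec \<alpha> + (root_vec \<alpha> + root_vec (sroot (- s) i))"
        using entry_bracket_root_vector by (metis basis_weight.simps)
      then have "root_vec \<alpha> = 0" using sum0 by simp
      then show False using is_root_nonzero[of "root_vec \<alpha>"] by simp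
    qed
    show ?thesis using 1 2 True by (simp add: unip_char_def root_elt_eq axis_def)
  next
    case False
    have "entry (root_elt \<alpha> a) (H i) ?c = 0"
    proof (rule ccontr)
      assume "entry (root_elt \<alpha> a) (H i) ?c \<noteq> 0"
      then obtain k where k: "k \<in> {1, 2}" "basis_weight (H i) = k *s root_vec \<alpha> + basis_weight ?c"
        using entry_root_elt_nonzero by blast
      then have k': "k *s root_vec \<alpha> = s *s simple_root i"
        using s by (auto simp: root_vec_sroot[OF s'] vec_eq_iff)
      then have "(k *s root_vec \<alpha>) $ i = (s *s simple_root i) $ i" by simp
      then have "k = 1" using k(1) s by (auto; presburger)
      then have "root_vec \<alpha> = root_vec (sroot s i)" using k' s by (simp add: one_scale)
      then show False using False by (simp add: root_vec_inject)
    qed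
    then show ?thesis using False by (simp add: unip_char_def)
  qed
qed

lemma hom_unip:
  assumes "\<phi> \<in> hom (G_ad\<lparr>carrier := unip S\<rparr>) additive_C" "g \<in> unip S" "h \<in> unip S"
  shows "\<phi> (g \<circ> h) = \<phi> g + \<phi> h"
  using assms hom_mult[OF assms(1)] by (simp add: additive_C_def)

text \<open>A root element for a nonsimple root is a commutator, and the target is
  commutative.\<close>

lemma hom_unip_nonsimple:
  assumes s: "s = 1 \<or> s = - 1" and \<phi>: "\<phi> \<in> hom (G_ad\<lparr>carrier := unip (sroots s)\<rparr>) additive_C"
    and \<alpha>: "\<alpha> \<in> sroots s" "\<And>j. \<alpha> \<noteq> sroot s j"
  shows "\<phi> (root_elt \<alpha> c) = 0"
proof -
  obtain j \<beta> where \<beta>: "\<beta> \<in> sroots s" "root_vec (sroot s j) + root_vec \<beta> = root_vec \<alpha>"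
    using sroots_nonsimple[OF s \<alpha>] by blast
  define e where "e = e6_eps (root_vec (sroot s j)) (root_vec \<beta>)"
  have e: "e * e = 1" by (simp add: e_def)
  let ?x = "root_elt (sroot s j) 1" and ?y = "root_elt \<beta> (c * e)"
  have m: "?x \<in> unip (sroots s)" "?y \<in> unip (sroots s)" "root_elt \<alpha> c \<in> unip (sroots s)"
    using sroot_in_sroots[OF s] \<beta> \<alpha> by (auto intro: root_elt_in_unip)
  have "?x \<circ> ?y = ?y \<circ> root_elt \<alpha> c \<circ> ?x"
    using root_elt_commute[OF \<beta>(2), of 1 "c * e"] e by (simp add: e_def[symmetric] mult.assoc)
  then have "\<phi> (?x \<circ> ?y) = \<phi> (?y \<circ> root_elt \<alpha> c \<circ> ?x)" by (simp only:)
  then show ?thesis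
    using m by (simp only: hom_unip[OF \<phi>] unip_comp) simp
qed

lemma unip_char_unique:
  assumes s: "s = 1 \<or> s = - 1" and \<phi>: "\<phi> \<in> hom (G_ad\<lparr>carrier := unip (sroots s)\<rparr>) additive_C"
    and gen: "\<And>j a. \<phi> (root_elt (sroot s j) (of_int s * a)) = (if i = j then a else 0)"
    and g: "g \<in> unip (sroots s)"
  shows "\<phi> g = unip_char s i g"
  using g
proof (induction rule: unip_induct)
  case id
  have "\<phi> (id \<circ> id) = \<phi> id + \<phi> id" using hom_unip[OF \<phi>] unip_id by blast
  moreover have "unip_char s i (id \<circ> id) = unip_char s i id + unip_char s i id"
    using unip_char_comp[OF s] unip_id by blast
  ultimately have "\<phi> id = 0" "unip_char s i id = 0" by (simp_all only: o_id) simp_all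
  then show ?case by metis
next
  case (root \<alpha> a)
  show ?case
  proof (cases "\<exists>j. \<alpha> = sroot s j")
    case True
    then obtain j where j: "\<alpha> = sroot s j" by blast
    have ss: "of_int s * (of_int s * a) = a" using s by auto
    have "sroot s j = sroot s i \<longleftrightarrow> i = j"
    proof
      assume "sroot s j = sroot s i"
      then have "s *s simple_root j = s *s simple_root i" using root_vec_sroot[OF s] by metis
      then have "(s *s simple_root j) $ i = (s *s simple_root i) $ i" by simp
      then show "i = j" using s by (auto split: if_splits)
    qed simp
    then show ?thesis
      using gen[of j "of_int s * a"] unip_char_root_elt[OF s root, of i a] j by (simp add: ss)
  next
    case False
    then show ?thesis
      using hom_unip_nonsimple[OF s \<phi> root] unip_char_root_elt[OF s root, of i a] by auto
  qed
next
  case (comp g h)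
  then show ?case using hom_unip[OF \<phi>] unip_char_comp[OF s] by metis
qed

lemma unip_char_hom:
  assumes s: "s = 1 \<or> s = - 1"
  shows "restrict (unip_char s i) (unip (sroots s)) \<in> hom (G_ad\<lparr>carrier := unip (sroots s)\<rparr>) additive_C"
proof (rule homI)
  fix g h assume "g \<in> carrier (G_ad\<lparr>carrier := unip (sroots s)\<rparr>)" "h \<in> carrier (G_ad\<lparr>carrier := unip (sroots s)\<rparr>)"
  then show "restrict (unip_char s i) (unip (sroots s)) (g \<otimes>\<^bsub>G_ad\<lparr>carrier := unip (sroots s)\<rparr>\<^esub> h) =
    restrict (unip_char s i) (unip (sroots s)) g \<otimes>\<^bsub>additive_C\<^esub> restrict (unip_char s i) (unip (sroots s)) h"
    using unip_comp[of g _ h] unip_char_comp[OF s, of g h i] by (simp add: additive_C_def)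
qed (simp add: additive_C_def)

text \<open>Values outside the subgroup are pinned by \<open>extensional\<close>, and inside by the
  simple root elements. The factor \<open>of_int s\<close> matches the sign in
  \<open>chev_f\<close>, so both \<open>e_star\<close> and \<open>f_star\<close> are
  covered.\<close>

lemma unip_char_the:
  assumes s: "s = 1 \<or> s = - 1" and g: "g \<in> unip (sroots s)"
  shows "(THE \<phi>. \<phi> \<in> hom (G_ad\<lparr>carrier := unip (sroots s)\<rparr>) additive_C \<inter> extensional (unip (sroots s)) \<and>
     (\<forall>j a. \<phi> (root_elt (sroot s j) (of_int s * a)) = (if i = j then a else 0))) g = unip_char s i g"
proof -
  have "(THE \<phi>. \<phi> \<in> hom (G_ad\<lparr>carrier := unip (sroots s)\<rparr>) additive_C \<inter> extensional (unip (sroots s)) \<and>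
     (\<forall>j a. \<phi> (root_elt (sroot s j) (of_int s * a)) = (if i = j then a else 0)))
    = restrict (unip_char s i) (unip (sroots s))"
  proof (rule the_equality)
    have ss: "of_int s * (of_int s * a) = a" for a :: complex using s by auto
    have "sroot s j = sroot s i \<longleftrightarrow> i = j" for j
    proof
      assume "sroot s j = sroot s i"
      then have "s *s simple_root j = s *s simple_root i" using root_vec_sroot[OF s] by metis
      then have "(s *s simple_root j) $ i = (s *s simple_root i) $ i" by simp
      then show "i = j" using s by (auto split: if_splits)
    qed simp
    then have "restrict (unip_char s i) (unip (sroots s)) (root_elt (sroot s j) (of_int s * a)) = (if i = j then a else 0)" for j a
      using root_elt_in_unip[OF sroot_in_sroots[OF s], of j "of_int s * a"]
        unip_char_root_elt[OF s sroot_in_sroots[OF s], of i j "of_int s * a"] by (simp add: ss)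
    then show "restrict (unip_char s i) (unip (sroots s)) \<in> hom (G_ad\<lparr>carrier := unip (sroots s)\<rparr>) additive_C \<inter> extensional (unip (sroots s)) \<and>
     (\<forall>j a. restrict (unip_char s i) (unip (sroots s)) (root_elt (sroot s j) (of_int s * a)) = (if i = j then a else 0))"
      using unip_char_hom[OF s] by blast
  next
    fix \<phi> assume "\<phi> \<in> hom (G_ad\<lparr>carrier := unip (sroots s)\<rparr>) additive_C \<inter> extensional (unip (sroots s)) \<and>
     (\<forall>j a. \<phi> (root_elt (sroot s j) (of_int s * a)) = (if i = j then a else 0))"
    then show "\<phi> = restrict (unip_char s i) (unip (sroots s))"
      using unip_char_unique[OF s, of \<phi> i] by (intro extensionalityI[of _ "unip (sroots s)"]) auto
  qed
  then show ?thesis using g by simp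
qed

lemma e_star_eq: "g \<in> U_plus \<Longrightarrow> e_star i g = unip_char 1 i g"
  using unip_char_the[of 1 g i] by (simp add: e_star_def U_plus_eq pos_roots_eq x_sub_sroot)

lemma f_star_eq: "g \<in> U_minus \<Longrightarrow> f_star i g = unip_char (- 1) i g"
  using unip_char_the[of "- 1" g i] by (simp add: f_star_def U_minus_eq neg_roots_eq y_sub_sroot)

section \<open>Lifts of Weyl group elements\<close>

lemma gprod_Nil [simp]: "gprod [] = id"
  by (simp add: gprod_def)
lemma gprod_Cons: "gprod (g # gs) = g \<circ> gprod gs"
  by (simp add: gprod_def)
lemma gprod_append: "gprod (gs @ hs) = gprod gs \<circ> gprod hs"
  by (induction gs) (simp_all only: append.simps gprod_Cons gprod_Nil id_comp comp_assoc)
lemma gprod_in_G_ad: "set gs \<subseteq> carrier G_ad \<Longrightarrow> gprod gs \<in> carrier G_ad"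
proof (induction gs)
  case Nil
  then show ?case by (simp only: gprod_Nil G_ad_id)
next
  case (Cons g gs)
  then show ?case unfolding gprod_Cons by (intro G_ad_comp) auto
qed

text \<open>The middle factor is \<open>y_sub i a\<close>, as \<open>chev_f\<close> is a negated
  root vector. The values 1 and -1 of \<open>a\<close> give \<open>s_bar i\<close> and
  \<open>s_dot i\<close>; general \<open>a\<close> occurs in the Bruhat decomposition of
  \<open>y_sub i a\<close>.\<close>

definition refl_elt :: "e6_node \<Rightarrow> complex \<Rightarrow> e6_lie \<Rightarrow> e6_lie" where
  "refl_elt i a = root_elt (sroot 1 i) (- 1 / a) \<circ> root_elt (sroot (- 1) i) (- a) \<circ> root_elt (sroot 1 i) (- 1 / a)"

lemma refl_elt_in_G_ad [simp]: "refl_elt i a \<in> carrier G_ad"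
  unfolding refl_elt_def by (intro G_ad_comp) simp_all

lemma s_dot_eq: "s_dot i = refl_elt i (- 1)"
proof -
  have "s_dot i = root_elt (sroot 1 i) 1 \<circ> (root_elt (sroot (- 1) i) 1 \<circ> root_elt (sroot 1 i) 1)"
    by (simp only: s_dot_def gprod_Cons gprod_Nil comp_id x_sub_sroot y_sub_sroot minus_minus)
  then show ?thesis by (simp add: refl_elt_def comp_assoc)
qed

lemma root_elt_cancel: "root_elt \<alpha> a \<circ> (root_elt \<alpha> (- a) \<circ> g) = g"
  by (simp only: comp_assoc[symmetric] root_elt_add add.right_inverse root_elt_zero id_comp)
lemma root_elt_cancel': "root_elt \<alpha> (- a) \<circ> (root_elt \<alpha> a \<circ> g) = g"
  using root_elt_cancel[of \<alpha> "- a" g] by (simp only: minus_minus)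

lemma s_bar_eq: "s_bar i = refl_elt i 1"
  unfolding s_bar_def s_dot_eq
proof (rule G_ad_inv_equality)
  let ?x = "root_elt (sroot 1 i)" and ?y = "root_elt (sroot (- 1) i)"
  have "refl_elt i 1 \<circ> refl_elt i (- 1)
     = ?x (- 1) \<circ> (?y (- 1) \<circ> (?x (- 1) \<circ> (?x 1 \<circ> (?y 1 \<circ> ?x 1))))"
    by (simp add: refl_elt_def comp_assoc)
  also have "\<dots> = ?x (- 1) \<circ> ?x 1" by (simp only: root_elt_cancel')
  also have "\<dots> = id" by (simp only: root_elt_add add.left_inverse root_elt_zero)
  finally show "refl_elt i 1 \<circ> refl_elt i (- 1) = id" .
qed simp_all

lemma s_bar_in_G_ad [simp]: "s_bar i \<in> carrier G_ad"
  by (simp add: s_bar_eq)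
lemma s_dot_in_G_ad [simp]: "s_dot i \<in> carrier G_ad"
  by (simp add: s_dot_eq)

text \<open>The rank one Bruhat decomposition, up to a torus factor that
  \<open>refl_elt_torus\<close> splits off.\<close>

lemma y_sub_refl_elt:
  assumes "a \<noteq> 0"
  shows "y_sub i a = root_elt (sroot 1 i) (1 / a) \<circ> refl_elt i a \<circ> root_elt (sroot 1 i) (1 / a)"
proof -
  have "root_elt (sroot 1 i) (1 / a) \<circ> refl_elt i a \<circ> root_elt (sroot 1 i) (1 / a)
     = root_elt (sroot 1 i) (1 / a) \<circ> (root_elt (sroot 1 i) (- (1 / a)) \<circ> (root_elt (sroot (- 1) i) (- a)
        \<circ> (root_elt (sroot 1 i) (- (1 / a)) \<circ> root_elt (sroot 1 i) (1 / a))))"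
    by (simp add: refl_elt_def comp_assoc)
  also have "\<dots> = root_elt (sroot (- 1) i) (- a)"
    by (simp only: root_elt_cancel root_elt_add add.left_inverse root_elt_zero comp_id)
  finally show ?thesis by (simp add: y_sub_sroot)
qed

definition rep_refl :: "lattice \<Rightarrow> complex \<Rightarrow> minuscule_fun \<Rightarrow> minuscule_fun" where
  "rep_refl v a = rep_elt v (- 1 / a) \<circ> rep_elt (- v) (- a) \<circ> rep_elt v (- 1 / a)"

lemma lift_refl_elt: "lift (refl_elt i a) (rep_refl (simple_root i) a)"
proof -
  have "root_vec (sroot 1 i) = simple_root i" "root_vec (sroot (- 1) i) = - simple_root i"
    by (simp_all add: one_scale minus_one_scale)
  then show ?thesis
    unfolding refl_elt_def rep_refl_def
    by (metis lift_comp lift_root_elt)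
qed

lemma rep_elt_apply:
  assumes "is_root v" "\<gamma> \<in> minuscule"
  shows "rep_elt v a \<phi> \<gamma> = \<phi> \<gamma> - (if pairing v \<gamma> = 1 then a * e6_eps v \<gamma> * \<phi> (\<gamma> - v) else 0)"
  using assms minuscule_diff_iff[OF assms]
  by (simp add: rep_elt_def rep_root_def e6_eps_diff_right e6_eps_self)

text \<open>Weight strings have one or two elements, so this is a computation with 2 by 2
  matrices.\<close>

lemma rep_refl_apply:
  assumes v: "is_root v" and \<gamma>: "\<gamma> \<in> minuscule" and a: "a \<noteq> 0"
  shows "rep_refl v a \<phi> \<gamma> =
    (if pairing v \<gamma> = 0 then \<phi> \<gamma> else if pairing v \<gamma> = 1 then e6_eps v \<gamma> / a * \<phi> (\<gamma> - v)
     else a * e6_eps v \<gamma> * \<phi> (\<gamma> + v))"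
proof -
  define \<phi>1 where "\<phi>1 = rep_elt v (- 1 / a) \<phi>"
  define \<phi>2 where "\<phi>2 = rep_elt (- v) (- a) \<phi>1"
  have T: "rep_refl v a \<phi> = rep_elt v (- 1 / a) \<phi>2" by (simp add: rep_refl_def \<phi>1_def \<phi>2_def)
  have v': "is_root (- v)" using v by simp
  have vv: "e6_form v v = 2" using v by (simp add: is_root_def)
  note A = rep_elt_apply[OF v] rep_elt_apply[OF v'] and e = e6_eps_square
  \<comment> \<open>At the lower end of a string the old value \<open>\<phi> \<delta>\<close>
    cancels because the sign squares to 1.\<close>
  have low: "\<phi>2 \<delta> = a * e6_eps v \<delta> * \<phi> (\<delta> + v)" if \<delta>: "\<delta> \<in> minuscule" "pairing v \<delta> = - 1" for \<delta>
  proof -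
    have d: "\<delta> + v \<in> minuscule" using minuscule_add_iff[OF v \<delta>(1)] \<delta>(2) by simp
    have "\<phi>1 (\<delta> + v) = \<phi> (\<delta> + v) + (1 / a) * e6_eps v (\<delta> + v) * \<phi> \<delta>"
      using \<delta> d by (simp add: \<phi>1_def A pairing_add_right vv)
    also have "e6_eps v (\<delta> + v) = - e6_eps v \<delta>" using v by (simp add: e6_eps_add_right e6_eps_self)
    finally have "\<phi>1 (\<delta> + v) = \<phi> (\<delta> + v) - (1 / a) * e6_eps v \<delta> * \<phi> \<delta>" by simp
    moreover have "\<phi>2 \<delta> = \<phi> \<delta> + a * e6_eps v \<delta> * \<phi>1 (\<delta> + v)"
      using \<delta> by (simp add: \<phi>2_def A) (simp add: \<phi>1_def A)
    ultimately have "\<phi>2 \<delta> = \<phi> \<delta> + a * e6_eps v \<delta> * (\<phi> (\<delta> + v) - (1 / a) * e6_eps v \<delta> * \<phi> \<delta>)"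
      by (simp only:)
    also have "\<dots> = \<phi> \<delta> + a * e6_eps v \<delta> * \<phi> (\<delta> + v) - (e6_eps v \<delta> * e6_eps v \<delta>) * \<phi> \<delta>"
      using a by (simp add: field_simps del: e6_eps_square)
    finally show ?thesis by simp
  qed
  consider "pairing v \<gamma> = 0" | "pairing v \<gamma> = - 1" | "pairing v \<gamma> = 1"
    using pairing_bounds[OF v \<gamma>] by linarith
  then show ?thesis
  proof cases
    case 1
    then show ?thesis using \<gamma> by (simp add: T A) (simp add: \<phi>2_def \<phi>1_def A)
  next
    case 2
    then show ?thesis using \<gamma> low by (simp add: T A)
  next
    case 3
    have d: "\<gamma> - v \<in> minuscule" using minuscule_diff_iff[OF v \<gamma>] 3 by simp
    have "\<phi>2 (\<gamma> - v) = a * e6_eps v (\<gamma> - v) * \<phi> \<gamma>"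
      using low[OF d] 3 vv by (simp add: pairing_diff_right)
    also have "e6_eps v (\<gamma> - v) = - e6_eps v \<gamma>" using v by (simp add: e6_eps_diff_right e6_eps_self)
    finally have "\<phi>2 (\<gamma> - v) = - (a * e6_eps v \<gamma> * \<phi> \<gamma>)" by simp
    moreover have "\<phi>2 \<gamma> = \<phi> \<gamma> + (1 / a) * e6_eps v \<gamma> * \<phi> (\<gamma> - v)"
      using \<gamma> 3 by (simp add: \<phi>2_def A) (simp add: \<phi>1_def A)
    moreover have "rep_refl v a \<phi> \<gamma> = \<phi>2 \<gamma> + (1 / a) * e6_eps v \<gamma> * \<phi>2 (\<gamma> - v)"
      using \<gamma> 3 by (simp add: T A)
    ultimately have "rep_refl v a \<phi> \<gamma> = \<phi> \<gamma> + (1 / a) * e6_eps v \<gamma> * \<phi> (\<gamma> - v)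
        + (1 / a) * e6_eps v \<gamma> * - (a * e6_eps v \<gamma> * \<phi> \<gamma>)" by (simp only:)
    also have "\<dots> = \<phi> \<gamma> + (1 / a) * e6_eps v \<gamma> * \<phi> (\<gamma> - v) - (e6_eps v \<gamma> * e6_eps v \<gamma>) * \<phi> \<gamma>"
      using a by (simp add: field_simps del: e6_eps_square)
    finally show ?thesis using 3 by simp
  qed
qed

lemma rep_refl_off: "\<gamma> \<notin> minuscule \<Longrightarrow> rep_refl v a \<phi> \<gamma> = \<phi> \<gamma>"
  by (simp add: rep_refl_def rep_elt_supp)

lemma torus_char_power: 
  assumes "a \<noteq> 0"
  shows "torus_char (\<lambda>j. a powi (- e6_form u (simple_root j))) v = a powi (- e6_form u v)"
proof -
  have "e6_form u v = (\<Sum>j\<in>UNIV. e6_form u (simple_root j) * v $ j)"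
    unfolding e6_form_sym[of u v] e6_form_expand[of v u]
    by (simp add: e6_form_sym[of u] mult.commute)
  then have "- e6_form u v = (\<Sum>j\<in>UNIV. - e6_form u (simple_root j) * v $ j)"
    by (simp add: sum_negf)
  moreover have "(\<Prod>j\<in>UNIV. a powi f j) = a powi (\<Sum>j\<in>UNIV. f j)" for f :: "e6_node \<Rightarrow> int"
    using assms by (simp add: sum_e6_node prod_e6_node power_int_add)
  ultimately show ?thesis by (simp only: torus_char_def power_int_mult[symmetric])
qed

text \<open>The torus factor is the coroot of \<open>i\<close> evaluated at \<open>1 / a\<close>; it
  carries all dependence on \<open>a\<close>.\<close>

lemma refl_elt_torus:
  assumes a: "a \<noteq> 0"
  shows "refl_elt i a = torus_elt (\<lambda>j. a powi (- e6_form (simple_root i) (simple_root j))) \<circ> refl_elt i 1"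
proof -
  let ?v = "simple_root i"
  \<comment> \<open>On minuscule weights this is the character of the torus element times a
    constant, the contribution of the lowest weight.\<close>
  define d where "d = (\<lambda>\<gamma>. if \<gamma> \<in> minuscule then a powi (- pairing ?v \<gamma>) else 1)"
  have "lift (torus_elt (\<lambda>j. a powi (- e6_form ?v (simple_root j)))) (\<lambda>\<phi> \<gamma>. d \<gamma> * \<phi> \<gamma>)"
  proof (rule lift_torus_elt)
    fix w \<gamma> assume "\<gamma> \<in> minuscule" "\<gamma> + w \<in> minuscule"
    moreover have "- pairing ?v (\<gamma> + w) = - e6_form ?v w + - pairing ?v \<gamma>" by (simp add: pairing_add_right)
    then have "a powi (- pairing ?v (\<gamma> + w)) = a powi (- e6_form ?v w) * a powi (- pairing ?v \<gamma>)"
      using a by (metis power_int_add)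
    ultimately show "d (\<gamma> + w) = torus_char (\<lambda>j. a powi (- e6_form ?v (simple_root j))) w * d \<gamma>"
      using a by (simp add: d_def torus_char_power)
  qed (use a in \<open>auto simp: d_def\<close>)
  then have "lift (torus_elt (\<lambda>j. a powi (- e6_form ?v (simple_root j))) \<circ> refl_elt i 1)
     ((\<lambda>\<phi> \<gamma>. d \<gamma> * \<phi> \<gamma>) \<circ> rep_refl ?v 1)"
    by (rule lift_comp[OF _ lift_refl_elt])
  moreover have "(\<lambda>\<phi> \<gamma>. d \<gamma> * \<phi> \<gamma>) \<circ> rep_refl ?v 1 = rep_refl ?v a"
  proof (intro ext)
    fix \<phi> \<gamma>
    show "((\<lambda>\<phi> \<gamma>. d \<gamma> * \<phi> \<gamma>) \<circ> rep_refl ?v 1) \<phi> \<gamma> = rep_refl ?v a \<phi> \<gamma>"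
    proof (cases "\<gamma> \<in> minuscule")
      case True
      consider "pairing ?v \<gamma> = 0" | "pairing ?v \<gamma> = - 1" | "pairing ?v \<gamma> = 1"
        using pairing_bounds[of ?v \<gamma>] True by (auto; linarith)
      then show ?thesis using True a
        by cases (simp_all add: d_def rep_refl_apply power_int_minus field_simps)
    qed (simp add: d_def rep_refl_off)
  qed
  ultimately show ?thesis using lift_inject lift_refl_elt by metis
qed

lemma bracket_uminus_right: "bracket x (- y) = - bracket x y"
  by (simp add: bracket_def sum_negf)
lemma bracket_diff_right: "bracket x (y - z) = bracket x y - bracket x z"
  using bracket_add_right[of x y "- z"] by (simp add: bracket_uminus_right)
lemma bracket_diff_left: "bracket (x - y) z = bracket x z - bracket y z"
  by (simp add: bracket_def algebra_simps vec.scale_left_diff_distrib sum_subtractf)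

lemma bracket_H: "bracket (axis (H j) 1) y $ b = of_int (e6_form (simple_root j) (basis_weight b)) * y $ b"
proof -
  have "basis_bracket (H j) p $ b = (if p = b then of_int (e6_form (simple_root j) (basis_weight b)) else 0)" for p
    by (cases p) (auto simp: axis_def)
  then show ?thesis
    by (subst linear_nth_expand[OF linear_bracket])
      (simp add: bracket_axis if_distrib[of "\<lambda>x. _ * x"] cong: if_cong)
qed

lemma refl_elt_H:
  "refl_elt i 1 (axis (H j) 1) = axis (H j) 1 + (- of_int (e6_form (simple_root j) (simple_root i))) *s axis (H i) 1"
proof -
  let ?p = "sroot 1 i" and ?n = "sroot (- 1) i" and ?k = "of_int (e6_form (simple_root j) (simple_root i)) :: complex"
  let ?ep = "root_vector ?p" and ?en = "root_vector ?n" and ?H = "\<lambda>j. axis (H j) 1 :: e6_lie"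
  have rp: "root_vec ?p = simple_root i" and rn: "root_vec ?n = - simple_root i"
    by (simp_all add: one_scale minus_one_scale)
  have ii: "e6_form (simple_root i) (simple_root i) = 2" by (rule e6_form_simple_root)
  have pH: "bracket ?ep (?H m) = (- of_int (e6_form (simple_root m) (simple_root i))) *s ?ep" for m
    unfolding root_vector_def bracket_axis by (simp add: rp)
  have nH: "bracket ?en (?H m) = (of_int (e6_form (simple_root m) (simple_root i))) *s ?en" for m
    unfolding root_vector_def bracket_axis by (simp add: rn)
  have pp: "bracket ?ep ?ep = 0" by (rule bracket_root_vectors_zero) (simp add: rp ii)
  have nn: "bracket ?en ?en = 0" by (rule bracket_root_vectors_zero) (simp add: rn ii)
  have np: "bracket ?en ?ep = ?H i"
  proof -
    have "(\<Sum>k\<in>UNIV. of_int ((- simple_root i) $ k) *s ?H k) = (\<Sum>k\<in>UNIV. if k = i then - ?H i else 0)"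
      by (intro sum.cong) (auto simp: vec_eq_iff)
    then show ?thesis unfolding bracket_root_vectors by (simp add: rp rn)
  qed
  note simps = root_elt_eq pH nH pp nn np bracket_add_right bracket_scale_right
    bracket_uminus_right bracket_diff_right ii
  have 1: "root_elt ?p (- 1) (?H j) = ?H j + ?k *s ?ep"
    by (simp add: simps)
  have 2: "root_elt ?n (- 1) (?H j + ?k *s ?ep) = ?H j + ?k *s ?ep + (- ?k) *s ?H i"
    by (simp add: simps)
  have 3: "root_elt ?p (- 1) (?H j + ?k *s ?ep + (- ?k) *s ?H i) = ?H j + (- ?k) *s ?H i"
    by (simp add: simps) (simp add: vec_eq_iff algebra_simps)
  show ?thesis using 1 2 3 by (simp add: refl_elt_def)
qed

lemma e6_form_nondegenerate:
  assumes "\<And>j. e6_form (simple_root j) v = 0" shows "v = 0"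
proof -
  have "e6_form v v = 0" unfolding e6_form_expand[of v v] using assms by simp
  then show ?thesis by (simp add: e6_form_eq_0)
qed

text \<open>The element is an automorphism acting on the Cartan subalgebra by the reflection
  (\<open>refl_elt_H\<close>), so the image of a root vector is a common eigenvector with reflected
  eigenvalues; nondegeneracy of the form turns eigenvalues into weights.\<close>

lemma shape_refl_elt: "shape {0} (simple_refl i) (refl_elt i 1)"
  unfolding shape_def
proof (intro allI impI)
  fix b c assume nz: "entry (refl_elt i 1) b c \<noteq> 0"
  show "basis_weight b - simple_refl i (basis_weight c) \<in> {0}"
  proof (cases c)
    case (H j)
    have "b = H j \<or> b = H i"
      using nz unfolding H refl_elt_H by (auto simp: axis_def split: if_splits)
    then show ?thesis using H by (auto simp: simple_refl_def)
  next
    case (E \<beta>)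
    let ?y = "refl_elt i 1 (root_vector \<beta>)"
    have "e6_form (simple_root j) (simple_refl i (basis_weight b) - root_vec \<beta>) = 0" for j
    proof -
      let ?k = "e6_form (simple_root j) (simple_root i)"
      have "refl_elt i 1 (bracket (axis (H j) 1) (root_vector \<beta>))
         = bracket (axis (H j) 1 + (- of_int ?k) *s axis (H i) 1) ?y"
        using lift_bracket[OF lift_refl_elt] refl_elt_H by metis
      moreover have "bracket (axis (H j) 1) (root_vector \<beta>) = of_int (e6_form (simple_root j) (root_vec \<beta>)) *s root_vector \<beta>"
        unfolding root_vector_def bracket_axis by simp
      ultimately have "of_int (e6_form (simple_root j) (root_vec \<beta>)) *s ?y
         = bracket (axis (H j) 1) ?y + (- of_int ?k) *s bracket (axis (H i) 1) ?y"
        by (simp add: vec.linear_scale[OF G_ad_linear[OF refl_elt_in_G_ad]] bracket_diff_left bracket_scale_left)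
      then have "(of_int (e6_form (simple_root j) (root_vec \<beta>)) *s ?y) $ b
         = (bracket (axis (H j) 1) ?y + (- of_int ?k) *s bracket (axis (H i) 1) ?y) $ b" by (simp only:)
      then have "of_int (e6_form (simple_root j) (root_vec \<beta>)) * ?y $ b
         = of_int (e6_form (simple_root j) (basis_weight b) - ?k * e6_form (simple_root i) (basis_weight b)) * ?y $ b"
        by (simp add: bracket_H algebra_simps)
      moreover have "?y $ b \<noteq> 0" using nz by (simp add: E root_vector_def)
      ultimately have "e6_form (simple_root j) (root_vec \<beta>)
         = e6_form (simple_root j) (basis_weight b) - ?k * e6_form (simple_root i) (basis_weight b)"
        by (metis mult_right_cancel of_int_eq_iff)
      then show ?thesis
        by (simp add: simple_refl_def e6_form_sym[of "basis_weight b"] mult.commute)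
    qed
    then have "simple_refl i (basis_weight b) = root_vec \<beta>"
      using e6_form_nondegenerate by (metis eq_iff_diff_eq_0)
    then show ?thesis using E simple_refl_involution by (metis basis_weight.simps(2) eq_iff_diff_eq_0 insertI1)
  qed
qed

lemma shape_s_bar: "shape {0} (simple_refl i) (s_bar i)"
  using shape_refl_elt by (simp add: s_bar_eq)

lemma shape_zero_comp:
  assumes "g \<in> carrier G_ad" "shape {0} (weyl_word is) g" "shape {0} w h"
  shows "shape {0} (weyl_word is \<circ> w) (g \<circ> h)"
  by (rule shape_comp[OF G_ad_linear[OF assms(1)] assms(2,3)]) simp

lemma shape_s_dot: "shape {0} (simple_refl i) (s_dot i)"
proof -
  let ?t = "torus_elt (\<lambda>j. (- 1) powi (- e6_form (simple_root i) (simple_root j)))"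
  have "shape {0} (weyl_word [] \<circ> simple_refl i) (?t \<circ> refl_elt i 1)"
    by (intro shape_zero_comp shape_refl_elt torus_elt_in_G_ad) (simp_all add: shape_torus_elt)
  then show ?thesis
    unfolding s_dot_eq refl_elt_torus[of "- 1", simplified] by simp
qed

lemma shape_word:
  assumes "\<And>i. shape {0} (simple_refl i) (f i)" "\<And>i. f i \<in> carrier G_ad"
  shows "shape {0} (weyl_word is) (gprod (map f is))"
proof (induction "is")
  case Nil
  show ?case by (simp only: list.map gprod_Nil weyl_word_Nil) (rule shape_id, simp)
next
  case (Cons i "is")
  have "shape {0} (weyl_word [i] \<circ> weyl_word is) (f i \<circ> gprod (map f is))"
    using assms Cons by (intro shape_zero_comp) simp_all
  then show ?case by (simp only: list.map gprod_Cons weyl_word_Cons weyl_word_Nil comp_id)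
qed

lemmas shape_s_bar_word = shape_word[of s_bar, OF shape_s_bar s_bar_in_G_ad]
  and shape_s_dot_word = shape_word[of s_dot, OF shape_s_dot s_dot_in_G_ad]

lemma s_bar_word_in_G_ad: "gprod (map s_bar is) \<in> carrier G_ad"
  by (rule gprod_in_G_ad) auto
lemma s_dot_word_in_G_ad: "gprod (map s_dot is) \<in> carrier G_ad"
  by (rule gprod_in_G_ad) auto

lemma s_dot_s_bar: "s_dot i \<circ> s_bar i = id" "s_bar i \<circ> s_dot i = id"
  using G_ad_inv_comp[of "s_dot i"] by (simp_all add: s_bar_def)

lemma inv_s_bar_word: "inv\<^bsub>G_ad\<^esub> (gprod (map s_bar is)) = gprod (map s_dot (rev is))"
proof (rule G_ad_inv_equality[OF s_bar_word_in_G_ad s_dot_word_in_G_ad])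
  show "gprod (map s_dot (rev is)) \<circ> gprod (map s_bar is) = id"
  proof (induction "is")
    case Nil
    show ?case by (simp only: list.map rev.simps gprod_Nil comp_id)
  next
    case (Cons i "is")
    have "gprod (map s_dot (rev (i # is))) \<circ> gprod (map s_bar (i # is))
        = gprod (map s_dot (rev is)) \<circ> ((s_dot i \<circ> s_bar i) \<circ> gprod (map s_bar is))"
      by (simp only: rev.simps map_append list.map gprod_append gprod_Cons gprod_Nil comp_id comp_assoc)
    then show ?case using Cons by (simp only: s_dot_s_bar id_comp)
  qed
qed

text \<open>Root spaces are one-dimensional and 0 is not a root, so only one basis vector can occur
  in the image; injectivity makes its coefficient nonzero.\<close>

lemma shape_zero_root_vector:
  assumes g: "g \<in> carrier G_ad" and sh: "shape {0} (weyl_word is) g"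
  shows "\<exists>c. c \<noteq> 0 \<and> g (root_vector \<alpha>) = c *s root_vector (Root (weyl_word is (root_vec \<alpha>)))"
proof -
  let ?\<beta> = "Root (weyl_word is (root_vec \<alpha>))"
  have r: "root_vec ?\<beta> = weyl_word is (root_vec \<alpha>)" by simp
  have "g (root_vector \<alpha>) $ b = (entry g (E ?\<beta>) (E \<alpha>) *s root_vector ?\<beta>) $ b" for b
  proof (cases "entry g b (E \<alpha>) = 0")
    case True
    then show ?thesis by (auto simp: root_vector_def axis_def)
  next
    case False
    then have w: "basis_weight b = root_vec ?\<beta>" using sh r by (auto simp: shape_def)
    have "b = E ?\<beta>"
    proof (cases b)
      case (H i)
      then have "root_vec ?\<beta> = 0" using w by (metis basis_weight.simps(1))
      then show ?thesis using is_root_nonzero[OF is_root_root_vec[of ?\<beta>]] by blast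
    next
      case (E \<delta>)
      then show ?thesis using w by (simp only: basis_weight.simps root_vec_inject)
    qed
    then show ?thesis by (simp add: root_vector_def axis_def)
  qed
  then have eq: "g (root_vector \<alpha>) = entry g (E ?\<beta>) (E \<alpha>) *s root_vector ?\<beta>" by (simp add: vec_eq_iff)
  have "entry g (E ?\<beta>) (E \<alpha>) \<noteq> 0"
  proof
    assume "entry g (E ?\<beta>) (E \<alpha>) = 0"
    then have "g (root_vector \<alpha>) = g 0" using eq vec.linear_0[OF G_ad_linear[OF g]] by simp
    then have "root_vector \<alpha> = 0" using G_ad_bij[OF g] by (metis bij_def injD)
    then show False by (simp add: root_vector_def axis_eq_0_iff)
  qed
  then show ?thesis using eq by blast
qed

lemma torus_char_scale: 
  assumes "\<And>i. c i \<noteq> 0"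
  shows "torus_char c (k *s v) = torus_char c v powi k"
  using assms
  by (simp add: torus_char_def prod_e6_node power_int_mult_distrib mult.commute[of k] power_int_mult)

lemma torus_char_word:
  assumes c: "\<And>i. c i \<noteq> 0"
  shows "torus_char (\<lambda>j. torus_char c (weyl_word is (simple_root j))) v = torus_char c (weyl_word is v)"
proof -
  have "torus_char c (\<Sum>j\<in>A. f j) = (\<Prod>j\<in>A. torus_char c (f j))" if "finite A" for f :: "e6_node \<Rightarrow> lattice" and A
    using that by (induction A) (simp_all add: torus_char_add c)
  from this[OF finite_class.finite_UNIV]
  have "torus_char c (weyl_word is v) = (\<Prod>j\<in>UNIV. torus_char c (v $ j *s weyl_word is (simple_root j)))"
    unfolding weyl_word_expand[of "is" v] by simp
  then show ?thesis using c
    by (simp add: torus_char_scale) (simp add: torus_char_def)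
qed

lemma torus_elt_weight:
  assumes "\<And>b. v $ b \<noteq> 0 \<Longrightarrow> basis_weight b = \<mu>"
  shows "torus_elt c v = torus_char c \<mu> *s v"
proof -
  have "torus_elt c v $ b = (torus_char c \<mu> *s v) $ b" for b
  proof (cases "v $ b = 0")
    case True
    then show ?thesis by (cases b) (simp_all add: torus_elt_nth)
  next
    case False
    then show ?thesis using assms[of b] by (cases b) (auto simp: torus_elt_nth)
  qed
  then show ?thesis by (simp add: vec_eq_iff)
qed

lemma linear_eqI:
  assumes "Vector_Spaces.linear (*s) (*s) g" "Vector_Spaces.linear (*s) (*s) h" "\<And>b. g (axis b 1) = h (axis b 1)"
  shows "g = (h :: e6_lie \<Rightarrow> e6_lie)"
proof
  fix v show "g v = h v"
    by (simp add: vec_eq_iff linear_nth_expand[OF assms(1), of v] linear_nth_expand[OF assms(2), of v] assms(3))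
qed

lemma torus_conj:
  assumes g: "g \<in> carrier G_ad" and sh: "shape {0} (weyl_word is) g" and c: "\<And>i. c i \<noteq> 0"
  shows "g \<circ> torus_elt c = torus_elt (\<lambda>j. torus_char c (weyl_word (rev is) (simple_root j))) \<circ> g"
proof (rule linear_eqI)
  let ?c' = "\<lambda>j. torus_char c (weyl_word (rev is) (simple_root j))"
  have c': "?c' i \<noteq> 0" for i by (rule torus_char_nonzero[OF c])
  show "Vector_Spaces.linear (*s) (*s) (g \<circ> torus_elt c)"
    by (rule G_ad_linear[OF G_ad_comp[OF g torus_elt_in_G_ad[OF c]]])
  show "Vector_Spaces.linear (*s) (*s) (torus_elt ?c' \<circ> g)"
    by (rule G_ad_linear[OF G_ad_comp[OF torus_elt_in_G_ad[OF c'] g]])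
  fix b
  have "torus_elt c (axis b 1) = torus_char c (basis_weight b) *s axis b 1"
    by (rule torus_elt_weight) (auto simp: axis_def split: if_splits)
  then have "(g \<circ> torus_elt c) (axis b 1) = torus_char c (basis_weight b) *s g (axis b 1)"
    by (simp add: vec.linear_scale[OF G_ad_linear[OF g]])
  also have "\<dots> = torus_char ?c' (weyl_word is (basis_weight b)) *s g (axis b 1)"
    unfolding torus_char_word[OF c] by simp
  also have "\<dots> = torus_elt ?c' (g (axis b 1))"
    using sh by (intro torus_elt_weight[symmetric]) (auto simp: shape_def)
  finally show "(g \<circ> torus_elt c) (axis b 1) = (torus_elt ?c' \<circ> g) (axis b 1)" by simp
qed

section \<open>Bruhat cells\<close>

text \<open>The group generated by the torus and the positive roots other than
  \<open>simple_root i\<close> is normalised by the root subgroup of \<open>simple_root i\<close>: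
  sums of that simple root with the others are again positive and different from it.\<close>

lemma ex_borel_commute:
  assumes "b \<in> borel (pos_roots - {sroot 1 i})"
  shows "\<exists>b'\<in>borel (pos_roots - {sroot 1 i}). \<exists>c. root_elt (sroot 1 i) a \<circ> b = b' \<circ> root_elt (sroot 1 i) c"
  using assms
proof (induction arbitrary: a rule: borel_induct)
  case id
  have "root_elt (sroot 1 i) a \<circ> id = id \<circ> root_elt (sroot 1 i) a" by (simp only: comp_id id_comp)
  then show ?case using borel_id by blast
next
  case (torus c)
  let ?k = "torus_char c (root_vec (sroot 1 i))"
  have "?k \<noteq> 0" using torus torus_char_nonzero by blast
  then have "torus_elt c \<circ> root_elt (sroot 1 i) (a / ?k) = root_elt (sroot 1 i) a \<circ> torus_elt c"
    using root_elt_conj[OF lift_torus_elt_char torus_elt_root_vector[of c "sroot 1 i"], where a = "a / ?k"] torus by simp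
  moreover have "torus_elt c \<in> borel (pos_roots - {sroot 1 i})"
    using torus by (intro torus_subset_borel torus_elt_in_torus)
  ultimately show ?case by metis
next
  case (root \<beta> b)
  have rp: "root_vec (sroot 1 i) = simple_root i" by (simp add: one_scale)
  have \<beta>: "root_elt \<beta> b \<in> borel (pos_roots - {sroot 1 i})"
    using root by (intro unip_subset_borel root_elt_in_unip)
  show ?case
  proof (cases "e6_form (simple_root i) (root_vec \<beta>) = - 1")
    case True
    then have "is_root (simple_root i + root_vec \<beta>)" using is_root_add_iff[of "simple_root i" "root_vec \<beta>"] by simp
    then have d: "root_vec (sroot 1 i) + root_vec \<beta> = root_vec (Root (simple_root i + root_vec \<beta>))"
      by (simp add: rp)
    let ?d = "Root (simple_root i + root_vec \<beta>)"
    have "?d \<in> pos_roots"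
      using root lat_nonneg_add[of "simple_root i" "root_vec \<beta>"] d unfolding rp by (simp add: pos_roots_iff)
    moreover have "?d \<noteq> sroot 1 i"
      using d is_root_nonzero[OF is_root_root_vec[of \<beta>]] by auto
    ultimately have "root_elt ?d x \<in> borel (pos_roots - {sroot 1 i})" for x
      by (intro unip_subset_borel root_elt_in_unip) blast
    then have "root_elt \<beta> b \<circ> root_elt ?d x \<in> borel (pos_roots - {sroot 1 i})" for x
      using \<beta> borel_comp by blast
    then show ?thesis using root_elt_commute[OF d, of a b] by blast
  next
    case False
    have "root_vec \<beta> \<noteq> - simple_root i"
      using root not_lat_nonneg_uminus_simple[of i] by (auto simp: pos_roots_iff)
    then have "e6_form (simple_root i) (root_vec \<beta>) \<noteq> - 2"
      using root_form_bounds(4)[of "simple_root i" "root_vec \<beta>"] by auto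
    then have "0 \<le> e6_form (simple_root i) (root_vec \<beta>)"
      using root_form_bounds(1)[of "simple_root i" "root_vec \<beta>"] False by simp
    then have "root_elt (sroot 1 i) a (root_vector \<beta>) = 1 *s root_vector \<beta>"
      by (simp add: root_elt_root_vector_zero rp)
    from root_elt_conj[OF lift_root_elt this, of b]
    have "root_elt (sroot 1 i) a \<circ> root_elt \<beta> b = root_elt \<beta> b \<circ> root_elt (sroot 1 i) a" by simp
    then show ?thesis using \<beta> by blast
  qed
next
  case (comp g h)
  obtain g' c where g': "g' \<in> borel (pos_roots - {sroot 1 i})" "root_elt (sroot 1 i) a \<circ> g = g' \<circ> root_elt (sroot 1 i) c"
    using comp by blast
  obtain h' d where h': "h' \<in> borel (pos_roots - {sroot 1 i})" "root_elt (sroot 1 i) c \<circ> h = h' \<circ> root_elt (sroot 1 i) d"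
    using comp by blast
  have "root_elt (sroot 1 i) a \<circ> (g \<circ> h) = (g' \<circ> h') \<circ> root_elt (sroot 1 i) d"
    using g'(2) h'(2) by (metis comp_assoc)
  then show ?case using borel_comp[OF g'(1) h'(1)] by blast
qed

lemma ex_borel_decomp:
  assumes "b \<in> borel pos_roots"
  shows "\<exists>b'\<in>borel (pos_roots - {sroot 1 i}). \<exists>c. b = b' \<circ> root_elt (sroot 1 i) c"
  using assms
proof (induction rule: borel_induct)
  case id
  have "id = id \<circ> root_elt (sroot 1 i) 0" by (simp only: root_elt_zero comp_id)
  then show ?case using borel_id by blast
next
  case (torus c)
  have "torus_elt c = torus_elt c \<circ> root_elt (sroot 1 i) 0" by (simp only: root_elt_zero comp_id)
  moreover have "torus_elt c \<in> borel (pos_roots - {sroot 1 i})"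
    using torus by (intro torus_subset_borel torus_elt_in_torus)
  ultimately show ?case by blast
next
  case (root \<beta> b)
  show ?case
  proof (cases "\<beta> = sroot 1 i")
    case True
    have "root_elt \<beta> b = id \<circ> root_elt (sroot 1 i) b" by (simp only: True id_comp)
    then show ?thesis using borel_id by blast
  next
    case False
    have "root_elt \<beta> b = root_elt \<beta> b \<circ> root_elt (sroot 1 i) 0" by (simp only: root_elt_zero comp_id)
    moreover have "root_elt \<beta> b \<in> borel (pos_roots - {sroot 1 i})"
      using root False by (intro unip_subset_borel root_elt_in_unip) blast
    ultimately show ?thesis by blast
  qed
next
  case (comp g h)
  obtain g' c where g': "g' \<in> borel (pos_roots - {sroot 1 i})" "g = g' \<circ> root_elt (sroot 1 i) c"
    using comp by blast
  obtain h' d where h': "h' \<in> borel (pos_roots - {sroot 1 i})" "h = h' \<circ> root_elt (sroot 1 i) d"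
    using comp by blast
  obtain h'' e where h'': "h'' \<in> borel (pos_roots - {sroot 1 i})" "root_elt (sroot 1 i) c \<circ> h' = h'' \<circ> root_elt (sroot 1 i) e"
    using ex_borel_commute[OF h'(1)] by blast
  have "g \<circ> h = (g' \<circ> h'') \<circ> (root_elt (sroot 1 i) e \<circ> root_elt (sroot 1 i) d)"
    using g'(2) h'(2) h''(2) by (metis comp_assoc)
  then show ?case using borel_comp[OF g'(1) h''(1)] by (metis root_elt_add)
qed

text \<open>The simple reflection keeps every positive root other than its own positive.\<close>

lemma s_bar_conj_borel:
  assumes "b \<in> borel (pos_roots - {sroot 1 i})"
  shows "\<exists>b'\<in>borel pos_roots. s_bar i \<circ> b = b' \<circ> s_bar i"
  using assms
proof (induction rule: borel_induct)
  case id
  have "s_bar i \<circ> id = id \<circ> s_bar i" by (simp only: comp_id id_comp)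
  then show ?case using borel_id by blast
next
  case (torus c)
  have "shape {0} (weyl_word [i]) (s_bar i)" using shape_s_bar by simp
  from torus_conj[OF s_bar_in_G_ad this torus]
  have "s_bar i \<circ> torus_elt c = torus_elt (\<lambda>j. torus_char c (weyl_word (rev [i]) (simple_root j))) \<circ> s_bar i" .
  moreover have "torus_elt (\<lambda>j. torus_char c (weyl_word (rev [i]) (simple_root j))) \<in> borel pos_roots"
    by (intro torus_subset_borel torus_elt_in_torus torus_char_nonzero torus)
  ultimately show ?case by blast
next
  case (root \<beta> a)
  have "shape {0} (weyl_word [i]) (s_bar i)" using shape_s_bar by simp
  then obtain c where "s_bar i (root_vector \<beta>) = c *s root_vector (Root (weyl_word [i] (root_vec \<beta>)))"
    using shape_zero_root_vector[OF s_bar_in_G_ad] by blast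
  moreover have "lift (s_bar i) (rep_refl (simple_root i) 1)"
    using lift_refl_elt by (simp add: s_bar_eq)
  ultimately have "s_bar i \<circ> root_elt \<beta> a = root_elt (Root (weyl_word [i] (root_vec \<beta>))) (a * c) \<circ> s_bar i"
    by (intro root_elt_conj)
  moreover have "root_vec \<beta> \<noteq> simple_root i"
  proof
    assume "root_vec \<beta> = simple_root i"
    then have "root_vec \<beta> = root_vec (sroot 1 i)" by (simp add: one_scale)
    then have "\<beta> = sroot 1 i" by (simp only: root_vec_inject)
    then show False using root by simp
  qed
  then have "lat_nonneg (weyl_word [i] (root_vec \<beta>))"
    using simple_refl_lat_nonneg root by (simp add: pos_roots_iff)
  then have "root_elt (Root (weyl_word [i] (root_vec \<beta>))) (a * c) \<in> borel pos_roots"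
    by (intro unip_subset_borel root_elt_in_unip) (simp add: pos_roots_iff)
  ultimately show ?case by blast
next
  case (comp g h)
  then show ?case using borel_comp by (metis comp_assoc)
qed

definition bruhat_cell :: "(e6_lie \<Rightarrow> e6_lie) \<Rightarrow> (e6_lie \<Rightarrow> e6_lie) set" where
  "bruhat_cell n = {b \<circ> n \<circ> b' | b b'. b \<in> B_plus \<and> b' \<in> B_plus}"

text \<open>After the rank one decomposition, the Borel factor next to \<open>s_bar i\<close> is
  split. The part without \<open>simple_root i\<close> moves left through \<open>s_bar i\<close>;
  the remaining root element moves right through \<open>n\<close> and stays in the Borel subgroup
  because \<open>pos\<close> makes the transported root positive. So the product lies in a single
  cell.\<close>

lemma y_sub_bruhat_cell:
  assumes a: "a \<noteq> 0" and n: "n \<in> carrier G_ad" "shape {0} (weyl_word is) n"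
    and pos: "lat_nonneg (weyl_word (rev is) (simple_root i))" and p: "p \<in> bruhat_cell n"
  shows "y_sub i a \<circ> p \<in> bruhat_cell (s_bar i \<circ> n)"
proof -
  obtain b1 b2 where b: "p = b1 \<circ> n \<circ> b2" "b1 \<in> borel pos_roots" "b2 \<in> borel pos_roots"
    using p by (auto simp: bruhat_cell_def B_plus_eq)
  let ?x = "root_elt (sroot 1 i)"
  let ?t = "torus_elt (\<lambda>j. a powi (- e6_form (simple_root i) (simple_root j)))"
  have x: "?x c \<in> borel pos_roots" for c
    using sroot_in_sroots[of 1 i] by (intro unip_subset_borel root_elt_in_unip) (simp add: pos_roots_eq)
  have t: "?t \<in> borel pos_roots" using a by (intro torus_subset_borel torus_elt_in_torus) simp
  obtain b' c where b': "b' \<in> borel (pos_roots - {sroot 1 i})" "?x (1 / a) \<circ> b1 = b' \<circ> ?x c"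
    using ex_borel_decomp[OF borel_comp[OF x b(2)]] by blast
  obtain b'' where b'': "b'' \<in> borel pos_roots" "s_bar i \<circ> b' = b'' \<circ> s_bar i"
    using s_bar_conj_borel[OF b'(1)] by blast
  let ?\<delta> = "Root (weyl_word (rev is) (simple_root i))"
  have d: "root_vec ?\<delta> = weyl_word (rev is) (simple_root i)" by simp
  have "Root (weyl_word is (root_vec ?\<delta>)) = sroot 1 i" by (simp add: sroot_def one_scale)
  then obtain k where k: "k \<noteq> 0" "n (root_vector ?\<delta>) = k *s root_vector (sroot 1 i)"
    using shape_zero_root_vector[OF n, of ?\<delta>] by auto
  obtain T where "lift n T" using ex_lift_G_ad[OF n(1)] by blast
  from root_elt_conj[OF this k(2), of "c / k"] k(1)
  have nx: "n \<circ> root_elt ?\<delta> (c / k) = ?x c \<circ> n" by simp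
  have \<delta>: "root_elt ?\<delta> (c / k) \<in> borel pos_roots"
    using pos by (intro unip_subset_borel root_elt_in_unip) (simp add: pos_roots_iff d)
  have y: "y_sub i a = ?x (1 / a) \<circ> ?t \<circ> s_bar i \<circ> ?x (1 / a)"
    unfolding y_sub_refl_elt[OF a] refl_elt_torus[OF a] s_bar_eq by (simp only: comp_assoc)
  have "y_sub i a \<circ> p = ?x (1 / a) \<circ> ?t \<circ> s_bar i \<circ> (?x (1 / a) \<circ> b1) \<circ> n \<circ> b2"
    unfolding y b(1) by (simp only: comp_assoc)
  also have "\<dots> = ?x (1 / a) \<circ> ?t \<circ> (s_bar i \<circ> b') \<circ> (?x c \<circ> n) \<circ> b2"
    unfolding b'(2) by (simp only: comp_assoc)
  also have "\<dots> = (?x (1 / a) \<circ> ?t \<circ> b'') \<circ> (s_bar i \<circ> n) \<circ> (root_elt ?\<delta> (c / k) \<circ> b2)"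
    unfolding b''(2) nx[symmetric] by (simp only: comp_assoc)
  finally show ?thesis
    unfolding bruhat_cell_def B_plus_eq
    using borel_comp[OF borel_comp[OF x t] b''(1)] borel_comp[OF \<delta> b(3)] by blast
qed

text \<open>Every letter lengthens the part of the word to its right. The inverse word appears
  because \<open>y_sub_bruhat_cell\<close> needs the root transported through \<open>n\<close> to
  the right.\<close>

fun positive_word :: "e6_node list \<Rightarrow> bool" where
  "positive_word [] \<longleftrightarrow> True"
| "positive_word (i # is) \<longleftrightarrow> lat_nonneg (weyl_word (rev is) (simple_root i)) \<and> positive_word is"

lemma y_word_bruhat_cell:
  assumes "positive_word (map fst ps)" "\<forall>(i, a)\<in>set ps. a \<noteq> 0"
  shows "gprod (map (\<lambda>(i, a). y_sub i a) ps) \<in> bruhat_cell (gprod (map s_bar (map fst ps)))"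
  using assms
proof (induction ps)
  case Nil
  have "id = id \<circ> id \<circ> (id :: e6_lie \<Rightarrow> e6_lie)" by (simp only: comp_id)
  then have "id \<in> bruhat_cell id"
    unfolding bruhat_cell_def B_plus_eq using borel_id[of pos_roots] by blast
  then show ?case by (simp only: list.map gprod_Nil)
next
  case (Cons q ps)
  obtain i a where q: "q = (i, a)" by force
  have "y_sub i a \<circ> gprod (map (\<lambda>(i, a). y_sub i a) ps) \<in> bruhat_cell (s_bar i \<circ> gprod (map s_bar (map fst ps)))"
    using Cons q by (intro y_sub_bruhat_cell[OF _ s_bar_word_in_G_ad shape_s_bar_word]) auto
  then show ?case by (simp only: q list.map prod.case fst_conv gprod_Cons)
qed

section \<open>Elements acting trivially on weights\<close>

text \<open>Such an automorphism scales each root vector by some \<open>k\<close>; brackets make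
  \<open>k\<close> multiplicative on sums of roots, so \<open>k\<close> is the character with the
  given values on simple roots. The Cartan subalgebra is spanned by brackets of opposite root
  vectors and is fixed.\<close>

lemma shape_zero_id_torus:
  assumes g: "g \<in> carrier G_ad" and sh: "shape {0} id g"
  shows "\<exists>c. (\<forall>i. c i \<noteq> 0) \<and> g = torus_elt c"
proof -
  obtain T where "lift g T" using ex_lift_G_ad[OF g] by blast
  note br = lift_bracket[OF this]
  note lin = vec.linear_scale[OF G_ad_linear[OF g]]
  have sh': "shape {0} (weyl_word []) g" using sh by (simp only: weyl_word_Nil)
  define k where "k \<alpha> = (SOME c. c \<noteq> 0 \<and> g (root_vector \<alpha>) = c *s root_vector \<alpha>)" for \<alpha>
  have k: "k \<alpha> \<noteq> 0 \<and> g (root_vector \<alpha>) = k \<alpha> *s root_vector \<alpha>" for \<alpha>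
  proof -
    have "\<exists>c. c \<noteq> 0 \<and> g (root_vector \<alpha>) = c *s root_vector \<alpha>"
      using shape_zero_root_vector[OF g sh', of \<alpha>] by (simp add: root_vec_inverse)
    then show ?thesis unfolding k_def by (rule someI_ex)
  qed
  have rv0: "root_vector \<alpha> \<noteq> 0" for \<alpha> by (simp add: root_vector_def axis_eq_0_iff)
  have scale_inj: "c = d" if "c *s x = d *s x" "x \<noteq> 0" for c d :: complex and x :: e6_lie
    using that by simp
  have kadd: "k \<delta> = k \<alpha> * k \<beta>" if "root_vec \<alpha> + root_vec \<beta> = root_vec \<delta>" for \<alpha> \<beta> \<delta>
  proof -
    have "g (bracket (root_vector \<alpha>) (root_vector \<beta>)) = (k \<alpha> * k \<beta>) *s bracket (root_vector \<alpha>) (root_vector \<beta>)"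
      unfolding br using k by (simp add: bracket_scale_left bracket_scale_right vector_smult_assoc)
    then have "(e6_eps (root_vec \<alpha>) (root_vec \<beta>) * k \<delta>) *s root_vector \<delta>
       = (k \<alpha> * k \<beta> * e6_eps (root_vec \<alpha>) (root_vec \<beta>)) *s root_vector \<delta>"
      using k by (simp add: bracket_root_vectors_sum[OF that] lin vector_smult_assoc)
    then show ?thesis using rv0 by simp
  qed
  define Hv where "Hv \<alpha> = (\<Sum>i\<in>UNIV. of_int (root_vec \<alpha> $ i) *s (axis (H i) 1 :: e6_lie))" for \<alpha>
  have Hb: "bracket (root_vector \<alpha>) (root_vector \<beta>) = - Hv \<alpha>" if "root_vec \<alpha> + root_vec \<beta> = 0" for \<alpha> \<beta>
    using that by (simp add: bracket_root_vectors Hv_def)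
  have Hact: "bracket (root_vector \<alpha>) (Hv \<alpha>) = (- 2) *s root_vector \<alpha>" for \<alpha>
  proof -
    have "bracket (root_vector \<alpha>) (Hv \<alpha>)
       = (\<Sum>i\<in>UNIV. of_int (root_vec \<alpha> $ i) *s bracket (root_vector \<alpha>) (axis (H i) 1))"
      unfolding Hv_def
      by (simp add: vec.linear_sum[OF linear_bracket] vec.linear_scale[OF linear_bracket])
    also have "\<dots> = (\<Sum>i\<in>UNIV. - of_int (root_vec \<alpha> $ i * e6_form (simple_root i) (root_vec \<alpha>)) *s root_vector \<alpha>)"
      unfolding root_vector_def bracket_axis by (intro sum.cong) (simp_all add: vector_smult_assoc)
    also have "\<dots> = (- of_int (e6_form (root_vec \<alpha>) (root_vec \<alpha>))) *s root_vector \<alpha>"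
      unfolding e6_form_expand[of "root_vec \<alpha>" "root_vec \<alpha>"]
      by (simp add: vec.scale_sum_left sum_negf)
    finally show ?thesis using is_root_root_vec[of \<alpha>] by (simp add: is_root_def)
  qed
  \<comment> \<open>The bracket of the two root vectors is scaled by
    \<open>k \<alpha> * k \<beta>\<close>. It acts on the first root vector by a nonzero eigenvalue,
    which an automorphism scaling that vector can respect only if the factor is 1.\<close>
  have kneg: "k \<alpha> * k \<beta> = 1" if ab: "root_vec \<alpha> + root_vec \<beta> = 0" for \<alpha> \<beta>
  proof -
    have "g (Hv \<alpha>) = (k \<alpha> * k \<beta>) *s Hv \<alpha>"
    proof -
      have "g (bracket (root_vector \<alpha>) (root_vector \<beta>)) = (k \<alpha> * k \<beta>) *s bracket (root_vector \<alpha>) (root_vector \<beta>)"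
        unfolding br using k by (simp add: bracket_scale_left bracket_scale_right vector_smult_assoc)
      then show ?thesis unfolding Hb[OF ab] by (simp add: vec.linear_neg[OF G_ad_linear[OF g]])
    qed
    then have "g (bracket (root_vector \<alpha>) (Hv \<alpha>)) = (k \<alpha> * (k \<alpha> * k \<beta>)) *s bracket (root_vector \<alpha>) (Hv \<alpha>)"
      unfolding br using k by (simp add: bracket_scale_left bracket_scale_right vector_smult_assoc mult.commute)
    then have "(- 2 * k \<alpha>) *s root_vector \<alpha> = (k \<alpha> * (k \<alpha> * k \<beta>) * (- 2)) *s root_vector \<alpha>"
      unfolding Hact using k
      by (simp add: lin vector_smult_assoc vec.linear_neg[OF G_ad_linear[OF g]])
    then have "- 2 * k \<alpha> = k \<alpha> * (k \<alpha> * k \<beta>) * (- 2)" using scale_inj rv0 by blast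
    then show ?thesis using k[of \<alpha>] by simp
  qed
  define c where "c i = k (sroot 1 i)" for i
  have c: "c i \<noteq> 0" for i using k by (simp add: c_def)
  \<comment> \<open>Induction on the height of the root, with one simple root split off at each
    step.\<close>
  have kpos: "k \<alpha> = torus_char c (root_vec \<alpha>)" if "lat_nonneg (root_vec \<alpha>)" for \<alpha>
    using that
  proof (induction "nat (\<Sum>i\<in>UNIV. root_vec \<alpha> $ i)" arbitrary: \<alpha> rule: less_induct)
    case less
    show ?case
    proof (cases "\<exists>j. root_vec \<alpha> = simple_root j")
      case True
      then obtain j where j: "root_vec \<alpha> = simple_root j" by blast
      then have "root_vec \<alpha> = root_vec (sroot 1 j)" by (simp add: one_scale)
      then have "\<alpha> = sroot 1 j" by (simp only: root_vec_inject)
      then show ?thesis using j by (simp add: c_def)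
    next
      case False
      then obtain j w where w: "is_root w" "lat_nonneg w" "root_vec \<alpha> = simple_root j + w"
        using positive_root_nonsimple[of "root_vec \<alpha>"] less(2) by auto
      have "(\<Sum>i\<in>UNIV. root_vec \<alpha> $ i) = 1 + (\<Sum>i\<in>UNIV. w $ i)"
        by (simp add: w(3) sum.distrib)
      moreover have "0 \<le> (\<Sum>i\<in>UNIV. w $ i)" using w(2) by (intro sum_nonneg) (simp add: lat_nonneg_def)
      ultimately have "k (Root w) = torus_char c w" using less(1)[of "Root w"] w by simp
      moreover have "k \<alpha> = k (sroot 1 j) * k (Root w)" using w by (intro kadd) (simp add: one_scale)
      ultimately show ?thesis using c by (simp add: w(3) torus_char_add c_def)
    qed
  qed
  have kall: "k \<alpha> = torus_char c (root_vec \<alpha>)" for \<alpha>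
  proof (cases "lat_nonneg (root_vec \<alpha>)")
    case False
    then have "lat_nonneg (- root_vec \<alpha>)" using root_sign[of "root_vec \<alpha>"] by simp
    then have "k (Root (- root_vec \<alpha>)) = torus_char c (- root_vec \<alpha>)" using kpos[of "Root (- root_vec \<alpha>)"] by simp
    moreover have "k (Root (- root_vec \<alpha>)) * k \<alpha> = 1" by (rule kneg) simp
    moreover have "torus_char c (- root_vec \<alpha>) * torus_char c (root_vec \<alpha>) = 1"
      using torus_char_add[of c "- root_vec \<alpha>" "root_vec \<alpha>"] c by simp
    ultimately show ?thesis using c torus_char_nonzero by (metis mult_cancel_left)
  qed (rule kpos)
  have "g = torus_elt c"
  proof (rule linear_eqI[OF G_ad_linear[OF g] linear_torus_elt])
    fix b
    show "g (axis b 1) = torus_elt c (axis b 1)"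
    proof (cases b)
      case (H i)
      have "Hv (sroot 1 i) = axis (H i) 1"
      proof -
        have "Hv (sroot 1 i) = (\<Sum>j\<in>UNIV. if j = i then axis (H i) 1 else 0)"
          unfolding Hv_def by (intro sum.cong) (auto simp: one_scale vec_eq_iff)
        then show ?thesis by simp
      qed
      moreover have "g (Hv (sroot 1 i)) = Hv (sroot 1 i)"
      proof -
        have z: "root_vec (sroot 1 i) + root_vec (sroot (- 1) i) = 0" by (simp add: one_scale minus_one_scale)
        have "g (bracket (root_vector (sroot 1 i)) (root_vector (sroot (- 1) i)))
           = (k (sroot 1 i) * k (sroot (- 1) i)) *s bracket (root_vector (sroot 1 i)) (root_vector (sroot (- 1) i))"
          unfolding br using k by (simp add: bracket_scale_left bracket_scale_right vector_smult_assoc)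
        then show ?thesis unfolding Hb[OF z] kneg[OF z] by (simp add: vec.linear_neg[OF G_ad_linear[OF g]])
      qed
      moreover have "torus_elt c (axis (H i) 1) = torus_char c 0 *s axis (H i) 1"
        by (rule torus_elt_weight) (auto simp: axis_def split: if_splits)
      ultimately show ?thesis using H by simp
    next
      case (E \<alpha>)
      then show ?thesis using k[of \<alpha>] torus_elt_root_vector[of c \<alpha>] kall[of \<alpha>] by (simp add: root_vector_def)
    qed
  qed
  then show ?thesis using c by blast
qed

text \<open>The quotient of the two lifts preserves all weight spaces, so it is a torus element and
  disappears in the right Borel factor. This takes the place of the braid relations.\<close>

lemma bruhat_cell_cong:
  assumes "weyl_word is = weyl_word js"
  shows "bruhat_cell (gprod (map s_bar is)) \<subseteq> bruhat_cell (gprod (map s_bar js))"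
proof
  fix p assume "p \<in> bruhat_cell (gprod (map s_bar is))"
  then obtain b b' where b: "p = b \<circ> gprod (map s_bar is) \<circ> b'" "b \<in> B_plus" "b' \<in> B_plus"
    by (auto simp: bruhat_cell_def)
  let ?m = "gprod (map s_bar js)" and ?n = "gprod (map s_bar is)"
  let ?g = "inv\<^bsub>G_ad\<^esub> ?m \<circ> ?n"
  have "weyl_word (rev js) \<circ> weyl_word is = id" by (simp add: assms fun_eq_iff)
  moreover have "shape {0} (weyl_word (rev js) \<circ> weyl_word is) ?g"
    unfolding inv_s_bar_word
    by (intro shape_zero_comp s_dot_word_in_G_ad shape_s_dot_word shape_s_bar_word)
  ultimately have "shape {0} id ?g" by metis
  moreover have "?g \<in> carrier G_ad" by (intro G_ad_comp G_ad_inv s_bar_word_in_G_ad)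
  ultimately obtain c where c: "\<forall>i. c i \<noteq> 0" "?g = torus_elt c" using shape_zero_id_torus by blast
  have "?m \<circ> ?g = ?n"
    by (simp only: comp_assoc[symmetric] G_ad_inv_comp[OF s_bar_word_in_G_ad] id_comp)
  then have "p = b \<circ> ?m \<circ> (torus_elt c \<circ> b')" using b(1) c(2) by (metis comp_assoc)
  moreover have "torus_elt c \<circ> b' \<in> B_plus"
    using c(1) b(3) unfolding B_plus_eq by (intro borel_comp[OF torus_subset_borel[OF torus_elt_in_torus]]) auto
  ultimately show "p \<in> bruhat_cell ?m" using b(2) by (auto simp: bruhat_cell_def)
qed

section \<open>Longest elements and minimal coset representatives\<close>

definition vec6 :: "int \<Rightarrow> int \<Rightarrow> int \<Rightarrow> int \<Rightarrow> int \<Rightarrow> int \<Rightarrow> lattice" where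
  "vec6 a b c d e f = (\<chi> i. case i of N1 \<Rightarrow> a | N2 \<Rightarrow> b | N3 \<Rightarrow> c | N4 \<Rightarrow> d | N5 \<Rightarrow> e | N6 \<Rightarrow> f)"

lemma vec6_nth [simp]:
  "vec6 a b c d e f $ N1 = a" "vec6 a b c d e f $ N2 = b" "vec6 a b c d e f $ N3 = c"
  "vec6 a b c d e f $ N4 = d" "vec6 a b c d e f $ N5 = e" "vec6 a b c d e f $ N6 = f"
  by (simp_all add: vec6_def)

lemma vec6_eqI: 
  "v$N1 = a \<Longrightarrow> v$N2 = b \<Longrightarrow> v$N3 = c \<Longrightarrow> v$N4 = d \<Longrightarrow> v$N5 = e \<Longrightarrow> v$N6 = f \<Longrightarrow> v = vec6 a b c d e f"
  by (simp add: vec_eq_iff all_e6_node)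

lemma vec6_eq_iff: "vec6 a b c d e f = vec6 a' b' c' d' e' f' \<longleftrightarrow>
    a = a' \<and> b = b' \<and> c = c' \<and> d = d' \<and> e = e' \<and> f = f'"
  by (simp add: vec_eq_iff all_e6_node)

lemma simple_root_vec6:
  "simple_root N1 = vec6 1 0 0 0 0 0" "simple_root N2 = vec6 0 1 0 0 0 0" "simple_root N3 = vec6 0 0 1 0 0 0"
  "simple_root N4 = vec6 0 0 0 1 0 0" "simple_root N5 = vec6 0 0 0 0 1 0" "simple_root N6 = vec6 0 0 0 0 0 1"
  by (rule vec6_eqI; simp)+

lemma simple_refl_vec6:
  "simple_refl N1 (vec6 a b c d e f) = vec6 (c - a) b c d e f"
  "simple_refl N2 (vec6 a b c d e f) = vec6 a (d - b) c d e f"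
  "simple_refl N3 (vec6 a b c d e f) = vec6 a b (a + d - c) d e f"
  "simple_refl N4 (vec6 a b c d e f) = vec6 a b c (b + c + e - d) e f"
  "simple_refl N5 (vec6 a b c d e f) = vec6 a b c d (d + f - e) f"
  "simple_refl N6 (vec6 a b c d e f) = vec6 a b c d e (e - f)"
  by (rule vec6_eqI; simp add: simple_refl_nth e6_form_sym[of _ "simple_root _"] e6_form_simple)+

lemma lat_nonneg_vec6:
  "lat_nonneg (vec6 a b c d e f) \<longleftrightarrow> 0 \<le> a \<and> 0 \<le> b \<and> 0 \<le> c \<and> 0 \<le> d \<and> 0 \<le> e \<and> 0 \<le> f"
  by (simp add: lat_nonneg_def all_e6_node)

lemma uminus_vec6: "- vec6 a b c d e f = vec6 (- a) (- b) (- c) (- d) (- e) (- f)"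
  by (rule vec6_eqI) simp_all

lemmas weyl_eval = simple_root_vec6 simple_refl_vec6 lat_nonneg_vec6 uminus_vec6 vec6_eq_iff

lemma lat_nonneg_sum:
  assumes "\<And>i. lat_nonneg (f i)" shows "lat_nonneg (\<Sum>i\<in>UNIV. f i)"
  using assms by (auto simp: lat_nonneg_def sum_component intro: sum_nonneg)

lemma lat_nonneg_scale: "0 \<le> k \<Longrightarrow> lat_nonneg v \<Longrightarrow> lat_nonneg (k *s v)"
  by (simp add: lat_nonneg_def)

lemma weyl_word_lat_nonneg:
  assumes "lat_nonneg v" "\<And>i. v $ i \<noteq> 0 \<Longrightarrow> lat_nonneg (weyl_word is (simple_root i))"
  shows "lat_nonneg (weyl_word is v)"
  unfolding weyl_word_expand[of "is" v]
proof (rule lat_nonneg_sum)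
  fix i show "lat_nonneg (v $ i *s weyl_word is (simple_root i))"
    using assms by (cases "v $ i = 0") (auto simp: lat_nonneg_scale lat_nonneg_def)
qed

lemma weyl_word_not_lat_nonneg:
  assumes "is_root v" "lat_nonneg v" "\<And>i. v $ i \<noteq> 0 \<Longrightarrow> lat_nonneg (- weyl_word is (simple_root i))"
  shows "\<not> lat_nonneg (weyl_word is v)"
proof -
  have "- weyl_word is v = (\<Sum>i\<in>UNIV. v $ i *s - weyl_word is (simple_root i))"
    unfolding weyl_word_expand[of "is" v] by (simp add: vec_eq_iff sum_component sum_negf)
  moreover have "lat_nonneg \<dots>"
  proof (rule lat_nonneg_sum)
    fix i show "lat_nonneg (v $ i *s - weyl_word is (simple_root i))"
    proof (cases "v $ i = 0")
      case False
      then show ?thesis using assms by (intro lat_nonneg_scale) (auto simp: lat_nonneg_def)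
    qed (simp add: lat_nonneg_def)
  qed
  ultimately show ?thesis using root_neg_iff[of "weyl_word is v"] assms(1) by simp
qed

text \<open>With equal inversion sets, the first element times the inverse of the second keeps all
  simple roots positive.\<close>

lemma inversions_inject:
  assumes "inversions (weyl_word is) = inversions (weyl_word js)"
  shows "weyl_word is = weyl_word js"
proof -
  have "lat_nonneg (weyl_word (is @ rev js) (simple_root i))" for i
  proof (cases "lat_nonneg (weyl_word (rev js) (simple_root i))")
    case True
    let ?v = "weyl_word (rev js) (simple_root i)"
    have "?v \<notin> inversions (weyl_word js)" by (simp add: inversions_def)
    then have "?v \<notin> inversions (weyl_word is)" using assms by simp
    then show ?thesis using True by (simp add: inversions_def weyl_word_append)
  next
    case False
    let ?v = "- weyl_word (rev js) (simple_root i)"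
    have v: "is_root ?v" "lat_nonneg ?v" using False root_neg_iff[of "weyl_word (rev js) (simple_root i)"] by simp_all
    have "weyl_word js ?v = - simple_root i" by (simp add: weyl_word_uminus)
    then have "?v \<in> inversions (weyl_word js)" using v by (simp add: inversions_def)
    then have "?v \<in> inversions (weyl_word is)" using assms by simp
    then have "\<not> lat_nonneg (- weyl_word is (weyl_word (rev js) (simple_root i)))"
      by (simp add: inversions_def weyl_word_uminus)
    then show ?thesis
      using root_neg_iff[of "weyl_word is (weyl_word (rev js) (simple_root i))"] by (simp add: weyl_word_append)
  qed
  then have "weyl_word (is @ rev js) = id" by (rule weyl_word_eq_id)
  then have "weyl_word is (weyl_word (rev js) v) = v" for v by (simp add: weyl_word_append fun_eq_iff)
  then have "weyl_word is v = weyl_word js v" for v by (metis weyl_word_rev)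
  then show ?thesis by blast
qed

text \<open>An inversion set containing all others has the largest cardinality, and every element
  attaining it has the same inversions; this yields the uniqueness that \<open>longest_in\<close>
  requires.\<close>

lemma longest_in_parabolic:
  assumes "w \<in> parabolic J" "\<And>v. v \<in> parabolic J \<Longrightarrow> inversions v \<subseteq> inversions w"
  shows "longest_in (parabolic J) = w"
  unfolding longest_in_def
proof (rule the_equality)
  have len: "weyl_length v = card (inversions v)" if "v \<in> parabolic J" for v
    using that weyl_length_eq by (auto simp: parabolic_def)
  show "w \<in> parabolic J \<and> (\<forall>v\<in>parabolic J. weyl_length v \<le> weyl_length w)"
    using assms by (auto simp: len intro!: card_mono)
  fix v assume v: "v \<in> parabolic J \<and> (\<forall>u\<in>parabolic J. weyl_length u \<le> weyl_length v)"
  then have "card (inversions w) \<le> card (inversions v)" using assms(1) len by metis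
  then have "inversions v = inversions w" using assms(2) v by (intro card_seteq) auto
  then show "v = w" using inversions_inject v assms(1) by (auto simp: parabolic_def)
qed

text \<open>The first 20 letters are \<open>word_P\<close> and the other 16 lead from the Levi part
  to the full group. The action on simple roots computed below identifies both words as longest
  elements.\<close>

definition word_0 :: "e6_node list" where
  "word_0 = [N1, N2, N3, N1, N4, N2, N3, N1, N4, N3, N5, N4, N2, N3, N1, N4, N3, N5, N4, N2,
     N6, N5, N4, N2, N3, N1, N4, N3, N5, N4, N2, N6, N5, N4, N3, N1]"

definition word_P :: "e6_node list" where
  "word_P = [N1, N2, N3, N1, N4, N2, N3, N1, N4, N3, N5, N4, N2, N3, N1, N4, N3, N5, N4, N2]"

lemma word_0_simple_root:
  "weyl_word word_0 (simple_root N1) = - simple_root N6" "weyl_word word_0 (simple_root N2) = - simple_root N2"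
  "weyl_word word_0 (simple_root N3) = - simple_root N5" "weyl_word word_0 (simple_root N4) = - simple_root N4"
  "weyl_word word_0 (simple_root N5) = - simple_root N3" "weyl_word word_0 (simple_root N6) = - simple_root N1"
  by (simp_all add: word_0_def weyl_eval)

text \<open>On the Levi part, of type D5, the longest element is minus the exchange of the two spin
  nodes 2 and 5; the remaining simple root goes to the highest root.\<close>

lemma word_P_simple_root:
  "weyl_word word_P (simple_root N1) = - simple_root N1" "weyl_word word_P (simple_root N2) = - simple_root N5"
  "weyl_word word_P (simple_root N3) = - simple_root N3" "weyl_word word_P (simple_root N4) = - simple_root N4"
  "weyl_word word_P (simple_root N5) = - simple_root N2" "weyl_word word_P (simple_root N6) = vec6 1 2 2 3 2 1"
  by (simp_all add: word_P_def weyl_eval)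

lemma w_0_eq: "w_0 = weyl_word word_0"
  unfolding w_0_def weyl_group_def
proof (rule longest_in_parabolic)
  fix v assume "v \<in> parabolic UNIV"
  have "lat_nonneg (- weyl_word word_0 (simple_root i))" for i
    by (cases i) (simp_all add: word_0_simple_root)
  then show "inversions v \<subseteq> inversions (weyl_word word_0)"
    using weyl_word_not_lat_nonneg by (auto simp: inversions_def)
qed (auto simp: parabolic_def)

lemma weyl_word_N6_nth:
  "set is \<subseteq> UNIV - {N6} \<Longrightarrow> weyl_word is v $ N6 = v $ N6"
  by (induction "is") (auto simp: simple_refl_nth)

text \<open>Levi reflections do not change the coordinate at node 6, and its sign decides the sign
  of the root.\<close>

lemma weyl_P_lat_nonneg:
  assumes "set is \<subseteq> UNIV - {N6}" "is_root v" "lat_nonneg v" "v $ N6 \<noteq> 0"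
  shows "lat_nonneg (weyl_word is v)"
proof -
  have "0 < v $ N6" using assms(3,4) by (simp add: lat_nonneg_def order_less_le)
  then have "0 < weyl_word is v $ N6" using weyl_word_N6_nth[OF assms(1)] by simp
  then have "\<not> lat_nonneg (- weyl_word is v)" by (auto simp: lat_nonneg_def not_le)
  then show ?thesis using root_neg_iff[of "weyl_word is v"] assms(2) by simp
qed

lemma word_P_subset: "set word_P \<subseteq> UNIV - {N6}"
  by (simp add: word_P_def)

lemma w_P_eq: "w_P = weyl_word word_P"
  unfolding w_P_def weyl_P_def
proof (rule longest_in_parabolic)
  show "weyl_word word_P \<in> parabolic (UNIV - {N6})"
    using word_P_subset unfolding parabolic_def by blast
  fix v assume "v \<in> parabolic (UNIV - {N6})"
  then obtain vs where vs: "v = weyl_word vs" "set vs \<subseteq> UNIV - {N6}" by (auto simp: parabolic_def)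
  show "inversions v \<subseteq> inversions (weyl_word word_P)"
  proof
    fix x assume x: "x \<in> inversions v"
    then have x6: "x $ N6 = 0" using weyl_P_lat_nonneg[OF vs(2), of x] by (auto simp: inversions_def vs(1))
    have "lat_nonneg (- weyl_word word_P (simple_root i))" if "x $ i \<noteq> 0" for i
      using that x6 by (cases i) (simp_all add: word_P_simple_root)
    then show "x \<in> inversions (weyl_word word_P)"
      using x weyl_word_not_lat_nonneg by (auto simp: inversions_def)
  qed
qed

text \<open>Positivity on the Levi simple roots lets the inversions of \<open>v\<close> inject into
  those of \<open>v \<circ> u\<close>, which gives minimality. A second minimal representative has
  the same positivity, so the Levi element between the two makes no simple root negative and is the
  identity.\<close>

lemma min_rep_eq:
  assumes w: "w = weyl_word ws" and v: "v = weyl_word vs"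
    and vw: "v = w \<circ> weyl_word us" "set us \<subseteq> UNIV - {N6}"
    and pos: "\<And>i. i \<noteq> N6 \<Longrightarrow> lat_nonneg (v (simple_root i))"
  shows "min_rep w = v"
  unfolding min_rep_def
proof (rule the_equality)
  have vpos: "lat_nonneg (v x)" if "lat_nonneg x" "x $ N6 = 0" for x
    unfolding v using that(1)
  proof (rule weyl_word_lat_nonneg)
    fix i assume "x $ i \<noteq> 0"
    then have "i \<noteq> N6" using that(2) by auto
    then show "lat_nonneg (weyl_word vs (simple_root i))" using pos v by simp
  qed
  have "weyl_length v \<le> weyl_length (v \<circ> u)" if u: "u \<in> weyl_P" for u
  proof -
    obtain ks where ks: "u = weyl_word ks" "set ks \<subseteq> UNIV - {N6}"
      using u by (auto simp: weyl_P_def parabolic_def)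
    have rks: "set (rev ks) \<subseteq> UNIV - {N6}" using ks by simp
    have "weyl_word (rev ks) ` inversions v \<subseteq> inversions (v \<circ> u)"
    proof
      fix y assume "y \<in> weyl_word (rev ks) ` inversions v"
      then obtain x where x: "y = weyl_word (rev ks) x" "x \<in> inversions v" by blast
      then have "x $ N6 \<noteq> 0" using vpos[of x] by (auto simp: inversions_def)
      then have "lat_nonneg y" using weyl_P_lat_nonneg[OF rks, of x] x by (auto simp: inversions_def)
      then show "y \<in> inversions (v \<circ> u)" using x by (simp add: inversions_def ks(1))
    qed
    moreover have "inj_on (weyl_word (rev ks)) (inversions v)"
      using bij_weyl_word[of "rev ks"] by (auto simp: bij_def intro: inj_on_subset)
    ultimately have "card (inversions v) \<le> card (inversions (v \<circ> u))"
      by (intro card_inj_on_le[of "weyl_word (rev ks)"]) simp_all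
    moreover have "v \<circ> u = weyl_word (vs @ ks)" by (simp add: v ks weyl_word_append)
    ultimately show ?thesis unfolding v using weyl_length_eq by metis
  qed
  moreover have "v \<in> weyl_group" unfolding v weyl_group_def parabolic_def by blast
  moreover have "weyl_word us \<in> weyl_P" unfolding weyl_P_def parabolic_def using vw(2) by blast
  ultimately show "v \<in> min_coset_reps \<and> v \<in> {w \<circ> u |u. u \<in> weyl_P}"
    using vw(1) unfolding min_coset_reps_def by blast
  fix v' assume v': "v' \<in> min_coset_reps \<and> v' \<in> {w \<circ> u |u. u \<in> weyl_P}"
  then obtain ks where ks: "v' = w \<circ> weyl_word ks" "set ks \<subseteq> UNIV - {N6}"
    by (auto simp: weyl_P_def parabolic_def)
  define u where "u = rev us @ ks"
  have u: "set u \<subseteq> UNIV - {N6}" using vw(2) ks(2) by (simp add: u_def)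
  have "v \<circ> weyl_word u = v'" unfolding vw(1) ks(1) u_def by (simp add: fun_eq_iff weyl_word_append)
  have v'w: "v' = weyl_word (ws @ ks)" by (simp add: ks(1) w weyl_word_append)
  have v'pos: "lat_nonneg (v' (simple_root i))" if "i \<noteq> N6" for i
  proof (rule ccontr)
    assume "\<not> lat_nonneg (v' (simple_root i))"
    then have "card (inversions v') = Suc (card (inversions (v' \<circ> simple_refl i)))"
      by (rule card_inversions_refl_neg[OF v'w])
    moreover have "v' \<circ> simple_refl i = weyl_word (ws @ ks @ [i])" by (simp add: v'w weyl_word_append comp_assoc)
    ultimately have "weyl_length (v' \<circ> simple_refl i) < weyl_length v'"
      unfolding v'w by (metis lessI weyl_length_eq)
    moreover have "simple_refl i \<in> weyl_P"
      unfolding weyl_P_def parabolic_def using that by (intro CollectI exI[of _ "[i]"]) simp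
    ultimately show False using v' by (force simp: min_coset_reps_def)
  qed
  have "lat_nonneg (weyl_word u (simple_root i))" for i
  proof (cases "i = N6")
    case True
    then show ?thesis by (intro weyl_P_lat_nonneg[OF u]) simp_all
  next
    case False
    show ?thesis
    proof (rule ccontr)
      let ?b = "weyl_word u (simple_root i)"
      assume "\<not> lat_nonneg ?b"
      then have "lat_nonneg (- ?b)" using root_neg_iff[of ?b] by simp
      moreover have "(- ?b) $ N6 = 0" using weyl_word_N6_nth[OF u] False by simp
      ultimately have "lat_nonneg (v (- ?b))" by (rule vpos)
      then have "lat_nonneg (- v' (simple_root i))"
        using \<open>v \<circ> weyl_word u = v'\<close> by (auto simp: v weyl_word_uminus fun_eq_iff)
      then show False using v'pos[OF False] root_neg_iff[of "v' (simple_root i)"] by (simp add: v'w)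
    qed
  qed
  then have "weyl_word u = id" by (rule weyl_word_eq_id)
  then show "v' = v" using \<open>v \<circ> weyl_word u = v'\<close> by simp
qed

lemma reduced_expr_positive_word:
  "positive_word (rev is) \<Longrightarrow> reduced_expr is (weyl_word is)"
proof (induction "is" rule: rev_induct)
  case Nil
  show ?case by (simp only: reduced_expr_Nil weyl_word_Nil)
next
  case (snoc i "is")
  have "weyl_word (is @ [i]) \<circ> simple_refl i = weyl_word is"
    by (simp add: weyl_word_append comp_assoc simple_refl_comp_self)
  then show ?case using snoc by (simp add: reduced_expr_snoc)
qed

section \<open>Explicit words for the three coset elements\<close>

definition word_upper_P :: "e6_node list" where
  "word_upper_P = [N1, N3, N4, N2, N5, N6, N4, N5, N3, N4, N2, N1, N3, N4, N5, N6]"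

definition word_double_prime :: "e6_node list" where
  "word_double_prime = [N2, N4, N5, N3, N4, N1, N3, N2, N4, N5, N6]"

lemma word_upper_P_simple_root:
  "weyl_word word_upper_P (simple_root N1) = simple_root N6" "weyl_word word_upper_P (simple_root N2) = simple_root N3"
  "weyl_word word_upper_P (simple_root N3) = simple_root N5" "weyl_word word_upper_P (simple_root N4) = simple_root N4"
  "weyl_word word_upper_P (simple_root N5) = simple_root N2" "weyl_word word_upper_P (simple_root N6) = - vec6 1 2 2 3 2 1"
  by (simp_all add: word_upper_P_def weyl_eval)

lemma word_upper_P_eq: "weyl_word word_upper_P = weyl_word word_0 \<circ> weyl_word word_P"
proof -
  have "weyl_word word_upper_P = weyl_word (word_0 @ word_P)"
  proof (rule weyl_word_eqI)
    fix i show "weyl_word word_upper_P (simple_root i) = weyl_word (word_0 @ word_P) (simple_root i)"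
    proof (cases "i = N6")
      case True
      then show ?thesis unfolding weyl_word_append word_upper_P_simple_root o_apply
        by (simp add: word_upper_P_simple_root word_P_simple_root) (simp add: word_0_def weyl_eval)
    next
      case False
      then show ?thesis
        by (cases i) (simp_all add: weyl_word_append word_upper_P_simple_root word_P_simple_root
            word_0_simple_root weyl_word_uminus)
    qed
  qed
  then show ?thesis by (simp add: weyl_word_append)
qed

lemma w_upper_P_eq: "w_upper_P = weyl_word word_upper_P"
  unfolding w_upper_P_def
proof (rule min_rep_eq[OF w_0_eq refl _ word_P_subset])
  show "weyl_word word_upper_P = w_0 \<circ> weyl_word word_P" by (simp add: w_0_eq word_upper_P_eq)
  show "lat_nonneg (weyl_word word_upper_P (simple_root i))" if "i \<noteq> N6" for i
    using that by (cases i) (simp_all add: word_upper_P_simple_root)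
qed

lemma reduced_word_upper_P: "reduced_expr word_upper_P w_upper_P"
  unfolding w_upper_P_eq
  by (rule reduced_expr_positive_word) (simp add: word_upper_P_def weyl_eval)

lemma w_double_prime_eq: "w_double_prime = weyl_word word_double_prime"
  unfolding w_double_prime_def
\<comment> \<open>The word \<open>us\<close> represents the longest element of the type A4 group on
  nodes 1, 2, 3, 4, whose reflections commute with that of node 6; of the 21 letters of
  \<open>ws\<close> it takes away 10.\<close>
proof (rule min_rep_eq[where ws = "word_P @ [N6]" and us = "[N1, N2, N3, N1, N4, N2, N3, N1, N4, N3]"])
  have "weyl_word word_double_prime = weyl_word (word_P @ [N6] @ [N1, N2, N3, N1, N4, N2, N3, N1, N4, N3])"
  proof (rule weyl_word_eqI)
    fix i show "weyl_word word_double_prime (simple_root i)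
      = weyl_word (word_P @ [N6] @ [N1, N2, N3, N1, N4, N2, N3, N1, N4, N3]) (simple_root i)"
      by (cases i) (simp_all add: word_P_def word_double_prime_def weyl_eval)
  qed
  then show "weyl_word word_double_prime
     = w_P \<circ> simple_refl N6 \<circ> weyl_word [N1, N2, N3, N1, N4, N2, N3, N1, N4, N3]"
    by (simp add: w_P_eq weyl_word_append comp_assoc)
  show "lat_nonneg (weyl_word word_double_prime (simple_root i))" if "i \<noteq> N6" for i
    using that by (cases i) (simp_all add: word_double_prime_def weyl_eval)
qed (simp_all add: w_P_eq weyl_word_append)

lemma w_prime_eq: "w_prime = weyl_word [N1, N3, N4, N5, N6]"
proof -
  have "w_prime = weyl_word (word_upper_P @ rev word_double_prime)"
    by (simp add: w_prime_def w_upper_P_eq w_double_prime_eq inv_weyl_word weyl_word_append)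
  also have "\<dots> = weyl_word [N1, N3, N4, N5, N6]"
  proof (rule weyl_word_eqI)
    fix i show "weyl_word (word_upper_P @ rev word_double_prime) (simple_root i) = weyl_word [N1, N3, N4, N5, N6] (simple_root i)"
      by (cases i) (simp_all add: word_upper_P_def word_double_prime_def weyl_eval)
  qed
  finally show ?thesis .
qed

text \<open>The last letter of a reduced word is a simple root made negative, and here there is only
  one; applied repeatedly, this determines the whole word.\<close>

lemma reduced_expr_unique_last:
  assumes red: "reduced_expr is (weyl_word (ws @ [k]))"
    and neg: "\<not> lat_nonneg (weyl_word (ws @ [k]) (simple_root k))"
    and pos: "\<And>i. i \<noteq> k \<Longrightarrow> lat_nonneg (weyl_word (ws @ [k]) (simple_root i))"
  shows "\<exists>js. is = js @ [k] \<and> reduced_expr js (weyl_word ws)"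
proof (cases "is" rule: rev_cases)
  case Nil
  then have "weyl_word (ws @ [k]) = id" using red by (metis reduced_expr_Nil)
  then show ?thesis using neg by simp
next
  case (snoc js i)
  then have js: "reduced_expr js (weyl_word (ws @ [k]) \<circ> simple_refl i)" "lat_nonneg (weyl_word js (simple_root i))"
    using red reduced_expr_snoc by blast+
  then have "weyl_word js (simple_root i) = - weyl_word (ws @ [k]) (simple_root i)"
    by (simp add: reduced_expr_word weyl_word_uminus)
  then have "\<not> lat_nonneg (weyl_word (ws @ [k]) (simple_root i))"
    using js(2) root_neg_iff[of "weyl_word (ws @ [k]) (simple_root i)"] by simp
  then have "i = k" using pos by blast
  moreover have "weyl_word (ws @ [k]) \<circ> simple_refl k = weyl_word ws"
    by (simp add: weyl_word_append comp_assoc simple_refl_comp_self)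
  ultimately show ?thesis using snoc js by auto
qed

lemma reduced_expr_w_prime: "{is. reduced_expr is w_prime} = {[N1, N3, N4, N5, N6]}"
proof (intro Set.set_eqI iffI)
  fix "is" assume "is \<in> {is. reduced_expr is w_prime}"
  then have "reduced_expr is (weyl_word ([N1, N3, N4, N5] @ [N6]))" by (simp add: w_prime_eq)
  then obtain j5 where 5: "is = j5 @ [N6]" "reduced_expr j5 (weyl_word ([N1, N3, N4] @ [N5]))"
  proof (rule reduced_expr_unique_last[THEN exE])
    show "lat_nonneg (weyl_word ([N1, N3, N4, N5] @ [N6]) (simple_root i))" if "i \<noteq> N6" for i
      using that by (cases i) (simp_all add: weyl_eval)
  qed (auto simp: weyl_eval)
  from 5(2) obtain j4 where 4: "j5 = j4 @ [N5]" "reduced_expr j4 (weyl_word ([N1, N3] @ [N4]))"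
  proof (rule reduced_expr_unique_last[THEN exE])
    show "lat_nonneg (weyl_word ([N1, N3, N4] @ [N5]) (simple_root i))" if "i \<noteq> N5" for i
      using that by (cases i) (simp_all add: weyl_eval)
  qed (auto simp: weyl_eval)
  from 4(2) obtain j3 where 3: "j4 = j3 @ [N4]" "reduced_expr j3 (weyl_word ([N1] @ [N3]))"
  proof (rule reduced_expr_unique_last[THEN exE])
    show "lat_nonneg (weyl_word ([N1, N3] @ [N4]) (simple_root i))" if "i \<noteq> N4" for i
      using that by (cases i) (simp_all add: weyl_eval)
  qed (auto simp: weyl_eval)
  from 3(2) obtain j2 where 2: "j3 = j2 @ [N3]" "reduced_expr j2 (weyl_word ([] @ [N1]))"
  proof (rule reduced_expr_unique_last[THEN exE])
    show "lat_nonneg (weyl_word ([N1] @ [N3]) (simple_root i))" if "i \<noteq> N3" for i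
      using that by (cases i) (simp_all add: weyl_eval)
  qed (auto simp: weyl_eval)
  from 2(2) obtain j1 where 1: "j2 = j1 @ [N1]" "reduced_expr j1 (weyl_word [])"
  proof (rule reduced_expr_unique_last[THEN exE])
    show "lat_nonneg (weyl_word ([] @ [N1]) (simple_root i))" if "i \<noteq> N1" for i
      using that by (cases i) (simp_all add: weyl_eval)
  qed (auto simp: weyl_eval)
  have "j1 = []" using 1(2) by (simp add: reduced_expr_word inversions_def)
  then show "is \<in> {[N1, N3, N4, N5, N6]}" using 1 2 3 4 5 by simp
next
  fix "is" assume "is \<in> {[N1, N3, N4, N5, N6]}"
  moreover have "reduced_expr [N1, N3, N4, N5, N6] (weyl_word [N1, N3, N4, N5, N6])"
    by (rule reduced_expr_positive_word) (simp add: weyl_eval)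
  ultimately show "is \<in> {is. reduced_expr is w_prime}" by (simp add: w_prime_eq)
qed

text \<open>Needed because \<open>w_bar w_P\<close> is built from an unknown reduced word. A final
  letter 6 would produce a positive root with coordinate -1 at node 6.\<close>

lemma reduced_expr_weyl_P:
  assumes "reduced_expr is (weyl_word ws)" "set ws \<subseteq> UNIV - {N6}"
  shows "set is \<subseteq> UNIV - {N6}"
  using assms
proof (induction "is" arbitrary: ws rule: rev_induct)
  case (snoc i "is")
  then have s: "reduced_expr is (weyl_word ws \<circ> simple_refl i)" "lat_nonneg (weyl_word is (simple_root i))"
    using reduced_expr_snoc by blast+
  have "i \<noteq> N6"
  proof
    assume i: "i = N6"
    have "weyl_word is (simple_root i) = - weyl_word ws (simple_root i)"
      using s(1) by (simp add: reduced_expr_word weyl_word_uminus)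
    then have "weyl_word is (simple_root i) $ N6 = - 1" using weyl_word_N6_nth[OF snoc(3)] i by simp
    moreover have "0 \<le> weyl_word is (simple_root i) $ N6" using s(2) by (simp add: lat_nonneg_def)
    ultimately show False by simp
  qed
  moreover have "reduced_expr is (weyl_word (ws @ [i]))" using s(1) by (simp add: weyl_word_append)
  ultimately show ?case using snoc.IH[of "ws @ [i]"] snoc.prems(2) by simp
qed simp

section \<open>The decomposition of the mirror variety\<close>

lemma ex_w_bar:
  assumes "w = weyl_word ws"
  obtains "is" where "reduced_expr is w" "weyl_word is = w" "w_bar w = gprod (map s_bar is)"
proof
  have "w \<in> weyl_group" using assms by (auto simp: weyl_group_def parabolic_def)
  then show "reduced_expr (SOME is. reduced_expr is w) w" by (rule someI_ex[OF ex_reduced_expr])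
  then show "weyl_word (SOME is. reduced_expr is w) = w" by (simp add: reduced_expr_def)
qed (simp add: w_bar_def)

lemma w_bar_in_G_ad: "w = weyl_word ws \<Longrightarrow> w_bar w \<in> carrier G_ad"
  by (metis ex_w_bar s_bar_word_in_G_ad)

lemma shape_w_bar: "w = weyl_word ws \<Longrightarrow> shape {0} w (w_bar w)"
  by (metis ex_w_bar shape_s_bar_word)

lemma shape_inv_w_bar:
  assumes "w = weyl_word ws" shows "shape {0} (weyl_word (rev ws)) (inv\<^bsub>G_ad\<^esub> w_bar w)"
proof -
  obtain "is" where W: "weyl_word is = w" "w_bar w = gprod (map s_bar is)" using ex_w_bar[OF assms] by blast
  have "weyl_word (rev is) v = weyl_word (rev ws) v" for v
    using W(1) assms by (metis weyl_word_rev weyl_word_rev')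
  then have "weyl_word (rev is) = weyl_word (rev ws)" by blast
  then show ?thesis unfolding W(2) inv_s_bar_word by (metis shape_s_dot_word)
qed

lemma shape_conj:
  assumes g: "g \<in> carrier G_ad" "shape {0} (weyl_word ws) g" "shape {0} (weyl_word (rev ws)) (inv\<^bsub>G_ad\<^esub> g)"
    and b: "b \<in> carrier G_ad" "shape C id b" and CD: "\<And>x. x \<in> C \<Longrightarrow> weyl_word ws x \<in> D"
  shows "shape D id (g \<circ> b \<circ> inv\<^bsub>G_ad\<^esub> g)"
proof -
  have "shape C (weyl_word [] \<circ> weyl_word (rev ws)) (b \<circ> inv\<^bsub>G_ad\<^esub> g)"
    by (rule shape_comp[OF G_ad_linear[OF b(1)]]) (use b(2) g(3) in auto)
  then have "shape D (weyl_word ws \<circ> (weyl_word [] \<circ> weyl_word (rev ws))) (g \<circ> (b \<circ> inv\<^bsub>G_ad\<^esub> g))"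
    by (rule shape_comp[OF G_ad_linear[OF g(1)] g(2)]) (use CD in auto)
  moreover have "weyl_word ws \<circ> (weyl_word [] \<circ> weyl_word (rev ws)) = id" by (simp add: fun_eq_iff)
  ultimately show ?thesis by (metis comp_assoc)
qed

lemma shape_comp_cone:
  assumes "g \<in> carrier G_ad" "shape C id g" "shape D id h" "\<And>x y. x \<in> C \<Longrightarrow> y \<in> D \<Longrightarrow> x + y \<in> F"
  shows "shape F id (g \<circ> h)"
  using shape_comp[OF G_ad_linear[OF assms(1)], of C "[]" D id h F] assms by simp

definition cone_pos :: "lattice set" where "cone_pos = {v. lat_nonneg v}"
definition cone_neg :: "lattice set" where "cone_neg = {v. lat_nonneg (- v)}"
text \<open>The weight shifts of the parabolic subgroup that contains \<open>B_plus\<close> and has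
  all nodes but 6 in its Levi subgroup.\<close>

definition cone_6 :: "lattice set" where "cone_6 = {v. 0 \<le> v $ N6}"
text \<open>Contains the image of \<open>cone_pos\<close> under \<open>w_P\<close>: the node 6
  direction stays positive and the Levi directions are reversed. Its negative \<open>cone_P'\<close>
  plays the same role for \<open>w_P\<close> times \<open>w_0\<close>.\<close>

definition cone_P :: "lattice set" where
  "cone_P = {v. 0 < v $ N6 \<or> v $ N6 = 0 \<and> lat_nonneg (- v)}"
definition cone_P' :: "lattice set" where
  "cone_P' = {v. v $ N6 < 0 \<or> v $ N6 = 0 \<and> lat_nonneg v}"

lemma shape_B_plus: "b \<in> B_plus \<Longrightarrow> shape cone_pos id b"
  using shape_unip[of 1 b] by (simp add: B_plus_eq pos_roots_eq cone_pos_def one_scale)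
lemma shape_B_minus: "b \<in> B_minus \<Longrightarrow> shape cone_neg id b"
  using shape_unip[of "- 1" b] by (simp add: B_minus_eq neg_roots_eq cone_neg_def minus_one_scale)

lemma B_plus_in_G_ad: "b \<in> B_plus \<Longrightarrow> b \<in> carrier G_ad"
  by (simp add: B_plus_eq borel_in_G_ad)
lemma B_minus_in_G_ad: "b \<in> B_minus \<Longrightarrow> b \<in> carrier G_ad"
  by (simp add: B_minus_eq borel_in_G_ad)
lemma U_plus_in_G_ad: "b \<in> U_plus \<Longrightarrow> b \<in> carrier G_ad"
  by (simp add: U_plus_eq unip_in_G_ad)
lemma U_minus_in_G_ad: "b \<in> U_minus \<Longrightarrow> b \<in> carrier G_ad"
  by (simp add: U_minus_eq unip_in_G_ad)
lemma U_plus_B_plus: "b \<in> U_plus \<Longrightarrow> b \<in> B_plus"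
  by (simp add: U_plus_eq B_plus_eq unip_subset_borel)
lemma U_minus_B_minus: "b \<in> U_minus \<Longrightarrow> b \<in> B_minus"
  by (simp add: U_minus_eq B_minus_eq unip_subset_borel)
lemma B_plus_inv: "b \<in> B_plus \<Longrightarrow> inv\<^bsub>G_ad\<^esub> b \<in> B_plus"
  by (simp add: B_plus_eq borel_inv)
lemma B_plus_comp: "b \<in> B_plus \<Longrightarrow> c \<in> B_plus \<Longrightarrow> b \<circ> c \<in> B_plus"
  unfolding B_plus_eq by (rule borel_comp)

lemma weyl_word_rev_P: "weyl_word (rev word_P) = weyl_word word_P"
proof (rule weyl_word_eqI)
  fix i show "weyl_word (rev word_P) (simple_root i) = weyl_word word_P (simple_root i)"
    by (cases i) (simp_all add: word_P_def weyl_eval)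
qed
lemma weyl_word_rev_0: "weyl_word (rev word_0) = weyl_word word_0"
proof (rule weyl_word_eqI)
  fix i show "weyl_word (rev word_0) (simple_root i) = weyl_word word_0 (simple_root i)"
    by (cases i) (simp_all add: word_0_def weyl_eval)
qed

lemma weyl_word_P_involution [simp]: "weyl_word word_P (weyl_word word_P v) = v"
  using weyl_word_rev[of word_P v] by (simp add: weyl_word_rev_P)
lemma weyl_word_0_involution [simp]: "weyl_word word_0 (weyl_word word_0 v) = v"
  using weyl_word_rev[of word_0 v] by (simp add: weyl_word_rev_0)

lemma weyl_word_P_apply: 
  "weyl_word word_P v = vec6 (v$N6 - v$N1) (2 * v$N6 - v$N5) (2 * v$N6 - v$N3) (3 * v$N6 - v$N4) (2 * v$N6 - v$N2) (v$N6)"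
  unfolding weyl_word_expand[of word_P v]
  by (rule vec6_eqI) (simp_all add: sum_e6_node word_P_simple_root)

lemma weyl_word_0_apply:
  "weyl_word word_0 v = vec6 (- v$N6) (- v$N2) (- v$N5) (- v$N4) (- v$N3) (- v$N1)"
  unfolding weyl_word_expand[of word_0 v]
  by (rule vec6_eqI) (simp_all add: sum_e6_node word_0_simple_root)

lemma weyl_P_cone: "x \<in> cone_pos \<Longrightarrow> weyl_word word_P x \<in> cone_P"
  by (auto simp: cone_pos_def cone_P_def weyl_word_P_apply uminus_vec6 lat_nonneg_vec6)
    (auto simp: lat_nonneg_def order_less_le)

lemma weyl_P_0_cone: "x \<in> cone_pos \<Longrightarrow> weyl_word (word_P @ word_0) x \<in> cone_P'"
  by (auto simp: cone_pos_def cone_P'_def weyl_word_append weyl_word_P_apply weyl_word_0_apply lat_nonneg_vec6)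
    (auto simp: lat_nonneg_def order_less_le)

lemma weyl_0_cone: "x \<in> cone_pos \<Longrightarrow> weyl_word word_0 x \<in> cone_neg"
  by (simp add: cone_pos_def cone_neg_def weyl_word_0_apply uminus_vec6 lat_nonneg_vec6) (simp add: lat_nonneg_def)

section \<open>Weight shifts of conjugates of the Borel subgroup\<close>

abbreviation (input) "nP \<equiv> w_bar w_P"
abbreviation (input) "n0 \<equiv> w_bar w_0"

lemmas nP_in_G_ad = w_bar_in_G_ad[OF w_P_eq] and n0_in_G_ad = w_bar_in_G_ad[OF w_0_eq]

lemma shape_nP: "shape {0} (weyl_word word_P) nP"
  using shape_w_bar[OF w_P_eq] w_P_eq by metis
lemma shape_n0: "shape {0} (weyl_word word_0) n0"
  using shape_w_bar[OF w_0_eq] w_0_eq by metis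

lemma shape_conj_nP: 
  assumes "b \<in> B_plus" shows "shape cone_P id (nP \<circ> b \<circ> inv\<^bsub>G_ad\<^esub> nP)"
  by (rule shape_conj[OF nP_in_G_ad shape_nP shape_inv_w_bar[OF w_P_eq] B_plus_in_G_ad[OF assms]
        shape_B_plus[OF assms] weyl_P_cone])

lemma shape_conj_inv_nP: 
  assumes "b \<in> B_plus" shows "shape cone_P id (inv\<^bsub>G_ad\<^esub> nP \<circ> b \<circ> nP)"
proof -
  have ii: "inv\<^bsub>G_ad\<^esub> (inv\<^bsub>G_ad\<^esub> nP) = nP"
    using group.inv_inv[OF group_G_ad nP_in_G_ad] .
  have s: "shape {0} (weyl_word word_P) (inv\<^bsub>G_ad\<^esub> nP)"
    using shape_inv_w_bar[OF w_P_eq] by (simp add: weyl_word_rev_P)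
  have s': "shape {0} (weyl_word (rev word_P)) (inv\<^bsub>G_ad\<^esub> (inv\<^bsub>G_ad\<^esub> nP))"
    unfolding ii weyl_word_rev_P by (rule shape_nP)
  show ?thesis
    using shape_conj[OF G_ad_inv[OF nP_in_G_ad] s s' B_plus_in_G_ad[OF assms] shape_B_plus[OF assms] weyl_P_cone]
    unfolding ii .
qed

lemma shape_conj_cell: 
  assumes "b \<in> B_plus" shows "shape cone_P' id ((nP \<circ> n0) \<circ> b \<circ> inv\<^bsub>G_ad\<^esub> (nP \<circ> n0))"
proof (rule shape_conj)
  show "nP \<circ> n0 \<in> carrier G_ad" by (intro G_ad_comp nP_in_G_ad n0_in_G_ad)
  show "shape {0} (weyl_word (word_P @ word_0)) (nP \<circ> n0)"
    unfolding weyl_word_append by (intro shape_zero_comp nP_in_G_ad shape_nP shape_n0)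
  show "shape {0} (weyl_word (rev (word_P @ word_0))) (inv\<^bsub>G_ad\<^esub> (nP \<circ> n0))"
    unfolding G_ad_inv_mult[OF nP_in_G_ad n0_in_G_ad] rev_append weyl_word_append
    by (intro shape_zero_comp G_ad_inv n0_in_G_ad shape_inv_w_bar w_P_eq w_0_eq)
qed (use assms B_plus_in_G_ad shape_B_plus weyl_P_0_cone in auto)

lemma shape_Int: "shape C w g \<Longrightarrow> shape D w g \<Longrightarrow> C \<inter> D \<subseteq> F \<Longrightarrow> shape F w g"
  by (auto simp: shape_def)

lemma unip_eq_id:
  assumes s: "s = 1 \<or> s = - 1" and g: "g \<in> unip (sroots s)" and sh: "shape {0} id g"
  shows "g = id"
proof (rule linear_eq_id[OF G_ad_linear[OF unip_in_G_ad[OF g]]])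
  fix b c
  show "entry g b c = (if b = c then 1 else 0)"
  proof (cases "entry g b c = 0")
    case True
    then show ?thesis using unip_entry_diag[OF s g, of c c] by auto
  next
    case False
    then have "basis_weight b = basis_weight c" using sh by (auto simp: shape_def)
    then show ?thesis by (rule unip_entry_diag[OF s g])
  qed
qed

lemma cone_zero: "cone_pos \<inter> cone_neg \<subseteq> {0}"
  using lat_nonneg_antisym by (auto simp: cone_pos_def cone_neg_def)

text \<open>The quotient of \<open>u'\<close> by \<open>u\<close>, multiplied by Borel elements on
  both sides, becomes a conjugate \<open>m\<close> of a Borel element. Its shifts lie in
  \<open>cone_P'\<close> by conjugation and in \<open>cone_6\<close> by hypothesis, hence are
  nonnegative. So the quotient is both upper and lower triangular, and being unipotent it is the
  identity.\<close>

lemma bruhat_cell_unique: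
  assumes u: "u \<in> U_minus" "u \<in> bruhat_cell (nP \<circ> n0)" and u': "u' \<in> U_minus" "u' \<in> bruhat_cell (nP \<circ> n0)"
    and sh: "shape cone_P id (u' \<circ> inv\<^bsub>G_ad\<^esub> u)"
  shows "u' = u"
proof -
  let ?w = "nP \<circ> n0" and ?n = "u' \<circ> inv\<^bsub>G_ad\<^esub> u"
  have w: "?w \<in> carrier G_ad" by (intro G_ad_comp nP_in_G_ad n0_in_G_ad)
  obtain b1 b2 where b: "u = b1 \<circ> ?w \<circ> b2" "b1 \<in> B_plus" "b2 \<in> B_plus"
    using u(2) unfolding bruhat_cell_def by blast
  obtain c1 c2 where c: "u' = c1 \<circ> ?w \<circ> c2" "c1 \<in> B_plus" "c2 \<in> B_plus"
    using u'(2) unfolding bruhat_cell_def by blast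
  note G = B_plus_in_G_ad[OF b(2)] B_plus_in_G_ad[OF b(3)] B_plus_in_G_ad[OF c(2)] B_plus_in_G_ad[OF c(3)]
    U_minus_in_G_ad[OF u(1)] U_minus_in_G_ad[OF u'(1)]
  define m where "m = inv\<^bsub>G_ad\<^esub> c1 \<circ> ?n \<circ> b1"
  have "?n \<circ> u = u'"
    by (simp only: comp_assoc G_ad_inv_comp[OF G(5)] comp_id)
  then have "?n \<circ> b1 \<circ> ?w \<circ> b2 = c1 \<circ> ?w \<circ> c2" using b(1) c(1) by (metis comp_assoc)
  then have "inv\<^bsub>G_ad\<^esub> c1 \<circ> (?n \<circ> b1 \<circ> ?w \<circ> b2) = inv\<^bsub>G_ad\<^esub> c1 \<circ> (c1 \<circ> ?w \<circ> c2)" by (simp only:)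
  then have "m \<circ> ?w \<circ> b2 = (inv\<^bsub>G_ad\<^esub> c1 \<circ> c1) \<circ> ?w \<circ> c2" by (simp only: m_def comp_assoc)
  then have "m \<circ> ?w \<circ> b2 = ?w \<circ> c2" by (simp only: G_ad_inv_comp[OF G(3)] id_comp)
  then have "m \<circ> ?w \<circ> b2 \<circ> inv\<^bsub>G_ad\<^esub> b2 \<circ> inv\<^bsub>G_ad\<^esub> ?w = ?w \<circ> c2 \<circ> inv\<^bsub>G_ad\<^esub> b2 \<circ> inv\<^bsub>G_ad\<^esub> ?w" by (simp only:)
  moreover have "m \<circ> ?w \<circ> b2 \<circ> inv\<^bsub>G_ad\<^esub> b2 \<circ> inv\<^bsub>G_ad\<^esub> ?w = m \<circ> (?w \<circ> ((b2 \<circ> inv\<^bsub>G_ad\<^esub> b2) \<circ> inv\<^bsub>G_ad\<^esub> ?w))"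
    by (simp only: comp_assoc)
  ultimately have m: "m = ?w \<circ> (c2 \<circ> inv\<^bsub>G_ad\<^esub> b2) \<circ> inv\<^bsub>G_ad\<^esub> ?w"
    unfolding G_ad_inv_comp[OF G(2)] id_comp G_ad_inv_comp[OF w] comp_id by (simp only: comp_assoc)
  have m1: "shape cone_P' id m"
    unfolding m by (intro shape_conj_cell B_plus_comp c B_plus_inv b)
  have add6: "x + y \<in> cone_6" if "x \<in> cone_6" "y \<in> cone_6" for x y using that by (simp add: cone_6_def)
  have sub6: "cone_pos \<subseteq> cone_6" "cone_P \<subseteq> cone_6"
    by (auto simp: cone_pos_def cone_P_def cone_6_def lat_nonneg_def)
  have n6: "shape cone_6 id ?n" using shape_mono[OF sh sub6(2)] .
  have c6: "shape cone_6 id (inv\<^bsub>G_ad\<^esub> c1)" "shape cone_6 id b1"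
    using shape_mono[OF shape_B_plus sub6(1)] B_plus_inv c b by blast+
  have nG: "?n \<in> carrier G_ad" by (intro G_ad_comp G_ad_inv G)
  have "shape cone_6 id m"
    unfolding m_def
    by (intro shape_comp_cone[of _ cone_6 cone_6] G_ad_comp G_ad_inv G nG n6 c6 add6)
  \<comment> \<open>The two conditions force coordinate 0 at node 6, where \<open>cone_P'\<close>
    allows only nonnegative shifts.\<close>
  then have m2: "shape cone_pos id m"
    by (rule shape_Int[OF _ m1]) (auto simp: cone_6_def cone_P'_def cone_pos_def)
  have addp: "x + y \<in> cone_pos" if "x \<in> cone_pos" "y \<in> cone_pos" for x y
    using that lat_nonneg_add by (simp add: cone_pos_def)
  have mG: "m \<in> carrier G_ad" unfolding m_def by (intro G_ad_comp G_ad_inv G nG)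
  have "c1 \<circ> m \<circ> inv\<^bsub>G_ad\<^esub> b1 = (c1 \<circ> inv\<^bsub>G_ad\<^esub> c1) \<circ> ?n \<circ> (b1 \<circ> inv\<^bsub>G_ad\<^esub> b1)"
    unfolding m_def by (simp only: comp_assoc)
  then have neq: "?n = c1 \<circ> m \<circ> inv\<^bsub>G_ad\<^esub> b1"
    by (simp only: G_ad_inv_comp[OF G(1)] G_ad_inv_comp[OF G(3)] id_comp comp_id)
  have "shape cone_pos id ?n"
    unfolding neq
    by (intro shape_comp_cone[of _ cone_pos cone_pos] G_ad_comp G mG m2 shape_B_plus B_plus_inv b c addp)
  moreover have nU: "?n \<in> U_minus" using u(1) u'(1) unfolding U_minus_eq by (intro unip_comp unip_inv)
  then have "shape cone_neg id ?n" by (intro shape_B_minus U_minus_B_minus)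
  ultimately have "shape {0} id ?n" using cone_zero by (rule shape_Int)
  then have "?n = id" using nU unip_eq_id[of "- 1"] by (simp add: U_minus_eq neg_roots_eq)
  then show ?thesis using \<open>?n \<circ> u = u'\<close> by (simp only: id_comp)
qed

lemma U_plus_torus_unique:
  assumes u: "u \<in> U_plus" "u' \<in> U_plus" and t: "t \<in> torus" "t' \<in> torus" and eq: "u \<circ> t = u' \<circ> t'"
  shows "u = u' \<and> t = t'"
proof -
  note G = U_plus_in_G_ad[OF u(1)] U_plus_in_G_ad[OF u(2)] torus_in_G_ad[OF t(1)] torus_in_G_ad[OF t(2)]
  let ?g = "inv\<^bsub>G_ad\<^esub> u' \<circ> u"
  have "inv\<^bsub>G_ad\<^esub> u' \<circ> (u \<circ> t) \<circ> inv\<^bsub>G_ad\<^esub> t = inv\<^bsub>G_ad\<^esub> u' \<circ> (u' \<circ> t') \<circ> inv\<^bsub>G_ad\<^esub> t"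
    unfolding eq ..
  moreover have "inv\<^bsub>G_ad\<^esub> u' \<circ> (u \<circ> t) \<circ> inv\<^bsub>G_ad\<^esub> t = ?g \<circ> (t \<circ> inv\<^bsub>G_ad\<^esub> t)"
    by (simp only: comp_assoc)
  moreover have "inv\<^bsub>G_ad\<^esub> u' \<circ> (u' \<circ> t') \<circ> inv\<^bsub>G_ad\<^esub> t = (inv\<^bsub>G_ad\<^esub> u' \<circ> u') \<circ> (t' \<circ> inv\<^bsub>G_ad\<^esub> t)"
    by (simp only: comp_assoc)
  ultimately have geq: "?g = t' \<circ> inv\<^bsub>G_ad\<^esub> t"
    by (simp only: G_ad_inv_comp[OF G(2)] G_ad_inv_comp[OF G(3)] comp_id id_comp)
  obtain c where c: "t = torus_elt c" "\<And>i. c i \<noteq> 0" using t(1) by (auto simp: torus_def)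
  obtain c' where c': "t' = torus_elt c'" using t(2) by (auto simp: torus_def)
  have "shape {0} id ?g"
    unfolding geq c(1) c' inv_torus_elt[of c, OF c(2)]
    using G(4) c' by (intro shape_comp_cone[of _ "{0}" "{0}"]) (simp_all add: shape_torus_elt)
  moreover have "?g \<in> unip (sroots 1)" using u unfolding U_plus_eq pos_roots_eq by (intro unip_comp unip_inv)
  ultimately have g: "?g = id" using unip_eq_id[of 1] by blast
  have "u' \<circ> ?g = u" by (simp only: comp_assoc[symmetric] G_ad_inv_comp[OF G(2)] id_comp)
  then have uu: "u = u'" unfolding g by (simp only: comp_id)
  have "inv\<^bsub>G_ad\<^esub> u \<circ> (u \<circ> t) = inv\<^bsub>G_ad\<^esub> u \<circ> (u \<circ> t')" using eq uu by (simp only:)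
  then have "t = t'" by (simp only: comp_assoc[symmetric] G_ad_inv_comp[OF G(1)] id_comp)
  then show ?thesis using uu by blast
qed

lemma U_minus_P_eq: "U_minus_P = U_minus \<inter> bruhat_cell (nP \<circ> n0)"
  by (auto simp: U_minus_P_def bruhat_cell_def r_coset_def set_mult_def)

lemma T_P_torus: "t \<in> T_P \<Longrightarrow> t \<in> torus"
  by (simp add: T_P_def)

text \<open>For two decompositions, the quotient of the lower factors is a conjugate by
  \<open>nP\<close> of an element of \<open>B_plus\<close>, so \<open>bruhat_cell_unique\<close>
  identifies the lower factors; what remains is uniqueness in the semidirect product of
  \<open>U_plus\<close> and the torus.\<close>

lemma Z_decomp_eq:
  assumes "up \<in> U_plus" "t \<in> T_P" "um \<in> U_minus_P" "z = up \<circ> t \<circ> nP \<circ> um"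
  shows "Z_decomp z = (up, t, um)"
proof -
  have "(up', t', um') = (up, t, um)"
    if "up' \<in> U_plus" "t' \<in> T_P" "um' \<in> U_minus_P" "z = up' \<circ> t' \<circ> nP \<circ> um'" for up' t' um'
  proof -
    have U: "um \<in> U_minus" "um' \<in> U_minus" "um \<in> bruhat_cell (nP \<circ> n0)" "um' \<in> bruhat_cell (nP \<circ> n0)"
      using assms(3) that(3) by (auto simp: U_minus_P_eq)
    have "t \<in> B_plus" "t' \<in> B_plus"
      using assms(2) that(2) T_P_torus torus_subset_borel unfolding B_plus_eq by blast+
    then have B: "up \<circ> t \<in> B_plus" "up' \<circ> t' \<in> B_plus"
      by (simp_all only: B_plus_comp U_plus_B_plus assms(1) that(1))
    note G = B_plus_in_G_ad[OF B(1)] B_plus_in_G_ad[OF B(2)] U_minus_in_G_ad[OF U(1)] U_minus_in_G_ad[OF U(2)]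
    let ?c = "inv\<^bsub>G_ad\<^esub> (up' \<circ> t') \<circ> (up \<circ> t)"
    have "(up \<circ> t) \<circ> nP \<circ> um = (up' \<circ> t') \<circ> nP \<circ> um'" using assms(4) that(4) by (simp only:)
    then have "inv\<^bsub>G_ad\<^esub> nP \<circ> inv\<^bsub>G_ad\<^esub> (up' \<circ> t') \<circ> ((up \<circ> t) \<circ> nP \<circ> um) \<circ> inv\<^bsub>G_ad\<^esub> um
       = inv\<^bsub>G_ad\<^esub> nP \<circ> inv\<^bsub>G_ad\<^esub> (up' \<circ> t') \<circ> ((up' \<circ> t') \<circ> nP \<circ> um') \<circ> inv\<^bsub>G_ad\<^esub> um" by (simp only:)
    moreover have "inv\<^bsub>G_ad\<^esub> nP \<circ> inv\<^bsub>G_ad\<^esub> (up' \<circ> t') \<circ> ((up \<circ> t) \<circ> nP \<circ> um) \<circ> inv\<^bsub>G_ad\<^esub> um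
       = inv\<^bsub>G_ad\<^esub> nP \<circ> ?c \<circ> nP \<circ> (um \<circ> inv\<^bsub>G_ad\<^esub> um)" by (simp only: comp_assoc)
    moreover have "inv\<^bsub>G_ad\<^esub> nP \<circ> inv\<^bsub>G_ad\<^esub> (up' \<circ> t') \<circ> ((up' \<circ> t') \<circ> nP \<circ> um') \<circ> inv\<^bsub>G_ad\<^esub> um
       = inv\<^bsub>G_ad\<^esub> nP \<circ> ((inv\<^bsub>G_ad\<^esub> (up' \<circ> t') \<circ> (up' \<circ> t')) \<circ> (nP \<circ> (um' \<circ> inv\<^bsub>G_ad\<^esub> um)))"
      by (simp only: comp_assoc)
    moreover have "inv\<^bsub>G_ad\<^esub> nP \<circ> (nP \<circ> (um' \<circ> inv\<^bsub>G_ad\<^esub> um)) = um' \<circ> inv\<^bsub>G_ad\<^esub> um"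
      by (simp only: comp_assoc[symmetric] G_ad_inv_comp[OF nP_in_G_ad] id_comp)
    ultimately have "um' \<circ> inv\<^bsub>G_ad\<^esub> um = inv\<^bsub>G_ad\<^esub> nP \<circ> ?c \<circ> nP"
      by (simp only: G_ad_inv_comp[OF G(2)] G_ad_inv_comp[OF G(3)] comp_id id_comp)
    moreover have "shape cone_P id (inv\<^bsub>G_ad\<^esub> nP \<circ> ?c \<circ> nP)"
      by (intro shape_conj_inv_nP B_plus_comp B_plus_inv B)
    ultimately have um: "um' = um" using bruhat_cell_unique U by metis
    have "(up \<circ> t) \<circ> (nP \<circ> um) = (up' \<circ> t') \<circ> (nP \<circ> um)"
      using assms(4) that(4) um by (simp only: comp_assoc)
    moreover have "bij (nP \<circ> um)" using G_ad_bij G_ad_comp nP_in_G_ad G(3) by blast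
    ultimately have "up \<circ> t = up' \<circ> t'" by (metis bij_def surj_fun_eq)
    then show ?thesis using U_plus_torus_unique[of up up' t t'] assms that T_P_torus um by blast
  qed
  then show ?thesis
    unfolding Z_decomp_def G_ad_mult by (intro the_equality) (use assms in auto)
qed

text \<open>The inverse of \<open>up\<close> is written as \<open>t \<circ> (m \<circ> k)\<close>.
  The factor \<open>m\<close> has shifts in \<open>cone_P\<close>; \<open>k\<close> only lowers, and
  solving for \<open>k\<close> puts it into \<open>cone_6\<close>, so it lowers along the Levi only.
  The inverse of \<open>up\<close> therefore has shifts in \<open>cone_P\<close>, which contains
  \<open>simple_root i\<close> only for node 6.\<close>

lemma unip_char_inv_zero:
  assumes up: "up \<in> U_plus" and t: "t \<in> torus" and um: "um \<in> bruhat_cell (nP \<circ> n0)" and bm: "bm \<in> B_minus"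
    and eq: "up \<circ> t \<circ> nP \<circ> um \<circ> n0 = bm" and i: "i \<noteq> N6"
  shows "unip_char 1 i (inv\<^bsub>G_ad\<^esub> up) = 0"
proof -
  obtain b1 b2 where b: "um = b1 \<circ> (nP \<circ> n0) \<circ> b2" "b1 \<in> B_plus" "b2 \<in> B_plus"
    using um unfolding bruhat_cell_def by blast
  let ?i = "\<lambda>g. inv\<^bsub>G_ad\<^esub> g"
  note G = U_plus_in_G_ad[OF up] torus_in_G_ad[OF t] B_minus_in_G_ad[OF bm] B_plus_in_G_ad[OF b(2)] B_plus_in_G_ad[OF b(3)]
    nP_in_G_ad n0_in_G_ad
  define m where "m = nP \<circ> b1 \<circ> ?i nP"
  \<comment> \<open>The first \<open>nP\<close> cancels the inverse in \<open>m\<close>, the second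
    comes from the cell of \<open>um\<close>. Both \<open>nP \<circ> nP\<close> and the two copies
    of \<open>n0\<close> move weights by squares of involutions, so trivially.\<close>
  define k where "k = (nP \<circ> nP) \<circ> (n0 \<circ> (b2 \<circ> n0)) \<circ> ?i bm"
  have mG: "m \<in> carrier G_ad" and kG: "k \<in> carrier G_ad"
    unfolding m_def k_def by (intro G_ad_comp G_ad_inv G)+
  have "m \<circ> k = nP \<circ> b1 \<circ> ((?i nP \<circ> nP) \<circ> (nP \<circ> n0 \<circ> b2 \<circ> n0 \<circ> ?i bm))"
    unfolding m_def k_def by (simp only: comp_assoc)
  also have "\<dots> = nP \<circ> um \<circ> n0 \<circ> ?i bm"
    unfolding G_ad_inv_comp[OF nP_in_G_ad] id_comp b(1) by (simp only: comp_assoc)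
  finally have "up \<circ> t \<circ> (m \<circ> k) = (up \<circ> t \<circ> nP \<circ> um \<circ> n0) \<circ> ?i bm" by (simp only: comp_assoc)
  then have 1: "up \<circ> (t \<circ> (m \<circ> k)) = id" unfolding eq G_ad_inv_comp[OF G(3)] by (simp only: comp_assoc)
  have up_eq: "?i up = t \<circ> (m \<circ> k)"
  proof -
    have "?i up \<circ> (up \<circ> (t \<circ> (m \<circ> k))) = ?i up" unfolding 1 comp_id ..
    then show ?thesis by (simp only: comp_assoc[symmetric] G_ad_inv_comp[OF G(1)] id_comp)
  qed
  have k_eq: "k = ?i m \<circ> (?i t \<circ> ?i up)"
    unfolding up_eq
    by (simp only: comp_assoc[symmetric] G_ad_inv_comp[OF G(2)] id_comp)
      (simp only: comp_assoc G_ad_inv_comp[OF mG] comp_assoc[symmetric] id_comp)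
  have addn: "x + y \<in> cone_neg" if "x \<in> cone_neg" "y \<in> cone_neg" for x y
    using that lat_nonneg_add[of "- x" "- y"] by (simp add: cone_neg_def)
  have "shape {0} (weyl_word word_P \<circ> weyl_word word_P) (nP \<circ> nP)"
    by (intro shape_zero_comp nP_in_G_ad shape_nP)
  moreover have "weyl_word word_P \<circ> weyl_word word_P = id" by (simp add: fun_eq_iff)
  ultimately have s1: "shape {0} id (nP \<circ> nP)" by metis
  have "shape cone_pos (weyl_word [] \<circ> weyl_word word_0) (b2 \<circ> n0)"
    by (rule shape_comp[OF G_ad_linear[OF G(5)] _ shape_n0]) (use shape_B_plus[OF b(3)] in auto)
  then have "shape cone_neg (weyl_word word_0 \<circ> (weyl_word [] \<circ> weyl_word word_0)) (n0 \<circ> (b2 \<circ> n0))"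
    by (rule shape_comp[OF G_ad_linear[OF G(7)] shape_n0]) (use weyl_0_cone in auto)
  moreover have "weyl_word word_0 \<circ> (weyl_word [] \<circ> weyl_word word_0) = id" by (simp add: fun_eq_iff)
  ultimately have s2: "shape cone_neg id (n0 \<circ> (b2 \<circ> n0))" by metis
  have "?i bm \<in> B_minus" using bm by (simp add: B_minus_eq borel_inv)
  then have s3: "shape cone_neg id (?i bm)" by (rule shape_B_minus)
  have k1: "shape cone_neg id k"
    unfolding k_def
    by (rule shape_comp_cone[OF _ shape_comp_cone[OF _ s1 s2] s3 addn, of cone_neg])
      (auto intro!: G_ad_comp G)
  have "?i m = nP \<circ> ?i b1 \<circ> ?i nP"
    unfolding m_def using G
    by (simp only: G_ad_inv_mult G_ad_comp G_ad_inv group.inv_inv[OF group_G_ad] comp_assoc)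
  then have "shape cone_P id (?i m)" using shape_conj_nP[OF B_plus_inv[OF b(2)]] by (simp only:)
  then have m6: "shape cone_6 id (?i m)" by (rule shape_mono) (auto simp: cone_P_def cone_6_def)
  obtain c where c: "t = torus_elt c" "\<And>i. c i \<noteq> 0" using t by (auto simp: torus_def)
  have t6: "shape cone_6 id (?i t)" unfolding c(1) inv_torus_elt[of c, OF c(2)]
    by (rule shape_torus_elt) (simp add: cone_6_def)
  have u1: "shape cone_pos id (?i up)" by (intro shape_B_plus B_plus_inv U_plus_B_plus up)
  then have u6: "shape cone_6 id (?i up)" by (rule shape_mono) (auto simp: cone_pos_def cone_6_def lat_nonneg_def)
  have add6: "x + y \<in> cone_6" if "x \<in> cone_6" "y \<in> cone_6" for x y using that by (simp add: cone_6_def)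
  have "shape cone_6 id k"
    unfolding k_eq
    by (intro shape_comp_cone[of _ cone_6 cone_6] G_ad_inv mG G t6 m6 u6 add6)
  then have k2: "shape (cone_6 \<inter> cone_neg) id k" using k1 by (rule shape_Int) simp
  have m1: "shape cone_P id m" unfolding m_def by (rule shape_conj_nP[OF b(2)])
  have mk: "shape cone_P id (m \<circ> k)"
  proof (rule shape_comp_cone[OF mG m1 k2])
    fix x y assume xy: "x \<in> cone_P" "y \<in> cone_6 \<inter> cone_neg"
    then have "0 \<le> y $ N6" "lat_nonneg (- y)" by (simp_all add: cone_6_def cone_neg_def)
    then have "y $ N6 = 0" "lat_nonneg (- y)" by (auto simp: lat_nonneg_def intro: antisym)
    then show "x + y \<in> cone_P" using xy(1) lat_nonneg_add[of "- x" "- y"] by (auto simp: cone_P_def)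
  qed
  have u2: "shape cone_P id (?i up)"
    unfolding up_eq c(1)
    by (rule shape_comp_cone[OF torus_elt_in_G_ad[OF c(2)] shape_torus_elt[of "{0}"] mk]) simp_all
  have "entry (?i up) (H i) (E (sroot (- 1) i)) = 0"
  proof (rule ccontr)
    assume "entry (?i up) (H i) (E (sroot (- 1) i)) \<noteq> 0"
    then have "basis_weight (H i) - id (basis_weight (E (sroot (- 1) i))) \<in> cone_P"
      using u2 unfolding shape_def by blast
    moreover have "root_vec (sroot (- 1) i) = - simple_root i" by (simp add: minus_one_scale)
    ultimately have "simple_root i \<in> cone_P" by (simp only: basis_weight.simps id_apply diff_0 minus_minus)
    then show False using i by (auto simp: cone_P_def)
  qed
  then show ?thesis by (simp add: unip_char_def)
qed

section \<open>The quantum term\<close>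

definition unit_fun :: "lattice \<Rightarrow> minuscule_fun" where
  "unit_fun \<gamma> \<delta> = (if \<delta> = \<gamma> then 1 else 0)"

text \<open>The highest weight itself is \<open>\<omega>\<^sub>1\<close>; as an offset from
  \<open>- \<omega>\<^sub>6\<close> it is \<open>\<omega>\<^sub>1 + \<omega>\<^sub>6\<close>, of
  height 16.\<close>

definition highest_weight :: lattice where "highest_weight = vec6 2 2 3 4 3 2"

lemma minuscule_vec6:
  "vec6 a b c d e f \<in> minuscule \<longleftrightarrow>
     a * a + b * b + c * c + d * d + e * e + f * f - a * c - c * d - d * e - e * f - b * d = f"
  by (auto simp: minuscule_def e6_form_self power2_eq_square)

lemma pairing_vec6:
  "pairing (simple_root N1) (vec6 a b c d e f) = 2 * a - c"
  "pairing (simple_root N2) (vec6 a b c d e f) = 2 * b - d"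
  "pairing (simple_root N3) (vec6 a b c d e f) = 2 * c - a - d"
  "pairing (simple_root N4) (vec6 a b c d e f) = 2 * d - c - b - e"
  "pairing (simple_root N5) (vec6 a b c d e f) = 2 * e - d - f"
  "pairing (simple_root N6) (vec6 a b c d e f) = 2 * f - e - 1"
  by (simp_all add: pairing_def e6_form_simple)

lemma eps_vec6:
  "e6_eps (simple_root N1) (vec6 a b c d e f) = (if even (a + c) then 1 else - 1)"
  "e6_eps (simple_root N2) (vec6 a b c d e f) = (if even (b + d) then 1 else - 1)"
  "e6_eps (simple_root N3) (vec6 a b c d e f) = (if even (c + d) then 1 else - 1)"
  "e6_eps (simple_root N4) (vec6 a b c d e f) = (if even (d + e) then 1 else - 1)"
  "e6_eps (simple_root N5) (vec6 a b c d e f) = (if even (e + f) then 1 else - 1)"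
  "e6_eps (simple_root N6) (vec6 a b c d e f) = (if even f then 1 else - 1)"
  by (simp_all add: e6_eps_explicit eps_exponent_def)

lemma add_simple_root_vec6:
  "vec6 a b c d e f + simple_root N1 = vec6 (a + 1) b c d e f"
  "vec6 a b c d e f + simple_root N2 = vec6 a (b + 1) c d e f"
  "vec6 a b c d e f + simple_root N3 = vec6 a b (c + 1) d e f"
  "vec6 a b c d e f + simple_root N4 = vec6 a b c (d + 1) e f"
  "vec6 a b c d e f + simple_root N5 = vec6 a b c d (e + 1) f"
  "vec6 a b c d e f + simple_root N6 = vec6 a b c d e (f + 1)"
  by (rule vec6_eqI; simp)+

lemma diff_simple_root_vec6:
  "vec6 a b c d e f - simple_root N1 = vec6 (a - 1) b c d e f"
  "vec6 a b c d e f - simple_root N2 = vec6 a (b - 1) c d e f"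
  "vec6 a b c d e f - simple_root N3 = vec6 a b (c - 1) d e f"
  "vec6 a b c d e f - simple_root N4 = vec6 a b c (d - 1) e f"
  "vec6 a b c d e f - simple_root N5 = vec6 a b c d (e - 1) f"
  "vec6 a b c d e f - simple_root N6 = vec6 a b c d e (f - 1)"
  by (rule vec6_eqI; simp)+

lemma zero_vec6: "0 = vec6 0 0 0 0 0 0"
  by (rule vec6_eqI) simp_all

lemma highest_weight_minuscule: "highest_weight \<in> minuscule"
  by (simp add: highest_weight_def minuscule_vec6)

subsection \<open>Products of lowering elements\<close>

fun rep_lower :: "(e6_node \<times> complex) list \<Rightarrow> minuscule_fun \<Rightarrow> minuscule_fun" where
  "rep_lower [] = id"
| "rep_lower ((i, a) # ps) = rep_elt (- simple_root i) (- a) \<circ> rep_lower ps"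

lemma lift_y_word: "lift (gprod (map (\<lambda>(i, a). y_sub i a) ps)) (rep_lower ps)"
proof (induction ps rule: rep_lower.induct)
  case 1
  show ?case by (simp only: list.map gprod_Nil rep_lower.simps lift_id)
next
  case (2 i a ps)
  have "lift (y_sub i a) (rep_elt (- simple_root i) (- a))"
    using lift_root_elt[of "sroot (- 1) i" "- a"] by (simp add: y_sub_sroot minus_one_scale)
  from lift_comp[OF this 2] show ?case by (simp only: list.map prod.case gprod_Cons rep_lower.simps)
qed

lemma rep_lower_Cons:
  assumes "\<gamma> \<in> minuscule"
  shows "rep_lower ((i, a) # ps) \<psi> \<gamma> = rep_lower ps \<psi> \<gamma> +
    (if pairing (simple_root i) \<gamma> = - 1 then a * e6_eps (simple_root i) \<gamma> * rep_lower ps \<psi> (\<gamma> + simple_root i) else 0)"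
  using rep_elt_apply[of "- simple_root i" \<gamma> "- a"] assms by auto

text \<open>Each factor lowers the height by at most 1, starting from 16.\<close>

lemma rep_lower_height:
  assumes "(\<Sum>i\<in>UNIV. \<gamma> $ i) + int (length ps) < 16"
  shows "rep_lower ps (unit_fun highest_weight) \<gamma> = 0"
  using assms
proof (induction ps arbitrary: \<gamma> rule: rep_lower.induct)
  case 1
  then have "\<gamma> \<noteq> highest_weight" by (auto simp: highest_weight_def sum_e6_node)
  then show ?case by (simp add: unit_fun_def)
next
  case (2 i a ps)
  show ?case
  proof (cases "\<gamma> \<in> minuscule")
    case True
    have "(\<Sum>j\<in>UNIV. (\<gamma> + simple_root i) $ j) = (\<Sum>j\<in>UNIV. \<gamma> $ j) + 1" by (simp add: sum.distrib)
    then show ?thesis using 2 by (simp add: rep_lower_Cons[OF True] del: rep_lower.simps)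
  next
    case False
    then show ?thesis using 2 by (simp add: rep_elt_supp)
  qed
qed

primrec lowered_weight :: "e6_node list \<Rightarrow> lattice" where
  "lowered_weight [] = highest_weight"
| "lowered_weight (i # is) = lowered_weight is - simple_root i"

primrec lowerable :: "e6_node list \<Rightarrow> bool" where
  "lowerable [] \<longleftrightarrow> True"
| "lowerable (i # is) \<longleftrightarrow> pairing (simple_root i) (lowered_weight is) = 1 \<and> lowerable is"

primrec lowering_sign :: "e6_node list \<Rightarrow> complex" where
  "lowering_sign [] = 1"
| "lowering_sign (i # is) = - e6_eps (simple_root i) (lowered_weight is) * lowering_sign is"

text \<open>At a depth equal to the number of factors only the term using all of them survives;
  every other contribution vanishes by \<open>rep_lower_height\<close>.\<close>

lemma rep_lower_leading:
  assumes "lowerable (map fst ps)"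
  shows "lowered_weight (map fst ps) \<in> minuscule \<and>
    (\<Sum>i\<in>UNIV. lowered_weight (map fst ps) $ i) = 16 - int (length ps) \<and>
    rep_lower ps (unit_fun highest_weight) (lowered_weight (map fst ps))
      = lowering_sign (map fst ps) * prod_list (map snd ps)"
  using assms
proof (induction ps rule: rep_lower.induct)
  case 1
  then show ?case by (simp add: highest_weight_minuscule unit_fun_def) (simp add: highest_weight_def sum_e6_node)
next
  case (2 i a ps)
  let ?g = "lowered_weight (map fst ps)"
  have g: "?g \<in> minuscule" "(\<Sum>i\<in>UNIV. ?g $ i) = 16 - int (length ps)" "pairing (simple_root i) ?g = 1"
    and v: "rep_lower ps (unit_fun highest_weight) ?g = lowering_sign (map fst ps) * prod_list (map snd ps)"
    using 2 by simp_all
  have m: "?g - simple_root i \<in> minuscule" using minuscule_diff_iff[of "simple_root i" ?g] g by simp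
  have s: "(\<Sum>j\<in>UNIV. (?g - simple_root i) $ j) = 16 - int (length ((i, a) # ps))"
    using g(2) by (simp add: sum_subtractf)
  have z: "rep_lower ps (unit_fun highest_weight) (?g - simple_root i) = 0"
    by (rule rep_lower_height) (use g(2) in \<open>simp add: sum_subtractf\<close>)
  have "pairing (simple_root i) (?g - simple_root i) = - 1"
    using g(3) e6_form_simple_root[of i] by (simp add: pairing_diff_right)
  moreover have "e6_eps (simple_root i) (?g - simple_root i) = - e6_eps (simple_root i) ?g"
    by (simp add: e6_eps_diff_right e6_eps_self)
  ultimately have "rep_lower ((i, a) # ps) (unit_fun highest_weight) (?g - simple_root i)
     = lowering_sign (map fst ((i, a) # ps)) * prod_list (map snd ((i, a) # ps))"
    using z v by (simp add: rep_lower_Cons[OF m] del: rep_lower.simps)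
  then show ?case using m s by simp
qed

text \<open>The weights above the highest root \<open>\<theta> = (1, 2, 2, 3, 2, 1)\<close> form a chain in which every step
  lowers by one of the roots 1, 3, 4, 5, 6, in this order.\<close>

lemma rep_lower_chain:
  "rep_lower ((i, a) # ps) \<psi> (vec6 2 2 3 4 3 2) = rep_lower ps \<psi> (vec6 2 2 3 4 3 2)"
  "rep_lower ((i, a) # ps) \<psi> (vec6 1 2 3 4 3 2) = rep_lower ps \<psi> (vec6 1 2 3 4 3 2)
     + (if i = N1 then a * rep_lower ps \<psi> (vec6 2 2 3 4 3 2) else 0)"
  "rep_lower ((i, a) # ps) \<psi> (vec6 1 2 2 4 3 2) = rep_lower ps \<psi> (vec6 1 2 2 4 3 2)
     + (if i = N3 then a * rep_lower ps \<psi> (vec6 1 2 3 4 3 2) else 0)"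
  "rep_lower ((i, a) # ps) \<psi> (vec6 1 2 2 3 3 2) = rep_lower ps \<psi> (vec6 1 2 2 3 3 2)
     + (if i = N4 then a * rep_lower ps \<psi> (vec6 1 2 2 4 3 2) else 0)"
  "rep_lower ((i, a) # ps) \<psi> (vec6 1 2 2 3 2 2) = rep_lower ps \<psi> (vec6 1 2 2 3 2 2)
     + (if i = N5 then a * rep_lower ps \<psi> (vec6 1 2 2 3 3 2) else 0)"
  "rep_lower ((i, a) # ps) \<psi> (vec6 1 2 2 3 2 1) = rep_lower ps \<psi> (vec6 1 2 2 3 2 1)
     + (if i = N6 then - a * rep_lower ps \<psi> (vec6 1 2 2 3 2 2) else 0)"
  by (subst rep_lower_Cons, simp add: minuscule_vec6,
      cases i; simp add: pairing_vec6 eps_vec6 add_simple_root_vec6 del: rep_lower.simps)+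

text \<open>The factor with \<open>a 16\<close> stands leftmost, so \<open>a 1\<close> acts first on
  the highest weight vector. Parameters are counted from 1, list positions from 0.\<close>

definition cayley_word :: "(nat \<Rightarrow> complex) \<Rightarrow> (e6_node \<times> complex) list" where
  "cayley_word a = map (\<lambda>k. (word_upper_P ! (k - 1), a k)) (rev [1..<17])"

lemma cayley_word_explicit:
  "cayley_word a = [(N6, a 16), (N5, a 15), (N4, a 14), (N3, a 13), (N1, a 12), (N2, a 11), (N4, a 10),
     (N3, a 9), (N5, a 8), (N4, a 7), (N6, a 6), (N5, a 5), (N2, a 4), (N4, a 3), (N3, a 2), (N1, a 1)]"
proof -
  have "rev [1..<17] = [16, 15, 14, 13, 12, 11, 10, 9, 8, 7, 6, 5, 4, 3, 2, 1 :: nat]"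
    by (simp add: upt_rec)
  then show ?thesis by (simp add: cayley_word_def word_upper_P_def)
qed

lemma map_fst_cayley_word: "map fst (cayley_word a) = rev word_upper_P"
  by (simp add: cayley_word_explicit word_upper_P_def)

lemma prod_cayley_word: "prod_list (map snd (cayley_word a)) = (\<Prod>i=1..16. a i)"
proof -
  have "(\<Prod>i=1..16. a i) = (\<Prod>i\<in>set (rev [1..<17]). a i)" by (intro prod.cong) auto
  also have "\<dots> = prod_list (map a (rev [1..<17]))" by (rule prod.distinct_set_conv_list) simp
  also have "map a (rev [1..<17]) = map snd (cayley_word a)" by (simp add: cayley_word_def)
  finally show ?thesis by simp
qed

lemma sum_cayley_word: "sum_list (map snd (cayley_word a)) = (\<Sum>i=1..16. a i)"
proof -
  have "(\<Sum>i=1..16. a i) = (\<Sum>i\<in>set (rev [1..<17]). a i)" by (intro sum.cong) auto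
  also have "\<dots> = sum_list (map a (rev [1..<17]))" by (rule sum.distinct_set_conv_list) simp
  also have "map a (rev [1..<17]) = map snd (cayley_word a)" by (simp add: cayley_word_def)
  finally show ?thesis by simp
qed

lemma rep_lower_cayley_lowest:
  "rep_lower (cayley_word a) (unit_fun highest_weight) 0 = - (\<Prod>i=1..16. a i)"
proof -
  have "lowerable (rev word_upper_P)" "lowered_weight (rev word_upper_P) = 0" "lowering_sign (rev word_upper_P) = - 1"
    by (simp_all add: word_upper_P_def highest_weight_def diff_simple_root_vec6 pairing_vec6 eps_vec6 zero_vec6)
  then show ?thesis
    using rep_lower_leading[of "cayley_word a"] by (simp add: map_fst_cayley_word prod_cayley_word)
qed

text \<open>The chain leaves one order for the five lowering steps, and the choices of positions in
  the word are the twelve monomials. The sign comes from the last step and will cancel the one of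
  \<open>rep_lower_cayley_lowest\<close>.\<close>

lemma rep_lower_cayley_theta:
  "rep_lower (cayley_word a) (unit_fun highest_weight) (vec6 1 2 2 3 2 1) = - cayley_poly a"
proof -
  have nil: "rep_lower [] (unit_fun highest_weight) (vec6 b c d e f g)
     = (if b = 2 \<and> c = 2 \<and> d = 3 \<and> e = 4 \<and> f = 3 \<and> g = 2 then 1 else 0)" for b c d e f g
    by (simp add: unit_fun_def highest_weight_def vec6_eq_iff)
  show ?thesis
    unfolding cayley_word_explicit
    by (simp add: rep_lower_chain nil del: rep_lower.simps) (simp add: cayley_poly_def algebra_simps)
qed

subsection \<open>Lifts of \<open>w\<^sub>P\<close> and \<open>w\<^sub>0\<close>\<close>

primrec rep_word :: "e6_node list \<Rightarrow> minuscule_fun \<Rightarrow> minuscule_fun" where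
  "rep_word [] = id"
| "rep_word (i # is) = rep_refl (simple_root i) 1 \<circ> rep_word is"

lemma rep_word_append: "rep_word (is @ js) = rep_word is \<circ> rep_word js"
  by (induction "is") (simp_all only: append.simps rep_word.simps id_comp comp_assoc)

lemma lift_rep_word: "lift (gprod (map s_bar is)) (rep_word is)"
proof (induction "is")
  case Nil
  show ?case by (simp only: list.map gprod_Nil rep_word.simps lift_id)
next
  case (Cons i "is")
  from lift_comp[OF lift_refl_elt this] show ?case
    by (simp only: list.map gprod_Cons rep_word.simps s_bar_eq)
qed

text \<open>The lowest weight pairs to 0 with all Levi simple roots.\<close>

lemma rep_word_lowest:
  "set is \<subseteq> UNIV - {N6} \<Longrightarrow> rep_word is \<psi> 0 = \<psi> 0"
  by (induction "is") (auto simp: rep_refl_apply pairing_def)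

text \<open>The nilradical of \<open>P\<close> is minuscule for its Levi subgroup, so it has a basis
  \<open>spin_sign \<beta> *s root_vector \<beta>\<close> on which the lowering operators act without signs.\<close>

definition nilradical_weights :: "lattice set" where
  "nilradical_weights = {vec6 0 0 0 0 0 1, vec6 0 0 0 0 1 1, vec6 0 0 0 1 1 1, vec6 0 0 1 1 1 1,
     vec6 0 1 0 1 1 1, vec6 0 1 1 1 1 1, vec6 1 0 1 1 1 1, vec6 0 1 1 2 1 1, vec6 1 1 1 1 1 1,
     vec6 0 1 1 2 2 1, vec6 1 1 1 2 1 1, vec6 1 1 1 2 2 1, vec6 1 1 2 2 1 1, vec6 1 1 2 2 2 1,
     vec6 1 1 2 3 2 1, vec6 1 2 2 3 2 1}"

text \<open>An explicit solution of the sign recursion in \<open>nilradical_weights_step\<close>,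
  equal to 1 at \<open>simple_root N6\<close> and again at the highest root.\<close>

definition spin_sign :: "lattice \<Rightarrow> complex" where
  "spin_sign v = (if even (v$N1 + v$N3 + min 1 (v$N2) + min 1 (v$N4) + min 1 (v$N5)) then 1 else - 1)"

lemma spin_sign_vec6:
  "spin_sign (vec6 a b c d e f) = (if even (a + c + min 1 b + min 1 d + min 1 e) then 1 else - 1)"
  by (simp add: spin_sign_def)

lemma nilradical_weights_step:
  assumes "\<beta> \<in> nilradical_weights" "i \<noteq> N6" "pairing (simple_root i) \<beta> = - 1"
  shows "\<beta> + simple_root i \<in> nilradical_weights
    \<and> spin_sign (\<beta> + simple_root i) = e6_eps (simple_root i) \<beta> * spin_sign \<beta>"
proof -
  have "\<forall>\<beta>\<in>nilradical_weights. \<forall>i\<in>{N1, N2, N3, N4, N5}. pairing (simple_root i) \<beta> = - 1 \<longrightarrow>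
      \<beta> + simple_root i \<in> nilradical_weights \<and>
      spin_sign (\<beta> + simple_root i) = e6_eps (simple_root i) \<beta> * spin_sign \<beta>"
    by (simp add: nilradical_weights_def pairing_vec6 add_simple_root_vec6 vec6_eq_iff spin_sign_vec6 eps_vec6)
  moreover have "i \<in> {N1, N2, N3, N4, N5}" using assms(2) by (cases i) simp_all
  ultimately show ?thesis using assms(1,3) by blast
qed

lemma nilradical_weights_minuscule: "\<beta> \<in> nilradical_weights \<Longrightarrow> \<beta> \<in> minuscule"
  by (auto simp: nilradical_weights_def minuscule_vec6)

text \<open>Along a reduced Levi word the weight starting at \<open>simple_root N6\<close> is fixed
  or raised at each reflection and never lowered, so the only signs that occur are those absorbed by
  \<open>spin_sign\<close>.\<close>

lemma rep_word_nilradical: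
  assumes "reduced_expr is (weyl_word is)" "set is \<subseteq> UNIV - {N6}"
  shows "weyl_word (rev is) (simple_root N6) \<in> nilradical_weights \<and>
    rep_word is \<psi> (simple_root N6)
      = spin_sign (weyl_word (rev is) (simple_root N6)) * \<psi> (weyl_word (rev is) (simple_root N6))"
  using assms
proof (induction "is" arbitrary: \<psi> rule: rev_induct)
  case Nil
  show ?case by (simp add: simple_root_vec6 nilradical_weights_def spin_sign_def)
next
  case (snoc i "is")
  let ?b = "weyl_word (rev is) (simple_root N6)" and ?r = "weyl_word is (simple_root i)"
  have red: "reduced_expr is (weyl_word (is @ [i]) \<circ> simple_refl i)" "lat_nonneg ?r"
    using snoc.prems(1) reduced_expr_snoc by blast+
  have "weyl_word (is @ [i]) \<circ> simple_refl i = weyl_word is"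
    by (simp add: weyl_word_append comp_assoc simple_refl_comp_self)
  then have IH: "?b \<in> nilradical_weights"
    "\<And>\<psi>. rep_word is \<psi> (simple_root N6) = spin_sign ?b * \<psi> ?b"
    using snoc.IH red(1) snoc.prems(2) by simp_all
  have i: "i \<noteq> N6" using snoc.prems(2) by simp
  have b: "?b \<in> minuscule" using IH(1) by (rule nilradical_weights_minuscule)
  have "?r $ N6 = 0" using weyl_word_N6_nth[of "is" "simple_root i"] snoc.prems(2) i by simp
  \<comment> \<open>Positive roots of the Levi have nonpositive product with
    \<open>simple_root N6\<close>; transported by the inverse word, this product is the pairing of
    the next reflection with the current weight.\<close>
  then have "e6_form (simple_root N6) ?r \<le> 0" using red(2) by (simp add: e6_form_simple lat_nonneg_def)
  also have "e6_form (simple_root N6) ?r = e6_form ?b (weyl_word (rev is) ?r)" by (simp only: e6_form_weyl_word)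
  also have "\<dots> = pairing (simple_root i) ?b"
    using i by (simp add: pairing_def e6_form_sym)
  finally consider "pairing (simple_root i) ?b = 0" | "pairing (simple_root i) ?b = - 1"
    using pairing_bounds[of "simple_root i" ?b] b by force
  then have "simple_refl i ?b \<in> nilradical_weights \<and>
    rep_refl (simple_root i) 1 \<psi> ?b * spin_sign ?b = spin_sign (simple_refl i ?b) * \<psi> (simple_refl i ?b)"
  proof cases
    case 1
    then have "simple_refl i ?b = ?b" using i e6_form_sym[of ?b "simple_root i"]
      by (simp add: simple_refl_def pairing_def)
    then show ?thesis using 1 IH(1) b by (simp add: rep_refl_apply)
  next
    case 2
    then have "e6_form ?b (simple_root i) = - 1" using i e6_form_sym[of ?b "simple_root i"]
      by (simp add: pairing_def)
    then have "simple_refl i ?b = ?b + simple_root i"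
      by (simp add: simple_refl_def vec_eq_iff)
    then show ?thesis using 2 nilradical_weights_step[OF IH(1) i 2] b by (simp add: rep_refl_apply)
  qed
  then show ?case by (simp add: rep_word_append IH(2) mult.commute)
qed

lemma rep_word_P_theta:
  assumes "reduced_expr is w_P"
  shows "rep_word is \<psi> (simple_root N6) = \<psi> (vec6 1 2 2 3 2 1)"
proof -
  have w: "weyl_word is = weyl_word word_P" using assms by (simp add: reduced_expr_def w_P_eq)
  have s: "set is \<subseteq> UNIV - {N6}"
    using reduced_expr_weyl_P[of "is" word_P] assms word_P_subset by (simp add: w_P_eq)
  have "weyl_word (rev is) (simple_root N6) = weyl_word (rev word_P) (simple_root N6)"
    using w by (metis weyl_word_rev weyl_word_rev')
  then have "weyl_word (rev is) (simple_root N6) = vec6 1 2 2 3 2 1"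
    by (simp add: weyl_word_rev_P word_P_simple_root)
  then show ?thesis
    using rep_word_nilradical[of "is" \<psi>] assms s w by (simp add: w_P_eq spin_sign_def)
qed

section \<open>Weight vectors under lifted Weyl group elements\<close>

lemma rep_refl_unit:
  assumes v: "is_root v" and \<gamma>: "\<gamma> \<in> minuscule"
  shows "\<exists>c. c \<noteq> 0 \<and> \<gamma> - pairing v \<gamma> *s v \<in> minuscule \<and>
     rep_refl v 1 (unit_fun \<gamma>) = (\<lambda>\<delta>. c * unit_fun (\<gamma> - pairing v \<gamma> *s v) \<delta>)"
proof -
  let ?g = "\<gamma> - pairing v \<gamma> *s v"
  have vv: "e6_form v v = 2" using v by (simp add: is_root_def)
  have "pairing v \<gamma> = 0 \<or> pairing v \<gamma> = - 1 \<or> pairing v \<gamma> = 1"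
    using pairing_bounds[OF v \<gamma>] by linarith
  then consider (0) "pairing v \<gamma> = 0" | (m) "pairing v \<gamma> = - 1" | (p) "pairing v \<gamma> = 1" by blast
  note cas = this
  then have g: "?g \<in> minuscule"
    using minuscule_add_iff[OF v \<gamma>] minuscule_diff_iff[OF v \<gamma>] \<gamma>
    by cases (simp_all add: vec_eq_iff one_scale minus_one_scale)
  have pg: "pairing v ?g = - pairing v \<gamma>" using vv by (simp add: pairing_diff_right)
  define c where "c = (if pairing v \<gamma> = 0 then 1 else e6_eps v ?g)"
  have "rep_refl v 1 (unit_fun \<gamma>) \<delta> = c * unit_fun ?g \<delta>" for \<delta>
  proof (cases "\<delta> \<in> minuscule")
    case False
    then have "\<delta> \<noteq> \<gamma>" "\<delta> \<noteq> ?g" using \<gamma> g by blast+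
    then show ?thesis using False by (simp add: rep_refl_off unit_fun_def)
  next
    case True
    have ap: "rep_refl v 1 (unit_fun \<gamma>) \<delta> = (if pairing v \<delta> = 0 then unit_fun \<gamma> \<delta>
       else if pairing v \<delta> = 1 then e6_eps v \<delta> * unit_fun \<gamma> (\<delta> - v) else e6_eps v \<delta> * unit_fun \<gamma> (\<delta> + v))"
      using rep_refl_apply[OF v True, of 1] by simp
    have d: "pairing v \<delta> = 0 \<or> pairing v \<delta> = 1 \<or> pairing v \<delta> = - 1"
      using pairing_bounds[OF v True] by linarith
    have e1: "\<delta> - v = \<gamma> \<longleftrightarrow> \<delta> = \<gamma> + v" and e2: "\<delta> + v = \<gamma> \<longleftrightarrow> \<delta> = \<gamma> - v"
      by (auto simp: algebra_simps)
    from cas show ?thesis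
    proof cases
      case 0
      then have "?g = \<gamma>" by (simp add: vec_eq_iff)
      moreover have "\<delta> - v \<noteq> \<gamma>" if "pairing v \<delta> = 1" using that 0 vv by (auto simp: e1 pairing_add_right)
      moreover have "\<delta> + v \<noteq> \<gamma>" if "pairing v \<delta> = - 1" using that 0 vv by (auto simp: e2 pairing_diff_right)
      ultimately show ?thesis using 0 d unfolding ap c_def unit_fun_def by auto
    next
      case m
      then have g': "?g = \<gamma> + v" by (simp add: vec_eq_iff)
      have "pairing v (\<gamma> + v) = 1" using m vv by (simp add: pairing_add_right)
      moreover have "\<delta> \<noteq> \<gamma>" if "pairing v \<delta> = 0" using that m by auto
      moreover have "\<delta> + v \<noteq> \<gamma>" if "pairing v \<delta> = - 1" using that m vv by (auto simp: e2 pairing_diff_right)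
      ultimately show ?thesis using m d unfolding ap c_def unit_fun_def g' e1 by auto
    next
      case p
      then have g': "?g = \<gamma> - v" by (simp add: vec_eq_iff)
      have "pairing v (\<gamma> - v) = - 1" using p vv by (simp add: pairing_diff_right)
      moreover have "\<delta> \<noteq> \<gamma>" if "pairing v \<delta> = 0" using that p by auto
      moreover have "\<delta> - v \<noteq> \<gamma>" if "pairing v \<delta> = 1" using that p vv by (auto simp: e1 pairing_add_right)
      ultimately show ?thesis using p d unfolding ap c_def unit_fun_def g' e2 by auto
    qed
  qed
  moreover have "c \<noteq> 0" by (simp add: c_def)
  ultimately show ?thesis using g by blast
qed

text \<open>Since \<open>vec6 2 3 4 6 5 4\<close> is \<open>3 \<omega>\<^sub>6\<close>, tripling
  turns the true weights into root lattice vectors, on which the Weyl group acts linearly.\<close>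

lemma rep_word_unit:
  assumes "\<gamma> \<in> minuscule"
  shows "\<exists>c \<delta>. c \<noteq> 0 \<and> \<delta> \<in> minuscule \<and> rep_word is (unit_fun \<gamma>) = (\<lambda>\<epsilon>. c * unit_fun \<delta> \<epsilon>) \<and>
     3 *s \<delta> - vec6 2 3 4 6 5 4 = weyl_word is (3 *s \<gamma> - vec6 2 3 4 6 5 4)"
proof (induction "is")
  case Nil
  have "rep_word [] (unit_fun \<gamma>) = (\<lambda>\<epsilon>. 1 * unit_fun \<gamma> \<epsilon>)" by simp
  then show ?case using assms by (metis id_apply one_neq_zero weyl_word_Nil)
next
  case (Cons i "is")
  then obtain c \<delta> where IH: "c \<noteq> 0" "\<delta> \<in> minuscule" "rep_word is (unit_fun \<gamma>) = (\<lambda>\<epsilon>. c * unit_fun \<delta> \<epsilon>)"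
    "3 *s \<delta> - vec6 2 3 4 6 5 4 = weyl_word is (3 *s \<gamma> - vec6 2 3 4 6 5 4)" by blast
  let ?d = "\<delta> - pairing (simple_root i) \<delta> *s simple_root i"
  obtain k where k: "k \<noteq> 0" "?d \<in> minuscule" "rep_refl (simple_root i) 1 (unit_fun \<delta>) = (\<lambda>\<epsilon>. k * unit_fun ?d \<epsilon>)"
    using rep_refl_unit[of "simple_root i" \<delta>] IH(2) by auto
  have "rep_word (i # is) (unit_fun \<gamma>) = (\<lambda>\<epsilon>. c * rep_refl (simple_root i) 1 (unit_fun \<delta>) \<epsilon>)"
    using lift_scale[OF lift_refl_elt, of i 1 c "unit_fun \<delta>"] by (simp add: IH(3))
  then have 1: "rep_word (i # is) (unit_fun \<gamma>) = (\<lambda>\<epsilon>. (c * k) * unit_fun ?d \<epsilon>)" by (simp add: k(3) mult.assoc)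
  have "e6_form (vec6 2 3 4 6 5 4) (simple_root i) = 3 * simple_root i $ N6"
    by (cases i) (simp_all add: e6_form_explicit)
  then have "3 *s ?d - vec6 2 3 4 6 5 4 = simple_refl i (3 *s \<delta> - vec6 2 3 4 6 5 4)"
    by (simp add: simple_refl_def vec_eq_iff pairing_def e6_form_sym[of \<delta>] algebra_simps)
  then have "3 *s ?d - vec6 2 3 4 6 5 4 = weyl_word (i # is) (3 *s \<gamma> - vec6 2 3 4 6 5 4)"
    by (simp add: IH(4))
  then show ?case using 1 IH(1) k(1,2) by (intro exI[of _ "c * k"] exI[of _ ?d]) simp
qed

lemma rep_word_0_lowest:
  assumes "weyl_word is = w_0"
  shows "\<exists>c. c \<noteq> 0 \<and> rep_word is (unit_fun 0) = (\<lambda>\<epsilon>. c * unit_fun highest_weight \<epsilon>)"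
proof -
  obtain c \<delta> where c: "c \<noteq> 0" "rep_word is (unit_fun 0) = (\<lambda>\<epsilon>. c * unit_fun \<delta> \<epsilon>)"
    "3 *s \<delta> - vec6 2 3 4 6 5 4 = weyl_word is (3 *s 0 - vec6 2 3 4 6 5 4)"
    using rep_word_unit[of 0 "is"] by auto
  \<comment> \<open>The right side is \<open>3 \<omega>\<^sub>1\<close>, the image of
    \<open>- 3 \<omega>\<^sub>6\<close> under the longest element.\<close>
  have "3 *s \<delta> - vec6 2 3 4 6 5 4 = vec6 4 3 5 6 4 2"
    unfolding c(3) assms w_0_eq weyl_word_0_apply by simp
  then have "(3 *s \<delta> - vec6 2 3 4 6 5 4) $ i = vec6 4 3 5 6 4 2 $ i" for i by simp
  from this[of N1] this[of N2] this[of N3] this[of N4] this[of N5] this[of N6]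
  have "\<delta> = highest_weight" unfolding highest_weight_def by (intro vec6_eqI) simp_all
  then show ?thesis using c by blast
qed

text \<open>No weight lies below 0 and only 0 lies below \<open>simple_root N6\<close>, so among the
  two lowest coefficients a raising element can only add a multiple of the lowest to the next one;
  that multiple is the character at node 6.\<close>

lemma lift_U_plus:
  assumes "g \<in> U_plus"
  shows "\<exists>T. lift g T \<and> (\<forall>\<psi>. T \<psi> 0 = \<psi> 0 \<and>
     T \<psi> (simple_root N6) = \<psi> (simple_root N6) + unip_char 1 N6 g * \<psi> 0)"
  using assms unfolding U_plus_eq pos_roots_eq
proof (induction rule: unip_induct)
  case id
  have "unip_char 1 N6 id = 0" using unip_char_root_elt[of 1 "sroot 1 N1" N6 0] sroot_in_sroots[of 1 N1]
    by (simp add: root_elt_zero split: if_splits)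
  then have "\<forall>\<psi>. id \<psi> 0 = \<psi> 0 \<and>
     id \<psi> (simple_root N6) = \<psi> (simple_root N6) + unip_char 1 N6 id * \<psi> 0"
    by (simp only: id_apply) simp
  then show ?case using lift_id by blast
next
  case (root \<alpha> a)
  let ?v = "root_vec \<alpha>" and ?s = "simple_root N6"
  have pos: "lat_nonneg ?v" using root by (simp add: sroots_def one_scale)
  have s6: "?s \<in> minuscule" by (simp add: simple_root_vec6 minuscule_vec6)
  have "pairing ?v 0 \<noteq> 1" using pos by (auto simp: pairing_def lat_nonneg_def dest: spec[of _ N6])
  then have 1: "rep_elt ?v a \<psi> 0 = \<psi> 0" for \<psi> by (simp add: rep_elt_apply)
  have 2: "rep_elt ?v a \<psi> ?s = \<psi> ?s + unip_char 1 N6 (root_elt \<alpha> a) * \<psi> 0" for \<psi>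
  proof (cases "?v = ?s")
    case True
    then have "root_vec \<alpha> = root_vec (sroot 1 N6)" by (simp add: one_scale)
    then have "\<alpha> = sroot 1 N6" by (simp only: root_vec_inject)
    then have "unip_char 1 N6 (root_elt \<alpha> a) = a" using unip_char_root_elt[of 1 \<alpha> N6 a] root by simp
    then show ?thesis using s6 by (simp add: True rep_elt_apply e6_eps_self)
      (simp add: pairing_def e6_form_simple)
  next
    case False
    have "?s - ?v \<notin> minuscule"
    proof
      assume "?s - ?v \<in> minuscule"
      then have n: "lat_nonneg (?s - ?v)" by (rule minuscule_nonneg)
      have b: "0 \<le> ?v $ i \<and> ?v $ i \<le> (if N6 = i then 1 else 0)" for i
        using spec[OF n[unfolded lat_nonneg_def], of i] spec[OF pos[unfolded lat_nonneg_def], of i] by simp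
      have "?v $ i = (?v $ N6 *s ?s) $ i" for i
        using b[of i] by (cases "i = N6") simp_all
      then have v: "?v = ?v $ N6 *s ?s" unfolding vec_eq_iff by blast
      moreover have "?v $ N6 = 0 \<or> ?v $ N6 = 1" using b[of N6] by auto
      ultimately have "?v = 0 \<or> ?v = ?s" by (metis one_scale vector_smult_lzero)
      then show False using False is_root_nonzero[OF is_root_root_vec[of \<alpha>]] by blast
    qed
    then have "pairing ?v ?s \<noteq> 1" using minuscule_diff_iff[of ?v ?s] s6 by simp
    moreover have "\<alpha> \<noteq> sroot 1 N6" using False by (auto simp: one_scale)
    ultimately show ?thesis
      using unip_char_root_elt[of 1 \<alpha> N6 a] root s6 by (simp add: rep_elt_apply)
  qed
  show ?case using lift_root_elt 1 2 by blast
next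
  case (comp g h)
  obtain S where S: "lift g S" "\<And>\<psi>. S \<psi> 0 = \<psi> 0"
    "\<And>\<psi>. S \<psi> (simple_root N6) = \<psi> (simple_root N6) + unip_char 1 N6 g * \<psi> 0" using comp(3) by blast
  obtain T where T: "lift h T" "\<And>\<psi>. T \<psi> 0 = \<psi> 0"
    "\<And>\<psi>. T \<psi> (simple_root N6) = \<psi> (simple_root N6) + unip_char 1 N6 h * \<psi> 0" using comp(4) by blast
  have "unip_char 1 N6 (g \<circ> h) = unip_char 1 N6 g + unip_char 1 N6 h"
    using unip_char_comp[of 1 g h N6] comp(1,2) by simp
  then have "\<forall>\<psi>. (S \<circ> T) \<psi> 0 = \<psi> 0 \<and>
     (S \<circ> T) \<psi> (simple_root N6) = \<psi> (simple_root N6) + unip_char 1 N6 (g \<circ> h) * \<psi> 0"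
    by (simp only: o_apply S T) (simp add: algebra_simps)
  then show ?case using lift_comp[OF S(1) T(1)] by blast
qed

lemma lift_B_minus:
  assumes "g \<in> B_minus"
  shows "\<exists>T c. lift g T \<and> c \<noteq> 0 \<and> T (unit_fun 0) = (\<lambda>\<gamma>. c * unit_fun 0 \<gamma>)"
  using assms unfolding B_minus_eq
proof (induction rule: borel_induct)
  case id
  have "id (unit_fun 0) = (\<lambda>\<gamma>. 1 * unit_fun 0 \<gamma>)" by simp
  then show ?case using lift_id one_neq_zero by blast
next
  case (torus c)
  have "(\<lambda>\<gamma>. torus_char c \<gamma> * unit_fun 0 \<gamma>) = (\<lambda>\<gamma>. 1 * unit_fun 0 \<gamma>)" by (auto simp: unit_fun_def fun_eq_iff)
  moreover have "lift (torus_elt c) (\<lambda>\<phi> \<gamma>. torus_char c \<gamma> * \<phi> \<gamma>)"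
    by (rule lift_torus_elt_char[OF torus])
  ultimately show ?case using one_neq_zero by blast
next
  case (root \<alpha> a)
  have neg: "lat_nonneg (- root_vec \<alpha>)" using root by (simp add: neg_roots_iff)
  have "rep_root (root_vec \<alpha>) (unit_fun 0) \<gamma> = 0" for \<gamma>
  proof -
    have "root_vec \<alpha> \<notin> minuscule"
      using neg minuscule_nonneg lat_nonneg_antisym is_root_nonzero[OF is_root_root_vec] by blast
    then show ?thesis by (auto simp: rep_root_def unit_fun_def)
  qed
  then have "rep_elt (root_vec \<alpha>) a (unit_fun 0) = (\<lambda>\<gamma>. 1 * unit_fun 0 \<gamma>)" by (simp add: rep_elt_def)
  then show ?case using lift_root_elt one_neq_zero by blast
next
  case (comp g h)
  obtain S c where S: "lift g S" "c \<noteq> 0" "S (unit_fun 0) = (\<lambda>\<gamma>. c * unit_fun 0 \<gamma>)" using comp(3) by blast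
  obtain T d where T: "lift h T" "d \<noteq> 0" "T (unit_fun 0) = (\<lambda>\<gamma>. d * unit_fun 0 \<gamma>)" using comp(4) by blast
  have "(S \<circ> T) (unit_fun 0) = (\<lambda>\<gamma>. (d * c) * unit_fun 0 \<gamma>)"
    by (simp add: T(3) lift_scale[OF S(1)] S(3) mult.assoc)
  moreover have "d * c \<noteq> 0" using S T by simp
  ultimately show ?case using lift_comp[OF S(1) T(1)] by blast
qed

text \<open>A nonzero weight \<open>\<gamma>\<close> satisfies
  \<open>pairing \<gamma> \<gamma> = \<gamma> $ N6 > 0\<close>, so some simple root can be
  subtracted from it; the corresponding lowering operator would expose the coefficient at
  \<open>\<gamma>\<close>.\<close>

lemma lowest_weight_vector:
  assumes supp: "\<And>\<gamma>. \<gamma> \<notin> minuscule \<Longrightarrow> x \<gamma> = 0"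
    and low: "\<And>i. rep (root_vector (sroot (- 1) i)) x = (\<lambda>_. 0)"
  shows "x = (\<lambda>\<gamma>. x 0 * unit_fun 0 \<gamma>)"
proof
  fix \<gamma>
  show "x \<gamma> = x 0 * unit_fun 0 \<gamma>"
  proof (cases "\<gamma> \<in> minuscule \<and> \<gamma> \<noteq> 0")
    case True
    have "\<exists>i. 0 < pairing (simple_root i) \<gamma>"
    proof (rule ccontr)
      assume "\<not> ?thesis"
      then have "pairing (simple_root i) \<gamma> \<le> 0" for i by (auto simp: not_less)
      then have "\<gamma> $ i * pairing (simple_root i) \<gamma> \<le> 0" for i
        using minuscule_nonneg[of \<gamma>] True by (intro mult_nonneg_nonpos) (auto simp: lat_nonneg_def)
      then have "pairing \<gamma> \<gamma> \<le> 0" unfolding pairing_expand[of \<gamma> \<gamma>] by (intro sum_nonpos) auto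
      then have "\<gamma> $ N6 \<le> 0" using True by (simp add: pairing_def minuscule_def)
      then have "e6_form \<gamma> \<gamma> \<le> 0" using True by (simp add: minuscule_def)
      then have "e6_form \<gamma> \<gamma> = 0" using e6_form_nonneg[of \<gamma>] by simp
      then show False using True by (simp add: e6_form_eq_0)
    qed
    then obtain i where i: "0 < pairing (simple_root i) \<gamma>" by blast
    then have "pairing (simple_root i) \<gamma> = 1" using pairing_bounds(2)[of "simple_root i" \<gamma>] True by simp
    then have m: "\<gamma> - simple_root i \<in> minuscule" using minuscule_diff_iff[of "simple_root i" \<gamma>] True by simp
    have "rep_root (- simple_root i) x (\<gamma> - simple_root i) = 0"
      using fun_cong[OF low[of i], of "\<gamma> - simple_root i"] by (simp add: rep_root_vector minus_one_scale)
    then have "x \<gamma> = 0" using True m by (simp add: rep_root_def)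
    then show ?thesis using True by (simp add: unit_fun_def)
  next
    case False
    then show ?thesis using supp[of \<gamma>] by (auto simp: unit_fun_def)
  qed
qed

text \<open>\<open>T\<close> and the lift assembled from \<open>up\<close> and \<open>bm\<close>
  induce the same automorphism, so the vector \<open>x\<close> relating them is killed by all
  lowering operators and is a multiple of the lowest weight vector. The ratio of coefficients is
  thus the same for every lift.\<close>

lemma lift_ratio:
  assumes up: "up \<in> U_plus" and bm: "bm \<in> B_minus" and T: "lift (up \<circ> bm) T"
  shows "unip_char 1 N6 up * T (unit_fun 0) 0 = T (unit_fun 0) (simple_root N6)"
proof -
  obtain S where S: "lift up S" "\<And>\<psi>. S \<psi> 0 = \<psi> 0"
    "\<And>\<psi>. S \<psi> (simple_root N6) = \<psi> (simple_root N6) + unip_char 1 N6 up * \<psi> 0" using lift_U_plus[OF up] by blast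
  obtain R c where R: "lift bm R" "c \<noteq> 0" "R (unit_fun 0) = (\<lambda>\<gamma>. c * unit_fun 0 \<gamma>)" using lift_B_minus[OF bm] by blast
  have L: "lift (up \<circ> bm) (S \<circ> R)" by (rule lift_comp[OF S(1) R(1)])
  obtain x where x: "T (unit_fun 0) = (S \<circ> R) x" using lift_bij[OF L] by (metis bij_pointE)
  have "\<forall>\<gamma>. \<gamma> \<notin> minuscule \<longrightarrow> unit_fun 0 \<gamma> = 0" by (auto simp: unit_fun_def)
  then have "\<forall>\<gamma>. \<gamma> \<notin> minuscule \<longrightarrow> T (unit_fun 0) \<gamma> = 0" using lift_supp[OF T] by blast
  then have supp: "\<forall>\<gamma>. \<gamma> \<notin> minuscule \<longrightarrow> x \<gamma> = 0" unfolding x using lift_supp[OF L] by blast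
  have "rep (root_vector (sroot (- 1) i)) x = (\<lambda>_. 0)" for i
  proof -
    let ?f = "root_vector (sroot (- 1) i)"
    have f0: "rep ?f (unit_fun 0) = (\<lambda>_. 0)"
    proof
      fix \<gamma>
      have "- simple_root i \<notin> minuscule" using minuscule_nonneg[of "- simple_root i"] by auto
      then show "rep ?f (unit_fun 0) \<gamma> = 0"
        by (auto simp: rep_root_vector minus_one_scale rep_root_def unit_fun_def add_eq_0_iff2)
    qed
    have "(S \<circ> R) (rep ?f x) = rep ((up \<circ> bm) ?f) ((S \<circ> R) x)" by (rule lift_rep[OF L])
    also have "\<dots> = T (rep ?f (unit_fun 0))" unfolding lift_rep[OF T] x ..
    also have "\<dots> = (\<lambda>_. 0)" unfolding f0 by (rule lift_zero[OF T])
    also have "\<dots> = (S \<circ> R) (\<lambda>_. 0)" using lift_zero[OF L] ..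
    finally show ?thesis using lift_bij[OF L] by (metis bij_def injD)
  qed
  then have "x = (\<lambda>\<gamma>. x 0 * unit_fun 0 \<gamma>)" using lowest_weight_vector supp by blast
  then have "T (unit_fun 0) = (S \<circ> R) (\<lambda>\<gamma>. x 0 * unit_fun 0 \<gamma>)" using x by metis
  also have "\<dots> = (\<lambda>\<gamma>. x 0 * S (R (unit_fun 0)) \<gamma>)" using lift_scale[OF L, of "x 0" "unit_fun 0"] by simp
  finally have "T (unit_fun 0) = (\<lambda>\<gamma>. x 0 * (c * S (unit_fun 0) \<gamma>))"
    unfolding R(3) lift_scale[OF S(1)] .
  then have v: "T (unit_fun 0) \<gamma> = x 0 * (c * S (unit_fun 0) \<gamma>)" for \<gamma> by simp
  have "simple_root N6 \<noteq> 0" using is_root_nonzero[OF is_root_simple] .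
  then show ?thesis unfolding v S by (simp add: unit_fun_def)
qed

lemma root_char_torus_elt:
  "root_char i (torus_elt c) = c i"
proof -
  have e: "chev_e i = root_vector (sroot 1 i)" by (simp add: chev_e_def sroot_def one_scale)
  have "torus_elt c (chev_e i) = c i *s chev_e i"
    unfolding e torus_elt_root_vector by (simp add: one_scale)
  moreover have "chev_e i \<noteq> 0" by (simp add: e root_vector_def axis_eq_0_iff)
  ultimately show ?thesis unfolding root_char_def by (intro the_equality) simp_all
qed

lemma unip_char_quantum_term:
  assumes up: "up \<in> U_plus" and t: "t \<in> torus" and bm: "bm \<in> B_minus"
    and um: "um = gprod (map (\<lambda>(i, a). y_sub i a) (cayley_word a))"
    and eq: "up \<circ> t \<circ> nP \<circ> um \<circ> n0 = bm" and a: "\<And>i. i \<in> {1..16} \<Longrightarrow> a i \<noteq> 0"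
  shows "unip_char 1 N6 (inv\<^bsub>G_ad\<^esub> up) = root_char N6 t * (cayley_poly a / (\<Prod>i=1..16. a i))"
proof -
  obtain c where c: "t = torus_elt c" "\<And>i. c i \<noteq> 0" using t by (auto simp: torus_def)
  obtain isP where P: "reduced_expr isP w_P" "nP = gprod (map s_bar isP)" using ex_w_bar[OF w_P_eq] by blast
  obtain is0 where z: "weyl_word is0 = w_0" "n0 = gprod (map s_bar is0)" using ex_w_bar[OF w_0_eq] by blast
  let ?D = "\<lambda>\<phi> \<gamma>. torus_char c \<gamma> * \<phi> \<gamma>"
  \<comment> \<open>A second lift of the element to which \<open>lift_ratio\<close> applies, this
    time built from factors with known coefficients.\<close>
  define T where "T = ?D \<circ> (rep_word isP \<circ> (rep_lower (cayley_word a) \<circ> rep_word is0))"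
  have L: "lift (t \<circ> (nP \<circ> (um \<circ> n0))) T"
    unfolding T_def c(1) P(2) z(2) um
    by (intro lift_comp lift_torus_elt_char c(2) lift_rep_word lift_y_word)
  have "inv\<^bsub>G_ad\<^esub> up \<circ> bm = (inv\<^bsub>G_ad\<^esub> up \<circ> up) \<circ> (t \<circ> (nP \<circ> (um \<circ> n0)))"
    unfolding eq[symmetric] by (simp only: comp_assoc)
  then have "inv\<^bsub>G_ad\<^esub> up \<circ> bm = t \<circ> (nP \<circ> (um \<circ> n0))"
    by (simp only: G_ad_inv_comp[OF U_plus_in_G_ad[OF up]] id_comp)
  then have L': "lift (inv\<^bsub>G_ad\<^esub> up \<circ> bm) T" using L by simp
  have "inv\<^bsub>G_ad\<^esub> up \<in> U_plus" using up by (simp add: U_plus_eq unip_inv)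
  then have ratio: "unip_char 1 N6 (inv\<^bsub>G_ad\<^esub> up) * T (unit_fun 0) 0 = T (unit_fun 0) (simple_root N6)"
    by (rule lift_ratio[OF _ bm L'])
  obtain k where k: "k \<noteq> 0" "rep_word is0 (unit_fun 0) = (\<lambda>\<epsilon>. k * unit_fun highest_weight \<epsilon>)"
    using rep_word_0_lowest[OF z(1)] by blast
  define \<psi> where "\<psi> = rep_lower (cayley_word a) (unit_fun highest_weight)"
  have T0: "T (unit_fun 0) = (\<lambda>\<gamma>. torus_char c \<gamma> * (k * rep_word isP \<psi> \<gamma>))"
    unfolding T_def o_apply k(2) lift_scale[OF lift_y_word] lift_scale[OF lift_rep_word] \<psi>_def ..
  have s: "set isP \<subseteq> UNIV - {N6}"
    using reduced_expr_weyl_P[of isP word_P] P(1) word_P_subset by (simp add: w_P_eq)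
  \<comment> \<open>This coefficient and the next share the sign and the scalar \<open>k\<close>,
    which cancel; the torus contributes 1 at offset 0 and \<open>c N6\<close> at
    \<open>simple_root N6\<close>.\<close>
  have "T (unit_fun 0) 0 = - (k * (\<Prod>i=1..16. a i))"
    unfolding T0 rep_word_lowest[OF s] \<psi>_def rep_lower_cayley_lowest by simp
  moreover have "T (unit_fun 0) (simple_root N6) = - (c N6 * k * cayley_poly a)"
    unfolding T0 rep_word_P_theta[OF P(1)] \<psi>_def rep_lower_cayley_theta by simp
  moreover have "(\<Prod>i=1..16. a i) \<noteq> 0" using a by simp
  ultimately have "unip_char 1 N6 (inv\<^bsub>G_ad\<^esub> up) = c N6 * (cayley_poly a / (\<Prod>i=1..16. a i))"
    using ratio k(1) by (simp add: field_simps)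
  then show ?thesis by (simp add: c(1) root_char_torus_elt)
qed

section \<open>The potential\<close>

lemma y_word_U_minus: "gprod (map (\<lambda>(i, a). y_sub i a) ps) \<in> U_minus"
  unfolding U_minus_eq neg_roots_eq
proof (induction ps)
  case Nil
  show ?case by (simp only: list.map gprod_Nil unip_id)
next
  case (Cons p ps)
  obtain i a where p: "p = (i, a)" by force
  have "y_sub i a \<in> unip (sroots (- 1))"
    unfolding y_sub_sroot by (intro root_elt_in_unip sroot_in_sroots) simp
  then show ?case using Cons by (simp only: p list.map prod.case gprod_Cons unip_comp)
qed

lemma unip_char_y_word:
  "unip_char (- 1) j (gprod (map (\<lambda>(i, a). y_sub i a) ps)) = (\<Sum>(i, a)\<leftarrow>ps. if i = j then a else 0)"
proof (induction ps)
  case Nil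
  have "unip_char (- 1) j (root_elt (sroot (- 1) j) 0) = 0"
    using unip_char_root_elt[of "- 1" "sroot (- 1) j" j 0] sroot_in_sroots[of "- 1" j] by simp
  then show ?case by (simp only: list.map gprod_Nil sum_list.Nil root_elt_zero)
next
  case (Cons p ps)
  obtain i a where p: "p = (i, a)" by force
  have m: "sroot (- 1) i \<in> sroots (- 1)" by (rule sroot_in_sroots) simp
  have y: "y_sub i a \<in> unip (sroots (- 1))" unfolding y_sub_sroot by (rule root_elt_in_unip[OF m])
  have "sroot (- 1) i = sroot (- 1) j \<longleftrightarrow> i = j"
  proof
    assume "sroot (- 1) i = sroot (- 1) j"
    then have "root_vec (sroot (- 1) i) $ i = root_vec (sroot (- 1) j) $ i" by simp
    then show "i = j" by (simp add: minus_one_scale split: if_splits)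
  qed simp
  then have "unip_char (- 1) j (y_sub i a) = (if i = j then a else 0)"
    unfolding y_sub_sroot using unip_char_root_elt[of "- 1" "sroot (- 1) i" j "- a"] m by simp
  moreover have "unip_char (- 1) j (y_sub i a \<circ> gprod (map (\<lambda>(i, a). y_sub i a) ps))
     = unip_char (- 1) j (y_sub i a) + unip_char (- 1) j (gprod (map (\<lambda>(i, a). y_sub i a) ps))"
    using y y_word_U_minus by (intro unip_char_comp) (simp_all add: U_minus_eq neg_roots_eq)
  ultimately show ?case using Cons by (simp only: p list.map prod.case gprod_Cons sum_list.Cons)
qed

lemma sum_f_star_y_word:
  "(\<Sum>j\<in>UNIV. f_star j (gprod (map (\<lambda>(i, a). y_sub i a) ps))) = sum_list (map snd ps)"
proof -
  have "(\<Sum>j\<in>UNIV. \<Sum>(i, a)\<leftarrow>ps. if i = j then a else 0) = sum_list (map snd ps)"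
    by (induction ps) (auto simp: sum.distrib)
  then show ?thesis using f_star_eq[OF y_word_U_minus] by (simp add: unip_char_y_word)
qed

text \<open>The parameters are given through the inverse of the lower factor, so the factor itself
  has to be recovered by cancelling from the middle.\<close>

lemma inv_y_word:
  "gprod (map (\<lambda>k. y_sub (f k) (- a k)) ks) \<circ> gprod (map (\<lambda>(i, a). y_sub i a) (map (\<lambda>k. (f k, a k)) (rev ks))) = id"
proof (induction ks)
  case Nil
  show ?case by (simp only: list.map rev.simps gprod_Nil comp_id)
next
  case (Cons k ks)
  let ?y = "gprod (map (\<lambda>(i, a). y_sub i a) (map (\<lambda>k. (f k, a k)) (rev ks)))"
  have "y_sub (f k) (- a k) \<circ> y_sub (f k) (a k) = id"
    by (simp add: y_sub_sroot root_elt_add root_elt_zero)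
  moreover have "gprod (map (\<lambda>k. y_sub (f k) (- a k)) (k # ks)) \<circ>
      gprod (map (\<lambda>(i, a). y_sub i a) (map (\<lambda>k. (f k, a k)) (rev (k # ks))))
    = y_sub (f k) (- a k) \<circ> ((gprod (map (\<lambda>k. y_sub (f k) (- a k)) ks) \<circ> ?y) \<circ> y_sub (f k) (a k))"
    by (simp only: list.map rev.simps map_append gprod_append gprod_Cons gprod_Nil comp_id prod.case comp_assoc)
  ultimately show ?case using Cons by (simp only: id_comp)
qed

lemma cayley_word_bruhat_cell:
  assumes "\<And>i. i \<in> {1..16} \<Longrightarrow> a i \<noteq> 0"
  shows "gprod (map (\<lambda>(i, a). y_sub i a) (cayley_word a)) \<in> bruhat_cell (nP \<circ> n0)"
proof -
  obtain isP where P: "weyl_word isP = w_P" "nP = gprod (map s_bar isP)" using ex_w_bar[OF w_P_eq] by blast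
  obtain is0 where z: "weyl_word is0 = w_0" "n0 = gprod (map s_bar is0)" using ex_w_bar[OF w_0_eq] by blast
  have "positive_word (map fst (cayley_word a))"
    unfolding map_fst_cayley_word by (simp add: word_upper_P_def weyl_eval)
  moreover have "\<forall>(i, x)\<in>set (cayley_word a). x \<noteq> 0"
    using assms by (auto simp: cayley_word_def)
  ultimately have "gprod (map (\<lambda>(i, a). y_sub i a) (cayley_word a))
      \<in> bruhat_cell (gprod (map s_bar (rev word_upper_P)))"
    using y_word_bruhat_cell[of "cayley_word a"] by (simp only: map_fst_cayley_word)
  \<comment> \<open>The factors of the lower element appear in the order of the inverse word, and
    the inverse of \<open>w_0\<close> times \<open>w_P\<close> is \<open>w_P\<close> times
    \<open>w_0\<close>.\<close>
  also have "weyl_word (rev word_upper_P) = weyl_word (word_P @ word_0)"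
  proof (rule weyl_word_eqI)
    fix i show "weyl_word (rev word_upper_P) (simple_root i) = weyl_word (word_P @ word_0) (simple_root i)"
      by (cases i) (simp_all add: weyl_word_append weyl_word_P_apply weyl_word_0_apply word_upper_P_def weyl_eval)
  qed
  then have "weyl_word (rev word_upper_P) = weyl_word (isP @ is0)"
    by (simp add: weyl_word_append P(1) z(1) w_P_eq w_0_eq)
  then have "bruhat_cell (gprod (map s_bar (rev word_upper_P))) \<subseteq> bruhat_cell (gprod (map s_bar (isP @ is0)))"
    by (rule bruhat_cell_cong)
  finally show ?thesis by (simp only: map_append gprod_append P(2) z(2))
qed

theorem mainTheorem3:
  fixes rs :: "e6_node list"
  assumes rs: "rs = [N1, N3, N4, N2, N5, N6, N4, N5, N3, N4, N2, N1, N3, N4, N5, N6]"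
  shows "reduced_expr rs w_upper_P \<and>
    {is. reduced_expr is w_prime} = {[N1, N3, N4, N5, N6]} \<and>
    (\<forall>z up t um a q.
      z \<in> Z_P_circ rs \<and> up \<in> U_plus \<and> t \<in> T_P \<and> um \<in> U_minus_circ rs \<and>
      z = up \<otimes>\<^bsub>G_ad\<^esub> t \<otimes>\<^bsub>G_ad\<^esub> w_bar w_P \<otimes>\<^bsub>G_ad\<^esub> um \<and>
      (\<forall>i\<in>{1..16}. a i \<noteq> 0) \<and>
      inv\<^bsub>G_ad\<^esub> um = gprod (map (\<lambda>k. y_sub (rs ! (k - 1)) (- a k)) [1..<17]) \<and>
      q = root_char N6 t \<longrightarrow>
      potential_circ rs z =
        (\<Sum>i=1..16. a i) + q * (cayley_poly a / (\<Prod>i=1..16. a i)))"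
proof (intro conjI allI impI)
  have rs': "rs = word_upper_P" using rs by (simp add: word_upper_P_def)
  show "reduced_expr rs w_upper_P" unfolding rs' by (rule reduced_word_upper_P)
  show "{is. reduced_expr is w_prime} = {[N1, N3, N4, N5, N6]}" by (rule reduced_expr_w_prime)
  fix z up t um and a :: "nat \<Rightarrow> complex" and q
  assume "z \<in> Z_P_circ rs \<and> up \<in> U_plus \<and> t \<in> T_P \<and> um \<in> U_minus_circ rs \<and>
      z = up \<otimes>\<^bsub>G_ad\<^esub> t \<otimes>\<^bsub>G_ad\<^esub> w_bar w_P \<otimes>\<^bsub>G_ad\<^esub> um \<and>
      (\<forall>i\<in>{1..16}. a i \<noteq> 0) \<and>
      inv\<^bsub>G_ad\<^esub> um = gprod (map (\<lambda>k. y_sub (rs ! (k - 1)) (- a k)) [1..<17]) \<and>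
      q = root_char N6 t"
  then have z: "z \<in> Z_P_circ rs" and up: "up \<in> U_plus" and t: "t \<in> T_P" and um: "um \<in> U_minus_circ rs"
    and z_eq: "z = up \<circ> t \<circ> nP \<circ> um" and a: "\<And>i. i \<in> {1..16} \<Longrightarrow> a i \<noteq> 0"
    and inv_um: "inv\<^bsub>G_ad\<^esub> um = gprod (map (\<lambda>k. y_sub (word_upper_P ! (k - 1)) (- a k)) [1..<17])"
    and q: "q = root_char N6 t"
    by (auto simp only: G_ad_mult rs')
  \<comment> \<open>Membership of \<open>um\<close> comes with parameters of its own, unrelated so
    far to \<open>a\<close>; it is used to have \<open>um\<close> in the group and to pass from
    \<open>Z_P_circ\<close> to \<open>Z_P\<close>.\<close>
  have U: "U_minus_circ rs \<subseteq> U_minus"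
  proof
    fix u assume "u \<in> U_minus_circ rs"
    then obtain b where "u = gprod (map (\<lambda>k. y_sub (rs ! (k - 1)) (b k)) (rev [1..<length rs + 1]))"
      by (auto simp: U_minus_circ_def)
    then have "u = gprod (map (\<lambda>(i, a). y_sub i a) (map (\<lambda>k. (rs ! (k - 1), b k)) (rev [1..<length rs + 1])))"
      by (simp add: comp_def)
    then show "u \<in> U_minus" by (simp only: y_word_U_minus)
  qed
  let ?y = "gprod (map (\<lambda>(i, a). y_sub i a) (cayley_word a))"
  have umG: "um \<in> carrier G_ad" and yG: "?y \<in> carrier G_ad"
    using U um U_minus_in_G_ad y_word_U_minus by blast+
  have "inv\<^bsub>G_ad\<^esub> um \<circ> ?y = id"
    unfolding inv_um cayley_word_def by (rule inv_y_word)
  then have "um \<circ> (inv\<^bsub>G_ad\<^esub> um \<circ> ?y) = um" by (simp only: comp_id)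
  then have um_eq: "um = ?y" by (simp only: comp_assoc[symmetric] G_ad_inv_comp[OF umG] id_comp)
  have cell: "um \<in> bruhat_cell (nP \<circ> n0)" unfolding um_eq by (rule cayley_word_bruhat_cell[OF a])
  have "um \<in> U_minus_P" using cell U um by (auto simp: U_minus_P_eq)
  then have dec: "Z_decomp z = (up, t, um)" using up t z_eq by (intro Z_decomp_eq)
  \<comment> \<open>Both \<open>potential_circ\<close> and \<open>potential\<close> are restricted
    functions, so each membership is needed to unfold a value.\<close>
  have zP: "z \<in> Z_P"
    using z U by (auto simp: Z_P_circ_def Z_P_def set_mult_def)
  have tor: "t \<in> torus" using t by (rule T_P_torus)
  obtain bm where bm: "bm \<in> B_minus" "z = bm \<circ> inv\<^bsub>G_ad\<^esub> n0"
    using z by (auto simp: Z_P_circ_def r_coset_def)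
  have "up \<circ> t \<circ> nP \<circ> um \<circ> n0 = bm \<circ> (inv\<^bsub>G_ad\<^esub> n0 \<circ> n0)"
    using bm(2) z_eq by (simp only: comp_assoc)
  then have eq: "up \<circ> t \<circ> nP \<circ> um \<circ> n0 = bm"
    by (simp only: G_ad_inv_comp[OF n0_in_G_ad] comp_id)
  have iup: "inv\<^bsub>G_ad\<^esub> up \<in> U_plus" using up by (simp add: U_plus_eq unip_inv)
  have "e_star i (inv\<^bsub>G_ad\<^esub> up) = (if i = N6 then q * (cayley_poly a / (\<Prod>i=1..16. a i)) else 0)" for i
    using unip_char_inv_zero[OF up tor cell bm(1) eq, of i]
      unip_char_quantum_term[OF up tor bm(1) um_eq eq a] q
    by (simp add: e_star_eq[OF iup])
  then have "(\<Sum>i\<in>UNIV. e_star i (inv\<^bsub>G_ad\<^esub> up)) = q * (cayley_poly a / (\<Prod>i=1..16. a i))"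
    by simp
  moreover have "(\<Sum>i\<in>UNIV. f_star i um) = (\<Sum>i=1..16. a i)"
    unfolding um_eq sum_f_star_y_word by (rule sum_cayley_word)
  ultimately show "potential_circ rs z = (\<Sum>i=1..16. a i) + q * (cayley_poly a / (\<Prod>i=1..16. a i))"
    using z zP dec by (simp add: potential_circ_def potential_def)
qed

end
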